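(* For all $\varepsilon,\delta\in(0,1)$ there is a $(b,w)$-hidden-batch random order streaming algorithm that, for an input graph $G$ with $n$ vertices and $m$ edges, outputs an estimate $\hat c$ with $|\hat c - c(G)|\le \varepsilon n$ with probability at least $1-\delta$, using $(1/(\varepsilon\delta))^{O(1/\varepsilon)}\,(b+wm)\,\mathrm{polylog}(n)$ bits of space.
   Context: $c(G)$ denotes the number of connected components of $G$. The $(b,w)$-hidden-batch random order stream model: an adversary partitions the edge set $E$ into batches of size at most $b$; each batch $B$ receives an independent uniform start time $\mathbf t_B\in[0,1]$; the adversary assigns each edge $e\in B$ a timestamp $\mathbf t_e\in[\mathbf t_B,\mathbf t_B+w]$; the pairs $(e,\mathbf t_e)$ are presented in non-decreasing order of $\mathbf t_e$ (ties broken adversarially), timestamps given to precision $\mathrm{poly}(1/n)$. The batches are not known to the algorithm. Probability is over the algorithm's internal randomness and the random batch times. *)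

theory Defs
  imports "HOL-Probability.Probability" "HOL-Library.Disjoint_Sets"
    "HOL-Computational_Algebra.Polynomial"
begin

section \<open>Graphs on the vertex set {..<n}\<close>

definition simple_graph :: "nat \<Rightarrow> nat set set \<Rightarrow> bool" where
  "simple_graph n E \<longleftrightarrow> E \<subseteq> {e. e \<subseteq> {..<n} \<and> card e = 2}"

definition reachable :: "nat \<Rightarrow> nat set set \<Rightarrow> (nat \<times> nat) set" where
  "reachable n E = {(u, v). u < n \<and> v < n \<and> (u, v) \<in> {(x, y). {x, y} \<in> E}\<^sup>*}"

definition num_components :: "nat \<Rightarrow> nat set set \<Rightarrow> nat" where
  "num_components n E = card ({..<n} // reachable n E)"


section \<open>Hidden-batch random order streams\<close>

definition start_times :: "nat set set set \<Rightarrow> (nat set set \<Rightarrow> real) measure" where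
  "start_times \<B> = (\<Pi>\<^sub>M B\<in>\<B>. uniform_measure lborel {0..1})"

text \<open>The algorithm sees timestamps only to precision \<open>1 / n ^ \<kappa>\<close>; they are encoded as the
  integer multiple of \<open>1 / n ^ \<kappa>\<close> obtained by rounding down.\<close>

definition presented ::
    "nat \<Rightarrow> nat \<Rightarrow> (nat set \<times> real) list \<Rightarrow> (nat set \<times> int) list" where
  "presented \<kappa> n = map (\<lambda>(e, x). (e, \<lfloor>x * real n ^ \<kappa>\<rfloor>))"

text \<open>An adversary is a partition \<open>\<B>\<close>, fixed before the start times are drawn, together with a
  map \<open>\<sigma>\<close> sending the drawn start times (of all batches) to the timestamped stream. The list
  \<open>\<sigma> t\<close> carries both the choice of timestamps and the breaking of ties, since \<open>sorted\<close> is the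
  non-strict order. The order is that of the exact timestamps. Measurability of the presented
  stream makes it a random variable, so that success probabilities are defined.\<close>

definition hidden_batch_adversary ::
    "nat \<Rightarrow> real \<Rightarrow> nat \<Rightarrow> nat \<Rightarrow> nat set set \<Rightarrow> nat set set set
      \<Rightarrow> ((nat set set \<Rightarrow> real) \<Rightarrow> (nat set \<times> real) list) \<Rightarrow> bool" where
  "hidden_batch_adversary b w \<kappa> n E \<B> \<sigma> \<longleftrightarrow>
     partition_on E \<B> \<and> (\<forall>B\<in>\<B>. card B \<le> b) \<and>
     (\<forall>t \<in> (\<Pi>\<^sub>E B\<in>\<B>. {0..1}).
        distinct (map fst (\<sigma> t)) \<and> set (map fst (\<sigma> t)) = E \<and>
        sorted (map snd (\<sigma> t)) \<and>
        (\<forall>B\<in>\<B>. \<forall>(e, x)\<in>set (\<sigma> t). e \<in> B \<longrightarrow> t B \<le> x \<and> x \<le> t B + w)) \<and>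
     (\<lambda>t. presented \<kappa> n (\<sigma> t)) \<in> start_times \<B> \<rightarrow>\<^sub>M count_space UNIV"


section \<open>Randomized streaming algorithms\<close>

text \<open>The memory content is a bit string. Fresh randomness is available in every step, but has to
  be kept in memory in order to be reused.\<close>

record streaming_algorithm =
  alg_init :: "bool list pmf"
  alg_step :: "bool list \<Rightarrow> nat set \<times> int \<Rightarrow> bool list pmf"
  alg_output :: "bool list \<Rightarrow> real"

definition run :: "streaming_algorithm \<Rightarrow> (nat set \<times> int) list \<Rightarrow> bool list pmf" where
  "run A xs = foldl (\<lambda>p x. bind_pmf p (\<lambda>s. alg_step A s x)) (alg_init A) xs"

text \<open>Worst case over the internal randomness and over all points of time in the stream.\<close>

definition space_at_most ::
    "streaming_algorithm \<Rightarrow> (nat set \<times> int) list \<Rightarrow> real \<Rightarrow> bool" where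
  "space_at_most A xs S \<longleftrightarrow>
     (\<forall>k\<le>length xs. \<forall>s\<in>set_pmf (run A (take k xs)). real (length s) \<le> S)"

text \<open>Distribution of the estimate, over the batch start times and the (independent) internal
  randomness of the algorithm.\<close>

definition estimate_distribution ::
    "streaming_algorithm \<Rightarrow> nat \<Rightarrow> nat \<Rightarrow> nat set set set
      \<Rightarrow> ((nat set set \<Rightarrow> real) \<Rightarrow> (nat set \<times> real) list) \<Rightarrow> real measure" where
  "estimate_distribution A \<kappa> n \<B> \<sigma> =
     Giry_Monad.bind (start_times \<B>)
       (\<lambda>t. measure_pmf (map_pmf (alg_output A) (run A (presented \<kappa> n (\<sigma> t)))))"

end

theory Submission
  imports Defs
begin

text \<open>Time is cut into cells slightly longer than \<open>w\<close>, and these are grouped into slots. A tracker grows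
the component of a random vertex: at level \<open>j\<close> it waits for slot \<open>j + 1\<close>, takes the cell with the
edge of least key crossing the set grown so far, and keeps all edges of that cell. It is discarded if
a smaller crossing edge arrives later. In the underlying decision tree every batch is queried at most
once: it is blocked with a small probability \<open>p\<close>, taken with probability \<open>\<rho>\<close>, or else the tracker is
discarded. Weighting each taken batch by \<open>1 / \<rho>\<close>, the paths without blocked batches contribute
exactly \<open>1 / card C\<close> to the expectation when the component \<open>C\<close> is small, and all other paths contribute at
most \<open>k * p * (1 - p) ^ - k\<close>; summing over the vertices counts the components. Unless an unlikely
event occurs, the tracker follows the tree, and the contributions of two vertices are dependent only
through shared batches, which bounds the variance. If \<open>b\<close> or \<open>w\<close> is too large or \<open>n\<close> too small for
this, the space bound allows storing a spanning star forest.\<close>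

section \<open>Components and crossing edges\<close>

text \<open>A tracker does not know what passed before the current slot, so it cannot tell whether
  the batch it ought to query has gone by. Being blocked has a small probability p, but the wrong
  branch that follows may carry a weight as large as (1/\<rho>)^k, and the product of the two is no
  use as a bound. What helps is that every factor 1/\<rho> is earned with probability exactly
  \<rho>, so that in expectation only a factor p for the blocked batch is left. This requires the
  time of a batch to be independent of the decision to query it: the batch to be queried is
  determined by keys and earlier answers, never by the order of arrival, and an edge that would have
  been preferred but comes too late discards the tracker. The exponents in the space bound stem from
  the size of the weights. With X about 1/(\<epsilon>\<delta>) and k about 4/\<epsilon>, they reach
  X^(13 k), so the unlikely events may have probability at most about X^(-15 k), although the times
  of up to X^(5 k) batches matter for one vertex. Cells must then be longer than w by a factor X^(25
  k) and shorter than X^(-33 k).\<close>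

definition all_edges :: "nat \<Rightarrow> nat set set" where
  "all_edges n = {e. e \<subseteq> {..<n} \<and> card e = 2}"

definition adj :: "nat set set \<Rightarrow> (nat \<times> nat) set" where
  "adj F = {(x, y). {x, y} \<in> F}"

definition component :: "nat \<Rightarrow> nat set set \<Rightarrow> nat set" where
  "component v F = (adj F)\<^sup>* `` {v}"

definition crossing :: "nat set \<Rightarrow> nat set \<Rightarrow> bool" where
  "crossing S e \<longleftrightarrow> (\<exists>x\<in>e. x \<in> S) \<and> (\<exists>y\<in>e. y \<notin> S)"

lemma finite_all_edges: "finite (all_edges n)"
  by (rule finite_subset[of _ "Pow {..<n}"]) (auto simp: all_edges_def)

lemma card_all_edges_le: "card (all_edges n) \<le> n ^ 2"
proof (cases "2 \<le> n")
  case True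
  have "card (all_edges n) = n choose 2"
    using n_subsets[of "{..<n}" 2] by (simp add: all_edges_def)
  then show ?thesis using binomial_le_pow[OF True] by simp
next
  case False
  have "card e \<noteq> 2" if "e \<subseteq> {..<n}" for e
    using card_mono[OF finite_lessThan that] False by simp
  then have "all_edges n = {}" by (simp add: all_edges_def)
  then show ?thesis by simp
qed

text \<open>One injective numbering serves twice: as the order in which crossing edges are preferred
  and, being below n^2, as the code of an edge in memory.\<close>

lemma ex_edge_key:
  "\<exists>key :: nat set \<Rightarrow> nat. inj_on key (all_edges n) \<and> key ` all_edges n \<subseteq> {..<n ^ 2}"
proof -
  obtain f where "bij_betw f (all_edges n) {0..<card (all_edges n)}"
    using ex_bij_betw_finite_nat[OF finite_all_edges] by blast
  then have "inj_on f (all_edges n)" "f ` all_edges n = {..<card (all_edges n)}"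
    by (auto simp: bij_betw_def lessThan_atLeast0)
  then show ?thesis
    using card_all_edges_le[of n] by (metis lessThan_subset_iff)
qed

lemma all_edges_doubleton:
  assumes "e \<in> all_edges n" obtains x y where "e = {x, y}" "x \<noteq> y" "x < n" "y < n"
  using assms by (auto simp: all_edges_def card_2_iff)

lemma sym_adj: "sym (adj F)"
  by (auto simp: sym_def adj_def insert_commute)

lemma component_self: "v \<in> component v F"
  by (simp add: component_def)

lemma component_mono: "F \<subseteq> F' \<Longrightarrow> component v F \<subseteq> component v F'"
proof -
  assume "F \<subseteq> F'"
  then have "(adj F)\<^sup>* \<subseteq> (adj F')\<^sup>*" by (intro rtrancl_mono) (auto simp: adj_def)
  then show ?thesis by (auto simp: component_def)
qed

lemma component_empty [simp]: "component v {} = {v}"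
  by (simp add: component_def adj_def)

lemma component_step: "x \<in> component v F \<Longrightarrow> {x, y} \<in> F \<Longrightarrow> y \<in> component v F"
  by (auto simp: component_def adj_def intro: rtrancl_into_rtrancl)

lemma component_subset_closed:
  assumes "v \<in> S" "\<And>x y. x \<in> S \<Longrightarrow> {x, y} \<in> F \<Longrightarrow> y \<in> S"
  shows "component v F \<subseteq> S"
proof
  fix u assume "u \<in> component v F"
  then have "(v, u) \<in> (adj F)\<^sup>*" by (simp add: component_def)
  then show "u \<in> S"
    by (induction rule: rtrancl_induct) (use assms in \<open>auto simp: adj_def\<close>)
qed

lemma component_subset_uncrossed:
  assumes "v \<in> S" "\<And>e. e \<in> F \<Longrightarrow> \<not> crossing S e"
  shows "component v F \<subseteq> S"
proof (rule component_subset_closed[OF assms(1)])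
  fix x y assume "x \<in> S" "{x, y} \<in> F"
  then show "y \<in> S" using assms(2)[of "{x, y}"] by (auto simp: crossing_def)
qed

lemma not_crossing_comp: "F \<subseteq> all_edges n \<Longrightarrow> e \<in> F \<Longrightarrow> \<not> crossing (component v F) e"
proof -
  assume "F \<subseteq> all_edges n" "e \<in> F"
  then obtain x y where e: "e = {x, y}" "{x, y} \<in> F" "{y, x} \<in> F"
    by (metis all_edges_doubleton insert_commute subsetD)
  then show "\<not> crossing (component v F) e"
    using component_step[of x v F y] component_step[of y v F x] by (auto simp: crossing_def)
qed

lemma component_subset_vertices:
  assumes "v < n" "F \<subseteq> all_edges n" shows "component v F \<subseteq> {..<n}"
proof (rule component_subset_closed)
  fix x y assume "{x, y} \<in> F"
  then have "{x, y} \<in> all_edges n" using assms(2) by blast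
  then show "y \<in> {..<n}" by (simp add: all_edges_def)
qed (use assms in simp)

lemma finite_comp: "v < n \<Longrightarrow> F \<subseteq> all_edges n \<Longrightarrow> finite (component v F)"
  by (rule finite_subset[OF component_subset_vertices]) auto

lemma component_eq: "u \<in> component v F \<Longrightarrow> component u F = component v F"
proof -
  assume "u \<in> component v F"
  then have 1: "(v, u) \<in> (adj F)\<^sup>*" by (simp add: component_def)
  then have 2: "(u, v) \<in> (adj F)\<^sup>*" by (meson sym_adj sym_rtrancl symD)
  show ?thesis using 1 2 by (auto simp: component_def)
qed

lemma crossing_comp_grow:
  assumes "F \<subseteq> F'" "F' \<subseteq> all_edges n" "e \<in> F'" "crossing (component v F) e"
  shows "component v F \<subset> component v F'"
proof -
  have "\<not> crossing (component v F') e" using assms not_crossing_comp by blast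
  then show ?thesis using component_mono[OF assms(1), of v] assms(4) by (auto simp: crossing_def)
qed

lemma crossing_reachable:
  assumes "F \<subseteq> E" "E \<subseteq> all_edges n" "\<And>e. e \<in> E \<Longrightarrow> \<not> crossing (component v F) e"
  shows "component v F = component v E"
  using component_mono[OF assms(1)] component_subset_uncrossed[OF component_self assms(3)] by blast

lemma crossing_sub_comp:
  assumes "F \<subseteq> E" "E \<subseteq> all_edges n" "e \<in> E" "crossing (component v F) e"
  shows "e \<subseteq> component v E"
  using not_crossing_comp[OF assms(2,3), of v] component_mono[OF assms(1), of v] assms(4)
  by (auto simp: crossing_def)

lemma card_edges_within:
  assumes "finite S" "\<And>e. e \<in> X \<Longrightarrow> e \<subseteq> S \<and> card e = 2"
  shows "card X \<le> card S ^ 2" "finite X"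
proof -
  show f: "finite X" by (rule finite_subset[of _ "Pow S"]) (use assms in auto)
  have "card X \<le> card {e. e \<subseteq> S \<and> card e = 2}"
    by (rule card_mono) (use assms in auto)
  also have "\<dots> = card S choose 2" using n_subsets[OF assms(1)] .
  also have "\<dots> \<le> card S ^ 2"
    by (cases "2 \<le> card S") (use binomial_le_pow[of 2 "card S"] in \<open>auto simp: binomial_eq_0\<close>)
  finally show "card X \<le> card S ^ 2" .
qed

lemma equiv_reachable: "equiv {..<n} (reachable n E)"
proof (rule equivI)
  show "sym (reachable n E)"
    using sym_rtrancl[OF sym_adj[of E]] by (auto simp: sym_def reachable_def adj_def)
  show "trans (reachable n E)"
    by (auto simp: trans_def reachable_def)
qed (auto simp: refl_on_def reachable_def)

lemma reachable_class:
  "v < n \<Longrightarrow> E \<subseteq> all_edges n \<Longrightarrow> reachable n E `` {v} = component v E"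
  using component_subset_vertices[of v n E] by (auto simp: reachable_def component_def adj_def)

text \<open>Every class distributes a total weight of 1 evenly among its elements. This turns the
  count of components into an average over random vertices.\<close>

lemma sum_inverse_card_class:
  assumes "finite A" "equiv A r"
  shows "(\<Sum>v\<in>A. 1 / real (card (r `` {v}))) = card (A // r)"
proof -
  have "(\<Sum>v\<in>A. 1 / real (card (r `` {v}))) = (\<Sum>v\<in>\<Union>(A // r). 1 / real (card (r `` {v})))"
    using Union_quotient[OF assms(2)] by simp
  also have "\<dots> = (\<Sum>X\<in>A // r. \<Sum>v\<in>X. 1 / real (card (r `` {v})))"
  proof (subst sum.Union_disjoint)
    show "\<forall>X\<in>A // r. finite X" using assms finite_equiv_class by (metis equiv_type)
    show "\<forall>X\<in>A // r. \<forall>Y\<in>A // r. X \<noteq> Y \<longrightarrow> X \<inter> Y = {}"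
      using quotient_disj[OF assms(2)] by blast
  qed simp
  also have "\<dots> = (\<Sum>X\<in>A // r. 1)"
  proof (rule sum.cong[OF refl])
    fix X assume X: "X \<in> A // r"
    then have "finite X" "X \<noteq> {}"
      using assms finite_equiv_class equiv_type in_quotient_imp_non_empty by metis+
    moreover have "r `` {v} = X" if "v \<in> X" for v
      using X that assms(2) by (metis Image_singleton_iff equiv_class_eq_iff quotientE)
    ultimately show "(\<Sum>v\<in>X. 1 / real (card (r `` {v}))) = 1"
      by simp
  qed
  finally show ?thesis by simp
qed

lemma num_components_eq_sum:
  assumes "E \<subseteq> all_edges n"
  shows "real (num_components n E) = (\<Sum>v<n. 1 / real (card (component v E)))"
  using sum_inverse_card_class[OF _ equiv_reachable[of n E]] reachable_class[OF _ assms]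
  by (simp add: num_components_def)

section \<open>Growing a component along the stream\<close>

text \<open>A retained set \<open>r\<close> consists of pairs of an edge and the index of the time cell in which it
  arrived; a slot consists of \<open>L\<close> consecutive cells. Level \<open>j\<close> of the growth happens in slot
  \<open>Suc j\<close>; slot \<open>0\<close> is only used to estimate the number of edges.\<close>

locale tracker =
  fixes n :: nat and key :: "nat set \<Rightarrow> nat" and L k :: nat and \<Lambda> :: "nat \<Rightarrow> nat"
  assumes inj_key: "inj_on key (all_edges n)"
begin

definition front :: "nat set \<Rightarrow> (nat set \<times> nat) set \<Rightarrow> nat \<Rightarrow> (nat set \<times> nat) set" where
  "front S r j = {(e, c) \<in> r. c div L = Suc j \<and> crossing S e}"

definition best :: "nat set \<Rightarrow> (nat set \<times> nat) set \<Rightarrow> nat \<Rightarrow> (nat set \<times> nat) \<Rightarrow> bool" where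
  "best S r j p \<longleftrightarrow> p \<in> front S r j \<and> (\<forall>p'\<in>front S r j. key (fst p) \<le> key (fst p'))"

text \<open>The whole cell of the best edge is taken, crossing or not: batches are hidden, and the
  cell stands in for the batch of that edge. Level \<open>j\<close> reads the slots up to
  \<open>j\<close> only.\<close>

primrec coll :: "nat \<Rightarrow> (nat set \<times> nat) set \<Rightarrow> nat \<Rightarrow> nat set set" where
  "coll v r 0 = {}"
| "coll v r (Suc j) =
     coll v r j \<union> {e'. \<exists>e c. best (component v (coll v r j)) r j (e, c) \<and> (e', c) \<in> r}"

abbreviation grown :: "nat \<Rightarrow> (nat set \<times> nat) set \<Rightarrow> nat \<Rightarrow> nat set" where
  "grown v r j \<equiv> component v (coll v r j)"

text \<open>If the front of level \<open>j\<close> is empty, the last condition is vacuous and every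
  later edge crossing the grown set is a violation. So a surviving tracker that finds nothing at one
  level finds nothing at the later levels either.\<close>

definition violation :: "nat \<Rightarrow> (nat set \<times> nat) set \<Rightarrow> nat set \<times> nat \<Rightarrow> bool" where
  "violation v r = (\<lambda>(e, c). \<exists>j<k. Suc j < c div L \<and> crossing (grown v r j) e \<and>
     (\<forall>p\<in>front (grown v r j) r j. key e < key (fst p)))"

text \<open>The current cell is kept whole even if none of its edges is best yet: a later edge of
  the same cell may become so, and then the entire cell is wanted.\<close>

definition prune :: "nat \<Rightarrow> nat \<Rightarrow> (nat set \<times> nat) set \<Rightarrow> (nat set \<times> nat) set" where
  "prune v c r = {(e', c') \<in> r. c' = c \<or> (\<exists>j<k. \<exists>e. best (grown v r j) r j (e, c'))}"

text \<open>The cap depends on the count from slot \<open>0\<close> because the number of edges is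
  not known in advance. The count no longer changes once slot \<open>1\<close> has begun.\<close>

definition add_item :: "nat \<Rightarrow> (nat set \<times> nat) set \<Rightarrow> nat set \<times> nat \<Rightarrow> (nat set \<times> nat) set" where
  "add_item cnt r = (\<lambda>(e, c). if 1 \<le> c div L \<and> c div L \<le> k \<and> card {e'. (e', c) \<in> r} < \<Lambda> cnt
     then insert (e, c) r else r)"

text \<open>The state consists of the tracked vertex, the number of edges in slot \<open>0\<close>, the flag that the
  tracker has been discarded, and the retained set.\<close>

fun step :: "nat \<times> nat \<times> bool \<times> (nat set \<times> nat) set \<Rightarrow> nat set \<times> nat
    \<Rightarrow> nat \<times> nat \<times> bool \<times> (nat set \<times> nat) set" where
  "step (v, cnt, dead, r) (e, c) =
     (v, if c div L = 0 then cnt + 1 else cnt, dead \<or> violation v r (e, c),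
      prune v c (add_item cnt r (e, c)))"

definition levels :: "nat \<Rightarrow> (nat set \<times> nat) set \<Rightarrow> nat" where
  "levels v r = card {j. j < k \<and> front (grown v r j) r j \<noteq> {}}"

fun estimate :: "real \<Rightarrow> nat \<times> nat \<times> bool \<times> (nat set \<times> nat) set \<Rightarrow> real" where
  "estimate \<rho> (v, cnt, dead, r) =
     (if dead \<or> card (grown v r k) > k then 0
      else (1 / \<rho>) ^ levels v r / real (card (grown v r k)))"

subsection \<open>Forgetting all but the chosen cells does not change the growth\<close>

text \<open>Here \<open>A\<close> is what a tracker without pruning would hold. A kernel may have
  lost any cell except those that \<open>A\<close> chooses at some level.\<close>

definition kernel :: "nat \<Rightarrow> (nat set \<times> nat) set \<Rightarrow> (nat set \<times> nat) set \<Rightarrow> bool" where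
  "kernel v r A \<longleftrightarrow> r \<subseteq> A \<and>
     (\<forall>j<k. \<forall>e c. best (grown v A j) A j (e, c) \<longrightarrow> (\<forall>e'. (e', c) \<in> A \<longrightarrow> (e', c) \<in> r))"

definition proper :: "(nat set \<times> nat) set \<Rightarrow> bool" where
  "proper A \<longleftrightarrow> finite A \<and> fst ` A \<subseteq> all_edges n \<and> inj_on fst A"

lemma proper_mono: "proper A \<Longrightarrow> r \<subseteq> A \<Longrightarrow> proper r"
  unfolding proper_def by (meson finite_subset image_mono inj_on_subset order_trans)

lemma front_subset: "front S r j \<subseteq> r"
  by (auto simp: front_def)

lemma ex_best:
  assumes "proper A" "front S A j \<noteq> {}"
  obtains e c where "best S A j (e, c)"
proof -
  have "finite (front S A j)"
    using assms(1) front_subset finite_subset by (metis proper_def)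
  then have "arg_min_on (\<lambda>p. key (fst p)) (front S A j) \<in> front S A j"
    "\<forall>p'\<in>front S A j. key (fst (arg_min_on (\<lambda>p. key (fst p)) (front S A j))) \<le> key (fst p')"
    using assms(2) arg_min_if_finite[of "front S A j" "\<lambda>p. key (fst p)"] by (auto simp: not_less)
  then obtain p where "p \<in> front S A j" "\<forall>p'\<in>front S A j. key (fst p) \<le> key (fst p')"
    by blast
  then show ?thesis using that[of "fst p" "snd p"] by (simp add: best_def)
qed

lemma best_unique:
  assumes "proper A" "best S A j p" "best S A j p'"
  shows "p = p'"
proof -
  have "p \<in> A" "p' \<in> A" using assms front_subset by (auto simp: best_def)
  moreover have "key (fst p) = key (fst p')"
    using assms by (meson best_def order_antisym)
  ultimately show ?thesis
    using assms(1) inj_key by (smt (verit) proper_def image_subset_iff inj_on_def)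
qed

text \<open>The least key of the larger front is attained in the smaller one, so both have the same
  minimum and pass the same comparisons.\<close>

lemma kernel_best:
  assumes "proper A" "r \<subseteq> A" "j < k"
    and K: "\<And>e c. best S A j (e, c) \<Longrightarrow> (e, c) \<in> r"
  shows "best S r j p \<longleftrightarrow> best S A j p"
    "front S r j = {} \<longleftrightarrow> front S A j = {}"
    "(\<forall>p\<in>front S r j. m < key (fst p)) \<longleftrightarrow> (\<forall>p\<in>front S A j. m < key (fst p))"
proof -
  have sub: "front S r j \<subseteq> front S A j" using assms(2) by (auto simp: front_def)
  have "(best S r j p \<longleftrightarrow> best S A j p) \<and> (front S r j = {} \<longleftrightarrow> front S A j = {})
    \<and> ((\<forall>p\<in>front S r j. m < key (fst p)) \<longleftrightarrow> (\<forall>p\<in>front S A j. m < key (fst p)))"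
  proof (cases "front S A j = {}")
    case True
    then show ?thesis using sub by (auto simp: best_def)
  next
    case False
    then obtain e c where b: "best S A j (e, c)" using ex_best[OF assms(1)] by blast
    then have "(e, c) \<in> r" by (rule K)
    with b have f: "(e, c) \<in> front S r j" by (auto simp: best_def front_def)
    then have br: "best S r j (e, c)" using b sub by (auto simp: best_def)
    then have "best S r j p \<longleftrightarrow> best S A j p"
      using b best_unique[OF assms(1), of S j] best_unique[OF proper_mono[OF assms(1,2)], of S j]
      by metis
    moreover have "(\<forall>p\<in>front S r j. m < key (fst p)) \<longleftrightarrow> (\<forall>p\<in>front S A j. m < key (fst p))"
      using f sub b unfolding best_def by (metis fst_conv order_less_le_trans subsetD)
    ultimately show ?thesis using f False by blast
  qed
  then show "best S r j p \<longleftrightarrow> best S A j p"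
    "front S r j = {} \<longleftrightarrow> front S A j = {}"
    "(\<forall>p\<in>front S r j. m < key (fst p)) \<longleftrightarrow> (\<forall>p\<in>front S A j. m < key (fst p))"
    by blast+
qed

lemma kernel_chosen: "kernel v r A \<Longrightarrow> j < k \<Longrightarrow> best (grown v A j) A j (e, c) \<Longrightarrow> (e, c) \<in> r"
  by (auto simp: kernel_def best_def front_def)

lemma kernel_coll:
  assumes "proper A" "kernel v r A" "j \<le> k"
  shows "coll v r j = coll v A j"
  using assms(3)
proof (induction j)
  case (Suc j)
  then have eq: "coll v r j = coll v A j" and j: "j < k" by auto
  have sub: "r \<subseteq> A" using assms(2) by (simp add: kernel_def)
  have "best (grown v A j) r j p \<longleftrightarrow> best (grown v A j) A j p" for p
    using kernel_best(1)[OF assms(1) sub j] kernel_chosen[OF assms(2) j] by blast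
  moreover have "(e', c) \<in> r \<longleftrightarrow> (e', c) \<in> A" if "best (grown v A j) A j (e, c)" for e e' c
    using assms(2) sub that j by (auto simp: kernel_def)
  ultimately show ?case using eq by simp blast
qed simp

lemma kernel_front:
  assumes "proper A" "kernel v r A" "j < k"
  shows "best (grown v r j) r j p \<longleftrightarrow> best (grown v A j) A j p"
    "front (grown v r j) r j = {} \<longleftrightarrow> front (grown v A j) A j = {}"
    "(\<forall>p\<in>front (grown v r j) r j. m < key (fst p)) \<longleftrightarrow>
     (\<forall>p\<in>front (grown v A j) A j. m < key (fst p))"
proof -
  have sub: "r \<subseteq> A" using assms(2) by (simp add: kernel_def)
  have eq: "coll v r j = coll v A j" using kernel_coll assms by simp
  note * = kernel_best[OF assms(1) sub assms(3) kernel_chosen[OF assms(2,3)]]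
  show "best (grown v r j) r j p \<longleftrightarrow> best (grown v A j) A j p"
    "front (grown v r j) r j = {} \<longleftrightarrow> front (grown v A j) A j = {}"
    "(\<forall>p\<in>front (grown v r j) r j. m < key (fst p)) \<longleftrightarrow>
     (\<forall>p\<in>front (grown v A j) A j. m < key (fst p))"
    using * by (simp_all add: eq)
qed

lemma kernel_violation:
  assumes "proper A" "kernel v r A"
  shows "violation v r p \<longleftrightarrow> violation v A p"
proof -
  have "(crossing (grown v r j) (fst p) \<and> (\<forall>q\<in>front (grown v r j) r j. key (fst p) < key (fst q)))
    \<longleftrightarrow> (crossing (grown v A j) (fst p) \<and> (\<forall>q\<in>front (grown v A j) A j. key (fst p) < key (fst q)))"
    if "j < k" for j
    using kernel_front(3)[OF assms that] kernel_coll[OF assms, of j] that by simp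
  then show ?thesis
    unfolding violation_def by (cases p, simp only: prod.case fst_conv, intro ex_cong1) metis
qed

lemma kernel_levels:
  assumes "proper A" "kernel v r A" shows "levels v r = levels v A"
  unfolding levels_def using kernel_front(2)[OF assms] by (metis (no_types, lifting))

lemma kernel_prune:
  assumes "proper A" "kernel v r A"
  shows "kernel v (prune v c r) A"
  unfolding kernel_def
proof (intro conjI allI impI)
  show "prune v c r \<subseteq> A" using assms(2) by (auto simp: prune_def kernel_def)
next
  fix j e c' e' assume j: "j < k" "best (grown v A j) A j (e, c')" "(e', c') \<in> A"
  then have "best (grown v r j) r j (e, c')" using kernel_front(1)[OF assms] by blast
  then show "(e', c') \<in> prune v c r"
    using j assms(2) by (auto simp: prune_def kernel_def)
qed

subsection \<open>The retained set along the stream\<close>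

lemma front_agree:
  assumes "\<And>e c. c div L = Suc j \<Longrightarrow> (e, c) \<in> A \<longleftrightarrow> (e, c) \<in> A'"
  shows "front S A j = front S A' j"
  using assms by (auto simp: front_def)

lemma coll_agree:
  assumes "\<And>e c. c div L \<le> i \<Longrightarrow> (e, c) \<in> A \<longleftrightarrow> (e, c) \<in> A'" "j \<le> i"
  shows "coll v A j = coll v A' j"
  using assms(2)
proof (induction j)
  case (Suc j)
  then have eq: "coll v A j = coll v A' j" by simp
  have f: "front S A j = front S A' j" for S
    using assms(1) Suc.prems by (intro front_agree) auto
  have "best S A j p \<longleftrightarrow> best S A' j p" for S p
    using f by (simp add: best_def)
  moreover have "(e', c) \<in> A \<longleftrightarrow> (e', c) \<in> A'" if "best S A' j (e, c)" for S e c e'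
    using that assms(1)[of c] Suc.prems by (auto simp: best_def front_def)
  ultimately show ?case using eq by simp blast
qed simp

text \<open>A discarded cell is never chosen again. Items arrive in the order of their cells, so a
  new one leaves the growth before its own slot unchanged, and within its slot it can only take over
  as best edge; an older edge that is best now was best before.\<close>

lemma kernel_insert:
  assumes "proper (insert (e, c) A)" "kernel v r A"
    and top: "\<And>e' c'. (e', c') \<in> A \<Longrightarrow> c' \<le> c"
    and cur: "\<And>e'. (e', c) \<in> A \<Longrightarrow> (e', c) \<in> r"
    and slot: "1 \<le> c div L"
  shows "kernel v (insert (e, c) r) (insert (e, c) A)"
  unfolding kernel_def
proof (intro conjI allI impI)
  show "insert (e, c) r \<subseteq> insert (e, c) A" using assms(2) by (auto simp: kernel_def)
next
  let ?A = "insert (e, c) A"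
  fix j e1 c1 e'
  assume j: "j < k" and b: "best (grown v ?A j) ?A j (e1, c1)" and e': "(e', c1) \<in> ?A"
  have pA: "proper A" using assms(1) proper_mono by blast
  have slot1: "c1 div L = Suc j" and in1: "(e1, c1) \<in> ?A" using b by (auto simp: best_def front_def)
  show "(e', c1) \<in> insert (e, c) r"
  proof (cases "c1 = c")
    case True
    then show ?thesis using e' cur by auto
  next
    case False
    then have A1: "(e1, c1) \<in> A" "(e', c1) \<in> A" using in1 e' by auto
    then have "c1 \<le> c" using top by blast
    then have le: "Suc j \<le> c div L" using slot1 div_le_mono by metis
    have eq: "coll v ?A j = coll v A j"
      by (rule coll_agree[of j]) (use le in auto)
    have "best (grown v A j) A j (e1, c1)"
      using b A1(1) unfolding eq by (auto simp: best_def front_def)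
    then show ?thesis using assms(2) j A1(2) by (auto simp: kernel_def)
  qed
qed

text \<open>\<open>A\<close> is a ghost set: everything that passed the cap, never pruned. The
  conjunct about cells \<open>c\<close> that bound all of \<open>us\<close> says that the newest
  cell is still complete in memory. The last conjunct says that the cap truncates only cells with
  more than \<open>\<Lambda> cnt\<close> items.\<close>

definition run_inv :: "nat \<Rightarrow> (nat set \<times> nat) list \<Rightarrow> (nat set \<times> nat) set
    \<Rightarrow> nat \<times> nat \<times> bool \<times> (nat set \<times> nat) set \<Rightarrow> bool" where
  "run_inv v us A = (\<lambda>(v', cnt, dead, r). v' = v \<and>
     cnt = card {u \<in> set us. snd u div L = 0} \<and>
     kernel v r A \<and> A \<subseteq> set us \<and> (\<forall>(e, c)\<in>A. 1 \<le> c div L) \<and>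
     (\<forall>u\<in>set us. \<forall>e c. (\<forall>u'\<in>set us. snd u' \<le> c) \<and> (e, c) \<in> A \<longrightarrow> (e, c) \<in> r) \<and>
     (dead \<longleftrightarrow> (\<exists>u\<in>set us. violation v A u)) \<and>
     (\<forall>c. 1 \<le> c div L \<and> c div L \<le> k \<and> card {u \<in> set us. snd u = c} \<le> \<Lambda> cnt \<longrightarrow>
        {u \<in> set us. snd u = c} \<subseteq> A))"

text \<open>Whether an item is a violation is settled by the slots before its own. Hence the verdict
  on arrival is final, and a single flag can record it.\<close>

lemma violation_agree:
  assumes "\<And>e' c'. c' div L < c div L \<Longrightarrow> (e', c') \<in> A \<longleftrightarrow> (e', c') \<in> A'"
  shows "violation v A (e, c) \<longleftrightarrow> violation v A' (e, c)"
proof -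
  have "coll v A j = coll v A' j \<and> front (grown v A j) A j = front (grown v A' j) A' j"
    if "Suc j < c div L" for j
  proof
    show eq: "coll v A j = coll v A' j"
      by (rule coll_agree[of j]) (use that assms in auto)
    show "front (grown v A j) A j = front (grown v A' j) A' j"
      unfolding eq by (rule front_agree) (use that assms in auto)
  qed
  then show ?thesis unfolding violation_def prod.case by (intro ex_cong1) metis
qed

lemma run_inv_step:
  assumes inv: "run_inv v us A st"
    and propr: "proper (set (us @ [(e, c)]))" and dist: "(e, c) \<notin> set us"
    and sorted: "\<forall>u\<in>set us. snd u \<le> c"
  shows "\<exists>A'. run_inv v (us @ [(e, c)]) A' (step st (e, c))"
proof -
  obtain cnt dead r where st: "st = (v, cnt, dead, r)"
    using inv by (cases st) (auto simp: run_inv_def)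
  note I = inv[unfolded st run_inv_def prod.case]
  have cnt: "cnt = card {u \<in> set us. snd u div L = 0}"
    and ker: "kernel v r A" and Asub: "A \<subseteq> set us" and A1: "\<forall>(e, c)\<in>A. 1 \<le> c div L"
    and top: "\<And>e' c'. us \<noteq> [] \<Longrightarrow> (\<forall>u'\<in>set us. snd u' \<le> c') \<Longrightarrow> (e', c') \<in> A \<Longrightarrow> (e', c') \<in> r"
    and dead: "dead \<longleftrightarrow> (\<exists>u\<in>set us. violation v A u)"
    and cells: "\<And>c. 1 \<le> c div L \<Longrightarrow> c div L \<le> k \<Longrightarrow> card {u \<in> set us. snd u = c} \<le> \<Lambda> cnt \<Longrightarrow>
        {u \<in> set us. snd u = c} \<subseteq> A"
    using I by (auto simp: neq_Nil_conv)
  define A' where "A' = add_item cnt A (e, c)"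
  have rA: "r \<subseteq> A" using ker by (simp add: kernel_def)
  have cellr: "(e', c) \<in> A \<longleftrightarrow> (e', c) \<in> r" for e'
    using top[of c e'] sorted rA Asub by (cases "us = []") auto
  have add: "add_item cnt r (e, c) = (if A' = A then r else insert (e, c) r)"
    "A' = A \<or> A' = insert (e, c) A \<and> 1 \<le> c div L \<and> c div L \<le> k"
  proof -
    have "(e, c) \<notin> A" using dist Asub by auto
    moreover from this have "insert (e, c) A \<noteq> A" by blast
    ultimately show "add_item cnt r (e, c) = (if A' = A then r else insert (e, c) r)"
      "A' = A \<or> A' = insert (e, c) A \<and> 1 \<le> c div L \<and> c div L \<le> k"
      by (auto simp: A'_def add_item_def cellr)
  qed
  have A'sub: "A' \<subseteq> set (us @ [(e, c)])" using add(2) Asub by auto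
  then have pA': "proper A'" using propr proper_mono by blast
  have ker1: "kernel v (add_item cnt r (e, c)) A'"
  proof (cases "A' = A")
    case False
    then have A': "A' = insert (e, c) A" "1 \<le> c div L" using add(2) by auto
    have "kernel v (insert (e, c) r) (insert (e, c) A)"
    proof (rule kernel_insert)
      show "c' \<le> c" if "(e', c') \<in> A" for e' c' using that Asub sorted by fastforce
    qed (use pA' ker cellr A' in auto)
    then show ?thesis using add(1) False A'(1) by simp
  qed (use ker add in simp)
  have ker2: "kernel v (prune v c (add_item cnt r (e, c))) A'" by (rule kernel_prune[OF pA' ker1])
  have agree: "(e', c') \<in> A' \<longleftrightarrow> (e', c') \<in> A" if "c' \<noteq> c" for e' c' using add(2) that by auto
  have agree': "(e', c') \<in> A \<longleftrightarrow> (e', c') \<in> A'" if "c' div L < c1 div L" "c1 \<le> c" for e' c' c1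
    using agree[of c' e'] that div_le_mono[of c1 c L] by (cases "c' = c") auto
  \<comment> \<open>The memory judges the item before it is added, the ghost set afterwards; the
    slot of the item itself does not enter the verdict.\<close>
  have v1: "violation v r (e, c) \<longleftrightarrow> violation v A' (e, c)"
  proof -
    have "violation v r (e, c) \<longleftrightarrow> violation v A (e, c)"
      using kernel_violation[OF _ ker] Asub propr proper_mono by (metis set_append sup.coboundedI1)
    also have "\<dots> \<longleftrightarrow> violation v A' (e, c)"
      by (rule violation_agree) (use agree' in blast)
    finally show ?thesis .
  qed
  have v2: "violation v A u \<longleftrightarrow> violation v A' u" if "u \<in> set us" for u
  proof -
    have "snd u \<le> c" using that sorted by auto
    then have "violation v A (fst u, snd u) \<longleftrightarrow> violation v A' (fst u, snd u)"
      by (intro violation_agree) (use agree' in blast)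
    then show ?thesis by simp
  qed
  define cnt' where "cnt' = (if c div L = 0 then cnt + 1 else cnt)"
  have cnt': "cnt' = card {u \<in> set (us @ [(e, c)]). snd u div L = 0}"
  proof -
    have *: "{u \<in> set (us @ [(e, c)]). snd u div L = 0} =
      (if c div L = 0 then insert (e, c) {u \<in> set us. snd u div L = 0}
       else {u \<in> set us. snd u div L = 0})" by auto
    show ?thesis unfolding * cnt'_def cnt using dist by auto
  qed
  have cells': "{u \<in> set (us @ [(e, c)]). snd u = c'} \<subseteq> A'"
    if c': "1 \<le> c' div L" "c' div L \<le> k" "card {u \<in> set (us @ [(e, c)]). snd u = c'} \<le> \<Lambda> cnt'" for c'
  proof -
    \<comment> \<open>A non-empty cell of a positive slot means that slot \<open>0\<close> is over,
      so the cap applied to this cell has not changed since.\<close>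
    have "c' div L \<le> c div L" if "c' = c \<or> {u \<in> set us. snd u = c'} \<noteq> {}"
      using that sorted by (fastforce intro: div_le_mono)
    then have cc: "cnt' = cnt" if "c' = c \<or> {u \<in> set us. snd u = c'} \<noteq> {}"
      using that c'(1) unfolding cnt'_def by auto
    have le: "card {u \<in> set us. snd u = c'} \<le> card {u \<in> set (us @ [(e, c)]). snd u = c'}"
      by (rule card_mono) auto
    have old: "{u \<in> set us. snd u = c'} \<subseteq> A"
    proof (cases "{u \<in> set us. snd u = c'} = {}")
      case False
      then show ?thesis using cells[OF c'(1,2)] cc le c'(3) by simp
    qed blast
    show ?thesis
    proof (cases "c' = c")
      case True
      have *: "{u \<in> set (us @ [(e, c)]). snd u = c'} = insert (e, c) {u \<in> set us. snd u = c'}"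
        using True by auto
      \<comment> \<open>With the new item included the cell is within the cap, so there is room for
        it now.\<close>
      have "card {e'. (e', c) \<in> A} \<le> card {u \<in> set us. snd u = c'}"
      proof (rule card_inj_on_le[of "\<lambda>e'. (e', c)"])
        show "(\<lambda>e'. (e', c)) ` {e'. (e', c) \<in> A} \<subseteq> {u \<in> set us. snd u = c'}"
          using Asub True by auto
      qed (auto simp: inj_on_def)
      also have "\<dots> < card {u \<in> set (us @ [(e, c)]). snd u = c'}"
        unfolding * by (subst card_insert_disjoint) (use dist in auto)
      also have "\<dots> \<le> \<Lambda> cnt" using c'(3) cc True by simp
      finally have "card {e'. (e', c) \<in> A} < \<Lambda> cnt" .
      then have "A' = insert (e, c) A"
        using c'(1,2) True by (simp add: A'_def add_item_def)
      then show ?thesis unfolding * by (rule ssubst) (rule Set.insert_mono[OF old])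
    next
      case False
      then have *: "{u \<in> set (us @ [(e, c)]). snd u = c'} = {u \<in> set us. snd u = c'}" by auto
      show ?thesis unfolding * using old add(2) by blast
    qed
  qed
  have top': "(e', c') \<in> prune v c (add_item cnt r (e, c))"
    if "\<forall>u'\<in>set (us @ [(e, c)]). snd u' \<le> c'" "(e', c') \<in> A'" for e' c'
  proof -
    have "c \<le> c'" using that(1) by auto
    moreover have "c' \<le> c" using that(2) A'sub sorted by fastforce
    ultimately have c': "c' = c" by simp
    have "(e', c) \<in> add_item cnt r (e, c)"
      using that(2) add c' cellr by (cases "A' = A") auto
    then show ?thesis using c' by (simp add: prune_def)
  qed
  have A1': "\<forall>(e, c)\<in>A'. 1 \<le> c div L" using add(2) A1 by auto
  have "run_inv v (us @ [(e, c)]) A'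
      (v, cnt', dead \<or> violation v r (e, c), prune v c (add_item cnt r (e, c)))"
    unfolding run_inv_def prod.case
  proof (intro conjI refl allI ballI impI)
    show "(dead \<or> violation v r (e, c)) = (\<exists>u\<in>set (us @ [(e, c)]). violation v A' u)"
      unfolding set_append using dead v1 v2 by (simp add: bex_Un disj_commute)
    fix e1 c1 assume "(\<forall>u'\<in>set (us @ [(e, c)]). snd u' \<le> c1) \<and> (e1, c1) \<in> A'"
    then show "(e1, c1) \<in> prune v c (add_item cnt r (e, c))" using top' by blast
  next
    fix c1 assume "1 \<le> c1 div L \<and> c1 div L \<le> k \<and>
      card {u \<in> set (us @ [(e, c)]). snd u = c1} \<le> \<Lambda> cnt'"
    then show "{u \<in> set (us @ [(e, c)]). snd u = c1} \<subseteq> A'" using cells' by blast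
  qed (use cnt' ker2 A'sub A1' in \<open>assumption | blast\<close>)+
  then show ?thesis unfolding st by (auto simp: cnt'_def)
qed

theorem run_inv_foldl:
  assumes "distinct (map fst us)" "fst ` set us \<subseteq> all_edges n" "sorted (map snd us)"
  shows "\<exists>A. run_inv v us A (foldl step (v, 0, False, {}) us)"
  using assms
proof (induction us rule: rev_induct)
  case Nil
  show ?case
    by (auto simp: run_inv_def kernel_def best_def front_def intro!: exI[of _ "{}"])
next
  case (snoc u us)
  obtain e c where u: "u = (e, c)" by (cases u)
  obtain A where A: "run_inv v us A (foldl step (v, 0, False, {}) us)"
    using snoc by (auto simp: sorted_append)
  have "proper (set (us @ [u]))"
    using snoc.prems distinct_map[of fst "us @ [u]"] by (auto simp: proper_def)
  moreover have "(e, c) \<notin> set us" using snoc.prems(1) u by force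
  moreover have "\<forall>u\<in>set us. snd u \<le> c" using snoc.prems(3) u by (auto simp: sorted_append)
  ultimately show ?case using run_inv_step[OF A, of e c] u by simp
qed

end

section \<open>Decision trees of batches\<close>

text \<open>At level \<open>j\<close> a queried batch is either blocked (it arrived in a slot \<open>\<le> j\<close>), or taken (it arrives
  in slot \<open>Suc j\<close>), or it arrives later and discards the tracker.\<close>

datatype 'b qtree = Leaf real | Query 'b "'b qtree" "'b qtree"

primrec tval :: "real \<Rightarrow> ('b \<Rightarrow> nat) \<Rightarrow> 'b qtree \<Rightarrow> nat \<Rightarrow> real" where
  "tval \<rho> s (Leaf r) j = r"
| "tval \<rho> s (Query B T T') j =
     (if s B \<le> j then tval \<rho> s T j else if s B = Suc j then 1 / \<rho> * tval \<rho> s T' (Suc j) else 0)"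

text \<open>The share of \<open>tval\<close> due to the one path on which every queried batch is
  taken. It involves at most \<open>k\<close> batches, which makes a variance bound possible,
  whereas \<open>tval\<close> may depend on all queries of the tree.\<close>

primrec straight :: "real \<Rightarrow> ('b \<Rightarrow> nat) \<Rightarrow> 'b qtree \<Rightarrow> nat \<Rightarrow> real" where
  "straight \<rho> s (Leaf r) j = r"
| "straight \<rho> s (Query B T T') j = (if s B = Suc j then 1 / \<rho> * straight \<rho> s T' (Suc j) else 0)"

primrec straight_leaf :: "'b qtree \<Rightarrow> real" where
  "straight_leaf (Leaf r) = r"
| "straight_leaf (Query B T T') = straight_leaf T'"

primrec straight_path :: "'b qtree \<Rightarrow> 'b set" where
  "straight_path (Leaf r) = {}"
| "straight_path (Query B T T') = insert B (straight_path T')"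

primrec queries :: "'b qtree \<Rightarrow> 'b set" where
  "queries (Leaf r) = {}"
| "queries (Query B T T') = insert B (queries T \<union> queries T')"

text \<open>A batch does not recur below its query, which makes its time independent of the values
  of both subtrees. The level counts taken batches only.\<close>

primrec wf_qtree :: "nat \<Rightarrow> 'b set \<Rightarrow> 'b qtree \<Rightarrow> nat \<Rightarrow> bool" where
  "wf_qtree k \<B> (Leaf r) j \<longleftrightarrow> 0 \<le> r \<and> r \<le> 1 \<and> j \<le> k"
| "wf_qtree k \<B> (Query B T T') j \<longleftrightarrow> j < k \<and> B \<in> \<B> \<and> B \<notin> queries T \<union> queries T' \<and>
     wf_qtree k \<B> T j \<and> wf_qtree k \<B> T' (Suc j)"

section \<open>The decision tree of a vertex\<close>

locale batch_tracker = tracker n key L k \<Lambda>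
  for n :: nat and key :: "nat set \<Rightarrow> nat" and L k :: nat and \<Lambda> :: "nat \<Rightarrow> nat" +
  fixes E :: "nat set set" and \<B> :: "nat set set set" and R :: nat and v :: nat
  assumes E: "E \<subseteq> all_edges n" and part: "partition_on E \<B>" and v: "v < n"
begin

definition touching :: "nat set \<Rightarrow> nat set set set" where
  "touching S = {B \<in> \<B>. \<exists>e\<in>B. crossing S e}"

definition reached :: "nat set set list \<Rightarrow> nat set" where
  "reached Bs = component v (\<Union>(set Bs))"

text \<open>The bound \<open>R\<close> keeps the number of chains independent of \<open>n\<close>
  and of the degrees. A set touched by more batches has value \<open>0\<close> in the tree; in a
  good run so many of these batches arrive late that the tracker yields \<open>0\<close>
  too.\<close>

definition low :: "nat set set list \<Rightarrow> bool" where
  "low Bs \<longleftrightarrow> card (reached Bs) \<le> k \<and> card (touching (reached Bs)) \<le> R"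

text \<open>A superset of the sequences of batches that a tracker can take. The keys are ignored,
  since it depends on the times which batches are blocked.\<close>

inductive_set chains :: "nat set set list set" where
  Nil: "[] \<in> chains"
| snoc: "Bs \<in> chains \<Longrightarrow> low Bs \<Longrightarrow> B \<in> touching (reached Bs) \<Longrightarrow> Bs @ [B] \<in> chains"

text \<open>Contains every batch that the tree can query, whatever the times. Union bounds over
  batches run over this set, whose size does not grow with \<open>n\<close>.\<close>

definition relevant :: "nat set set set" where
  "relevant = (\<Union>Bs\<in>{Bs \<in> chains. low Bs}. touching (reached Bs))"

definition next_batch :: "nat set \<Rightarrow> nat set set set \<Rightarrow> nat set set" where
  "next_batch S X = (SOME B. B \<in> touching S - X \<and> (\<exists>e\<in>B. crossing S e \<and>
     (\<forall>B'\<in>touching S - X. \<forall>e'\<in>B'. crossing S e' \<longrightarrow> key e \<le> key e')))"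

text \<open>\<open>Bs\<close> are the batches taken and \<open>X\<close> those found blocked.
  \<open>f\<close> is fuel: a query uses up a batch outside both, so \<open>Suc (card \<B>)\<close>
  is enough at the root. When only blocked batches touch the reached set, the leaf carries the
  inverse size of a set that may be smaller than the component, because the tracker cannot tell the
  difference.\<close>

primrec mk_tree :: "nat \<Rightarrow> nat set set list \<Rightarrow> nat set set set \<Rightarrow> nat set set qtree" where
  "mk_tree 0 Bs X = Leaf 0"
| "mk_tree (Suc f) Bs X =
     (if \<not> low Bs then Leaf 0
      else if touching (reached Bs) - X = {} then Leaf (1 / real (card (reached Bs)))
      else Query (next_batch (reached Bs) X)
        (mk_tree f Bs (insert (next_batch (reached Bs) X) X))
        (mk_tree f (Bs @ [next_batch (reached Bs) X]) X))"

lemma finite_E: "finite E"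
  using E finite_all_edges finite_subset by blast

lemma finite_\<B>: "finite \<B>"
  using finite_elements[OF finite_E part] .

lemma batch_subset: "B \<in> \<B> \<Longrightarrow> B \<subseteq> E"
  using partition_onD1[OF part] by auto

lemma batch_unique: "e \<in> B \<Longrightarrow> e \<in> B' \<Longrightarrow> B \<in> \<B> \<Longrightarrow> B' \<in> \<B> \<Longrightarrow> B = B'"
  using partition_onD2[OF part] by (auto simp: disjoint_def)

lemma ex_batch: "e \<in> E \<Longrightarrow> \<exists>B\<in>\<B>. e \<in> B"
  using partition_onD1[OF part] by auto

lemma finite_touching: "finite (touching S)"
  using finite_\<B> by (simp add: touching_def)

lemma next_batch:
  assumes "touching S - X \<noteq> {}"
  shows "next_batch S X \<in> touching S - X"
    "\<exists>e\<in>next_batch S X. crossing S e \<and>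
     (\<forall>B'\<in>touching S - X. \<forall>e'\<in>B'. crossing S e' \<longrightarrow> key e \<le> key e')"
proof -
  define C where "C = {e. crossing S e \<and> (\<exists>B\<in>touching S - X. e \<in> B)}"
  have "C \<subseteq> E" using batch_subset by (auto simp: C_def touching_def)
  then have "finite C" using finite_E finite_subset by blast
  moreover have "C \<noteq> {}" using assms by (auto simp: C_def touching_def)
  ultimately obtain e where e: "e \<in> C" "\<forall>e'\<in>C. key e \<le> key e'"
    using arg_min_if_finite[of C key] by (meson linorder_not_less)
  then obtain B where "B \<in> touching S - X" "e \<in> B" by (auto simp: C_def)
  then have "\<exists>B. B \<in> touching S - X \<and> (\<exists>e\<in>B. crossing S e \<and>
     (\<forall>B'\<in>touching S - X. \<forall>e'\<in>B'. crossing S e' \<longrightarrow> key e \<le> key e'))"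
    using e by (intro exI[of _ B]) (auto simp: C_def)
  from someI_ex[OF this] show "next_batch S X \<in> touching S - X"
    "\<exists>e\<in>next_batch S X. crossing S e \<and>
     (\<forall>B'\<in>touching S - X. \<forall>e'\<in>B'. crossing S e' \<longrightarrow> key e \<le> key e')"
    unfolding next_batch_def by blast+
qed

lemma chain_batches: "Bs \<in> chains \<Longrightarrow> set Bs \<subseteq> \<B>"
  by (induction rule: chains.induct) (auto simp: touching_def)

lemma chain_Union: "Bs \<in> chains \<Longrightarrow> \<Union>(set Bs) \<subseteq> E"
  using chain_batches batch_subset by blast

lemma finite_reached: "Bs \<in> chains \<Longrightarrow> finite (reached Bs)"
  using finite_comp[OF v] chain_Union E unfolding reached_def by blast

lemma touching_fresh:
  assumes "Bs \<in> chains" shows "touching (reached Bs) \<inter> set Bs = {}"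
proof -
  have "\<not> crossing (reached Bs) e" if "e \<in> B" "B \<in> set Bs" for e B
    using not_crossing_comp[of "\<Union>(set Bs)" n e v] chain_Union[OF assms] E that
    unfolding reached_def by blast
  then show ?thesis by (auto simp: touching_def)
qed

lemma reached_grow:
  assumes "Bs \<in> chains" "B \<in> touching (reached Bs)"
  shows "reached Bs \<subset> reached (Bs @ [B])"
proof -
  obtain e where e: "e \<in> B" "crossing (reached Bs) e" "B \<in> \<B>"
    using assms by (auto simp: touching_def)
  then have "\<Union>(set (Bs @ [B])) \<subseteq> all_edges n"
    using chain_Union[OF assms(1)] batch_subset[of B] E by auto
  then show ?thesis
    using e crossing_comp_grow[of "\<Union>(set Bs)" "\<Union>(set (Bs @ [B]))" n e v]
    unfolding reached_def by auto
qed

text \<open>Each batch of a chain brings in a new vertex, so growing to at most \<open>k\<close>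
  vertices takes fewer than \<open>k\<close> levels.\<close>

lemma chain_length: "Bs \<in> chains \<Longrightarrow> length Bs + 1 \<le> card (reached Bs)"
proof (induction rule: chains.induct)
  case (snoc Bs B)
  then have "card (reached Bs) < card (reached (Bs @ [B]))"
    using reached_grow finite_reached chains.snoc psubset_card_mono by meson
  then show ?case using snoc by simp
qed (simp add: reached_def)

lemma chain_relevant: "Bs \<in> chains \<Longrightarrow> set Bs \<subseteq> relevant"
  by (induction rule: chains.induct) (auto simp: relevant_def)

lemma relevant_subset: "relevant \<subseteq> \<B>"
  by (auto simp: relevant_def touching_def)

lemma low_chain_length: "Bs \<in> chains \<Longrightarrow> low Bs \<Longrightarrow> length Bs < k"
  using chain_length[of Bs] by (auto simp: low_def)

lemma chain_length_le: "Bs \<in> chains \<Longrightarrow> length Bs \<le> k"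
  by (induction rule: chains.induct) (use low_chain_length in fastforce)+

lemma queries_mk_tree:
  assumes "Bs \<in> chains" shows "queries (mk_tree f Bs X) \<inter> (X \<union> set Bs) = {}"
  using assms
proof (induction f arbitrary: Bs X)
  case (Suc f)
  let ?B = "next_batch (reached Bs) X"
  show ?case
  proof (cases "low Bs \<and> touching (reached Bs) - X \<noteq> {}")
    case True
    then have B: "?B \<in> touching (reached Bs) - X" using next_batch by blast
    then have "Bs @ [?B] \<in> chains" using Suc.prems True chains.snoc by blast
    from Suc.IH[OF this, of X] Suc.IH[OF Suc.prems, of "insert ?B X"]
    show ?thesis using True B touching_fresh[OF Suc.prems] by auto
  qed auto
qed simp

lemma wf_mk_tree:
  assumes "Bs \<in> chains" shows "wf_qtree k \<B> (mk_tree f Bs X) (length Bs)"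
  using assms
proof (induction f arbitrary: Bs X)
  case 0
  then show ?case using chain_length_le by simp
next
  case (Suc f)
  let ?B = "next_batch (reached Bs) X"
  have le: "length Bs \<le> k" using Suc.prems chain_length_le by blast
  show ?case
  proof (cases "low Bs \<and> touching (reached Bs) - X \<noteq> {}")
    case True
    then have B: "?B \<in> touching (reached Bs) - X" using next_batch by blast
    then have ch: "Bs @ [?B] \<in> chains" using Suc.prems True chains.snoc by blast
    have "length Bs < k" using low_chain_length Suc.prems True by blast
    moreover have "?B \<in> \<B>" using B by (auto simp: touching_def)
    ultimately show ?thesis
      using True Suc.IH[OF ch, of X] Suc.IH[OF Suc.prems, of "insert ?B X"]
        queries_mk_tree[OF ch, of f X] queries_mk_tree[OF Suc.prems, of f "insert ?B X"] by auto
  next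
    case False
    have "1 \<le> card (reached Bs)" using chain_length[OF Suc.prems] by simp
    then show ?thesis using False le by auto
  qed
qed

text \<open>Crossing edges picked from different batches are different, and they all lie inside the
  component of \<open>v\<close>.\<close>

lemma touching_card_le:
  assumes "F \<subseteq> E" "finite S" "component v E \<subseteq> S"
  shows "card (touching (component v F)) \<le> card S ^ 2"
proof -
  define g where "g B = (SOME e. e \<in> B \<and> crossing (component v F) e)" for B
  have g: "g B \<in> B \<and> crossing (component v F) (g B)" if "B \<in> touching (component v F)" for B
    unfolding g_def by (rule someI_ex) (use that in \<open>auto simp: touching_def\<close>)
  have inj: "inj_on g (touching (component v F))"
    using g batch_unique by (metis (no_types, lifting) inj_onI mem_Collect_eq touching_def)
  have "card (g ` touching (component v F)) \<le> card S ^ 2"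
  proof (rule card_edges_within(1)[OF assms(2)])
    fix e assume "e \<in> g ` touching (component v F)"
    then obtain B where "B \<in> \<B>" "e \<in> B" "crossing (component v F) e"
      using g by (auto simp: touching_def)
    then have "e \<in> E" "crossing (component v F) e" using batch_subset by auto
    moreover from this have "e \<subseteq> component v E" by (rule crossing_sub_comp[OF assms(1) E])
    ultimately show "e \<subseteq> S \<and> card e = 2"
      using E assms(3) by (auto simp: all_edges_def)
  qed
  then show ?thesis using card_image[OF inj] by simp
qed

lemma reached_eq_comp:
  assumes "Bs \<in> chains" "touching (reached Bs) = {}"
  shows "reached Bs = component v E"
  unfolding reached_def
proof (rule crossing_reachable[OF chain_Union[OF assms(1)] E])
  fix e assume "e \<in> E"
  then obtain B where "B \<in> \<B>" "e \<in> B" using ex_batch by blast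
  then show "\<not> crossing (component v (\<Union>(set Bs))) e"
    using assms(2) by (auto simp: touching_def reached_def)
qed

lemma reached_subset: "Bs \<in> chains \<Longrightarrow> reached Bs \<subseteq> component v E"
  unfolding reached_def by (intro component_mono chain_Union)

definition true_weight :: real where
  "true_weight = (if card (component v E) \<le> k then 1 / real (card (component v E)) else 0)"

text \<open>With nothing blocked, the growth ends at the full component or at a set that is not low.
  The latter happens only in components with more than \<open>k\<close> vertices: in a smaller one
  at most \<open>k ^ 2 \<le> R\<close> batches touch any reached set.\<close>

lemma straight_leaf_mk_tree:
  assumes "Bs \<in> chains" "card (\<B> - set Bs) < f" "k ^ 2 \<le> R"
  shows "straight_leaf (mk_tree f Bs {}) = true_weight"
  using assms(1,2)
proof (induction f arbitrary: Bs)
  case (Suc f)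
  let ?B = "next_batch (reached Bs) {}"
  show ?case
  proof (cases "low Bs")
    case False
    have "card (component v E) > k"
    proof (rule ccontr)
      assume le: "\<not> card (component v E) > k"
      have fin: "finite (component v E)" using finite_comp[OF v E] .
      have "card (reached Bs) \<le> k"
        using card_mono[OF fin reached_subset[OF Suc.prems(1)]] le by simp
      moreover have "card (touching (reached Bs)) \<le> card (component v E) ^ 2"
        using touching_card_le[OF chain_Union[OF Suc.prems(1)] fin] by (simp add: reached_def)
      moreover have "card (component v E) ^ 2 \<le> k ^ 2" using le by (intro power_mono) auto
      ultimately show False using False assms(3) unfolding low_def by linarith
    qed
    then show ?thesis using False by (simp add: true_weight_def)
  next
    case True
    show ?thesis
    proof (cases "touching (reached Bs) = {}")
      case True
      then show ?thesis
        using \<open>low Bs\<close> reached_eq_comp[OF Suc.prems(1) True] by (simp add: true_weight_def low_def)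
    next
      case False
      then have B: "?B \<in> touching (reached Bs)" using next_batch(1)[of "reached Bs" "{}"] by auto
      then have ch: "Bs @ [?B] \<in> chains" using Suc.prems True chains.snoc by blast
      have "?B \<in> \<B> - set Bs" using B touching_fresh[OF Suc.prems(1)] by (auto simp: touching_def)
      then have "\<B> - set (Bs @ [?B]) \<subset> \<B> - set Bs" by auto
      then have "card (\<B> - set (Bs @ [?B])) < f"
        using psubset_card_mono[of "\<B> - set Bs"] finite_\<B> Suc.prems(2) by fastforce
      from Suc.IH[OF ch this] show ?thesis using True False by simp
    qed
  qed
qed simp

text \<open>This limits the dependence between vertices: all those whose straight path contains a
  given batch have an edge of that batch in their component.\<close>

lemma straight_path_mk_tree:
  assumes "Bs \<in> chains" "B \<in> straight_path (mk_tree f Bs {})"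
  shows "B \<in> \<B> \<and> (\<exists>e\<in>B. e \<subseteq> component v E)"
  using assms
proof (induction f arbitrary: Bs)
  case (Suc f)
  let ?B = "next_batch (reached Bs) {}"
  have low: "low Bs" and ne: "touching (reached Bs) - {} \<noteq> {}"
    using Suc.prems(2) by (auto split: if_splits)
  have B: "?B \<in> touching (reached Bs)" using next_batch(1)[OF ne] by auto
  then have ch: "Bs @ [?B] \<in> chains" using Suc.prems low chains.snoc by blast
  show ?case
  proof (cases "B = ?B")
    case True
    then obtain e where e: "e \<in> B" "crossing (reached Bs) e" "B \<in> \<B>"
      using B by (auto simp: touching_def)
    then have "e \<in> E" using batch_subset by blast
    then have "e \<subseteq> component v E"
      using crossing_sub_comp[OF chain_Union[OF Suc.prems(1)] E] e by (simp add: reached_def)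
    then show ?thesis using e by blast
  next
    case False
    then show ?thesis using Suc.IH[OF ch] Suc.prems(2) low ne by auto
  qed
qed simp

subsection \<open>The number of relevant batches\<close>

lemma chains_level:
  "finite {Bs \<in> chains. length Bs = j} \<and> card {Bs \<in> chains. length Bs = j} \<le> R ^ j"
proof (induction j)
  case 0
  have "{Bs \<in> chains. length Bs = 0} = {[]}" using chains.Nil by auto
  then show ?case by simp
next
  case (Suc j)
  let ?C = "{Bs \<in> chains. length Bs = j}"
  let ?C' = "{Bs \<in> ?C. low Bs}"
  have sub: "{Bs \<in> chains. length Bs = Suc j} \<subseteq>
      (\<Union>Bs\<in>?C'. (\<lambda>B. Bs @ [B]) ` touching (reached Bs))"
  proof
    fix Bs assume "Bs \<in> {Bs \<in> chains. length Bs = Suc j}"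
    then have "Bs \<in> chains" "length Bs = Suc j" by auto
    then show "Bs \<in> (\<Union>Bs\<in>?C'. (\<lambda>B. Bs @ [B]) ` touching (reached Bs))"
      by (cases rule: chains.cases) auto
  qed
  have fin: "finite ?C'" by (rule finite_subset[of _ ?C]) (use Suc in auto)
  have "card (\<Union>Bs\<in>?C'. (\<lambda>B. Bs @ [B]) ` touching (reached Bs)) \<le> (\<Sum>Bs\<in>?C'. R)"
  proof (rule order_trans[OF card_UN_le[OF fin]], rule sum_mono)
    fix Bs assume "Bs \<in> ?C'"
    then show "card ((\<lambda>B. Bs @ [B]) ` touching (reached Bs)) \<le> R"
      using card_image_le[OF finite_touching, of "\<lambda>B. Bs @ [B]" "reached Bs"] by (auto simp: low_def)
  qed
  also have "\<dots> \<le> R ^ j * R"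
  proof -
    have "card ?C' \<le> card ?C" by (rule card_mono) (use Suc in auto)
    then show ?thesis using Suc by (simp add: mult_right_mono)
  qed
  finally have le: "card (\<Union>Bs\<in>?C'. (\<lambda>B. Bs @ [B]) ` touching (reached Bs)) \<le> R ^ j * R" .
  have finU: "finite (\<Union>Bs\<in>?C'. (\<lambda>B. Bs @ [B]) ` touching (reached Bs))"
    using fin finite_touching by blast
  show ?case
    using finite_subset[OF sub finU] card_mono[OF finU sub] le by (simp add: mult.commute)
qed

lemma chains_card:
  assumes "1 \<le> R" shows "finite chains" "card chains \<le> (k + 1) * R ^ k"
proof -
  have eq: "chains = (\<Union>j\<in>{..k}. {Bs \<in> chains. length Bs = j})"
    using chain_length_le by auto
  show "finite chains" by (subst eq) (use chains_level in blast)
  have "card (\<Union>j\<in>{..k}. {Bs \<in> chains. length Bs = j}) \<le> (\<Sum>j\<in>{..k}. card {Bs \<in> chains. length Bs = j})"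
    by (rule card_UN_le) simp
  also have "\<dots> \<le> (\<Sum>j\<in>{..k}. R ^ k)"
  proof (rule sum_mono)
    fix j assume "j \<in> {..k}"
    then show "card {Bs \<in> chains. length Bs = j} \<le> R ^ k"
      using chains_level[of j] power_increasing[of j k R] assms by (meson atMost_iff order_trans)
  qed
  finally show "card chains \<le> (k + 1) * R ^ k" using eq by simp
qed

lemma relevant_card:
  assumes "1 \<le> R" shows "card relevant \<le> (k + 1) * R ^ (k + 1)"
proof -
  have fin: "finite {Bs \<in> chains. low Bs}" using chains_card[OF assms] by auto
  have "card relevant \<le> (\<Sum>Bs\<in>{Bs \<in> chains. low Bs}. R)"
    unfolding relevant_def
    by (rule order_trans[OF card_UN_le[OF fin]], rule sum_mono) (auto simp: low_def)
  also have "\<dots> \<le> card chains * R"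
    using card_mono[of chains "{Bs \<in> chains. low Bs}"] chains_card[OF assms] by auto
  also have "\<dots> \<le> (k + 1) * R ^ k * R" using chains_card[OF assms] by (intro mult_right_mono) auto
  finally show ?thesis by (simp add: algebra_simps)
qed

end

section \<open>The tracker follows the decision tree\<close>

text \<open>The conditions for following the tree, free of probability. A relevant batch stays
  within one cell (\<open>cell\<close>), which it shares with no other relevant batch
  (\<open>inj\<close>) and which is not truncated by the cap (\<open>kept\<close>).
  \<open>late\<close> deals with small sets touched by too many batches: more than
  \<open>k ^ 2\<close> of these come after the last slot.\<close>

locale good_run = batch_tracker n key L k \<Lambda> E \<B> R v
  for n :: nat and key :: "nat set \<Rightarrow> nat" and L k :: nat and \<Lambda> :: "nat \<Rightarrow> nat"
    and E :: "nat set set" and \<B> :: "nat set set set" and R :: nat and v :: nat +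
  fixes cl :: "nat set \<Rightarrow> nat" and cb :: "nat set set \<Rightarrow> nat" and A :: "(nat set \<times> nat) set"
    and \<rho> :: real
  assumes A: "A \<subseteq> (\<lambda>e. (e, cl e)) ` E"
    and cell: "B \<in> relevant \<Longrightarrow> e \<in> B \<Longrightarrow> cl e = cb B"
    and inj: "inj_on cb relevant"
    and kept: "B \<in> relevant \<Longrightarrow> 1 \<le> cb B div L \<Longrightarrow> cb B div L \<le> k \<Longrightarrow> e \<in> E \<Longrightarrow> cl e = cb B
      \<Longrightarrow> (e, cl e) \<in> A"
    and late: "Bs \<in> chains \<Longrightarrow> card (reached Bs) \<le> k \<Longrightarrow> R < card (touching (reached Bs)) \<Longrightarrow>
      k ^ 2 < card {B \<in> touching (reached Bs). \<forall>e\<in>B. k < cl e div L}"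
begin

declare coll.simps(2) [simp del]

definition items :: "(nat set \<times> nat) set" where
  "items = (\<lambda>e. (e, cl e)) ` E"

definition slot :: "nat set set \<Rightarrow> nat" where
  "slot B = cb B div L"

definition weight :: real where
  "weight = (if (\<exists>u\<in>items. violation v A u) \<or> card (grown v A k) > k then 0
     else (1 / \<rho>) ^ levels v A / real (card (grown v A k)))"

lemma A_items: "A \<subseteq> items"
  using A by (simp add: items_def)

lemma proper_A: "proper A"
proof (rule proper_mono[OF _ A_items])
  show "proper items"
    using finite_E E by (auto simp: proper_def items_def inj_on_def image_image)
qed

lemma A_cell: "(e, c) \<in> A \<Longrightarrow> e \<in> E \<and> c = cl e"
  using A by auto

lemma coll_E: "coll v A j \<subseteq> E"
  by (induction j) (use A_cell in \<open>auto simp: coll.simps(2)\<close>)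

lemma coll_mono: "i \<le> j \<Longrightarrow> coll v A i \<subseteq> coll v A j"
  by (rule lift_Suc_mono_le[of "coll v A"]) (auto simp: coll.simps(2))

lemma finite_grown: "finite (grown v A j)"
  using finite_comp[OF v] coll_E E by (meson order_trans)

lemma grown_card:
  assumes "\<forall>i<j. front (grown v A i) A i \<noteq> {}"
  shows "j + 1 \<le> card (grown v A j)"
  using assms
proof (induction j)
  case (Suc j)
  then have "front (grown v A j) A j \<noteq> {}" by simp
  then obtain e c where b: "best (grown v A j) A j (e, c)" by (rule ex_best[OF proper_A])
  then have c: "(e, c) \<in> A" "crossing (grown v A j) e" by (auto simp: best_def front_def)
  then have "e \<in> coll v A (Suc j)" using b unfolding coll.simps by blast
  then have "grown v A j \<subset> grown v A (Suc j)"
    using crossing_comp_grow[OF coll_mono order_trans[OF coll_E E]] c(2) by (metis le_SucI order_refl)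
  then have "card (grown v A j) < card (grown v A (Suc j))"
    by (rule psubset_card_mono[OF finite_grown])
  then show ?case using Suc by simp
qed simp

lemma coll_front_empty: "front (grown v A j) A j = {} \<Longrightarrow> coll v A (Suc j) = coll v A j"
  by (auto simp: best_def coll.simps(2))

lemma violationI:
  assumes "j < k" "Suc j < c div L" "crossing (grown v A j) e"
    "\<And>p. p \<in> front (grown v A j) A j \<Longrightarrow> key e < key (fst p)"
  shows "violation v A (e, c)"
  unfolding violation_def using assms by blast

text \<open>If the weight were not \<open>0\<close>, having at most \<open>k\<close> vertices after
  \<open>k\<close> levels would mean that some front was empty. The absence of violations then
  freezes the set from that level on, and the late crossing edge is a violation after all.\<close>

lemma crossing_late_weight:
  assumes "e \<in> E" "crossing (grown v A k) e" "k < cl e div L"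
  shows "weight = 0"
proof (rule ccontr)
  assume "weight \<noteq> 0"
  then have nv: "\<And>u. u \<in> items \<Longrightarrow> \<not> violation v A u" and ck: "card (grown v A k) \<le> k"
    by (auto simp: weight_def split: if_splits)
  obtain j where j: "j < k" "front (grown v A j) A j = {}"
    using grown_card[of k] ck by force
  have eqs: "coll v A i = coll v A j" if "j \<le> i" "i \<le> k" for i
    using that
  proof (induction i rule: dec_induct)
    case (step i)
    then have eq: "coll v A i = coll v A j" by simp
    have "front (grown v A i) A i = {}"
    proof (cases "i = j")
      case False
      show ?thesis
      proof (rule ccontr)
        assume "front (grown v A i) A i \<noteq> {}"
        then obtain e' c' where f: "(e', c') \<in> A" "c' div L = Suc i" "crossing (grown v A j) e'"
          using eq by (auto simp: front_def)
        then have "violation v A (e', c')"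
          by (intro violationI[of j]) (use j False step in auto)
        then show False using nv A_items f by blast
      qed
    qed (use j in simp)
    then show ?case using coll_front_empty[of i] eq by simp
  qed simp
  have "coll v A k = coll v A j" using j(1) by (intro eqs) auto
  then have "violation v A (e, cl e)"
    by (intro violationI[of j]) (use j assms in auto)
  then show False using nv assms(1) by (auto simp: items_def)
qed

text \<open>More than \<open>k ^ 2\<close> late batches each supply a crossing edge of the reached
  set. A grown set of at most \<open>k\<close> vertices cannot contain all these edges, so one of
  them crosses it and comes too late.\<close>

lemma not_low_weight:
  assumes "Bs \<in> chains" "\<not> low Bs" "reached Bs \<subseteq> grown v A k"
  shows "weight = 0"
proof (cases "card (grown v A k) \<le> k")
  case True
  let ?S = "grown v A k"
  have "card (reached Bs) \<le> k" using card_mono[OF finite_grown assms(3)] True by simp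
  then have "R < card (touching (reached Bs))" using assms(2) by (simp add: low_def)
  from late[OF assms(1) \<open>card (reached Bs) \<le> k\<close> this]
  have many: "k ^ 2 < card {B \<in> touching (reached Bs). \<forall>e\<in>B. k < cl e div L}" (is "_ < card ?D") .
  define g where "g B = (SOME e. e \<in> B \<and> crossing (reached Bs) e)" for B
  have g: "g B \<in> B \<and> crossing (reached Bs) (g B)" if "B \<in> ?D" for B
    unfolding g_def by (rule someI_ex) (use that in \<open>auto simp: touching_def\<close>)
  have inj: "inj_on g ?D"
  proof (rule inj_onI)
    fix B B' assume *: "B \<in> ?D" "B' \<in> ?D" "g B = g B'"
    then have "B \<in> \<B>" "B' \<in> \<B>" by (auto simp: touching_def)
    then show "B = B'" using g[OF *(1)] g[OF *(2)] *(3) batch_unique by metis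
  qed
  have gE: "g B \<in> E" if "B \<in> ?D" for B
    using g[OF that] that batch_subset by (auto simp: touching_def)
  have "\<exists>B\<in>?D. \<not> g B \<subseteq> ?S"
  proof (rule ccontr)
    assume *: "\<not> (\<exists>B\<in>?D. \<not> g B \<subseteq> ?S)"
    have "card (g ` ?D) \<le> card ?S ^ 2"
      by (rule card_edges_within(1)[OF finite_grown]) (use * gE E in \<open>auto simp: all_edges_def\<close>)
    also have "\<dots> \<le> k ^ 2" using True power_mono by blast
    finally show False using many card_image[OF inj] by simp
  qed
  then obtain B where B: "B \<in> ?D" "\<not> g B \<subseteq> ?S" by blast
  have "crossing ?S (g B)" using g[OF B(1)] B(2) assms(3) by (auto simp: crossing_def)
  then show ?thesis using crossing_late_weight[of "g B"] gE[OF B(1)] g[OF B(1)] B(1) by auto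
qed (simp add: weight_def)

text \<open>\<open>consistent Bs X\<close> says that the run has followed the path of the tree with taken batches \<open>Bs\<close>
  and blocked batches \<open>X\<close>.\<close>

definition consistent :: "nat set set list \<Rightarrow> nat set set set \<Rightarrow> bool" where
  "consistent Bs X \<longleftrightarrow> Bs \<in> chains \<and> X \<subseteq> relevant \<and> (\<forall>B\<in>X. slot B \<le> length Bs) \<and>
     (\<forall>i<length Bs. front (grown v A i) A i \<noteq> {}) \<and>
     (\<forall>i<length Bs. \<forall>e\<in>E. Suc i < cl e div L \<longrightarrow> crossing (grown v A i) e \<longrightarrow>
        (\<exists>p\<in>front (grown v A i) A i. key (fst p) \<le> key e)) \<and>
     coll v A (length Bs) = {e \<in> E. cl e \<in> cb ` set Bs} \<and>
     grown v A (length Bs) = reached Bs"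

lemma consistent_grown_subset:
  "consistent Bs X \<Longrightarrow> length Bs \<le> k \<Longrightarrow> reached Bs \<subseteq> grown v A k"
  unfolding consistent_def by (metis component_mono coll_mono)

lemma crossing_batch:
  assumes "e \<in> E" "crossing (reached Bs) e" "Bs \<in> chains" "low Bs"
  shows "\<exists>B. e \<in> B \<and> B \<in> touching (reached Bs) \<and> B \<in> relevant \<and> cl e = cb B"
proof -
  obtain B where B: "B \<in> \<B>" "e \<in> B" using ex_batch assms by blast
  then have "B \<in> touching (reached Bs)" using assms by (auto simp: touching_def)
  moreover from this have "B \<in> relevant" using assms by (auto simp: relevant_def)
  ultimately show ?thesis using cell B by blast
qed

text \<open>All crossing edges lie in blocked batches, hence arrived too early to be seen at this
  level or a later one. The growth halts, and nothing comes afterwards that could be a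
  violation.\<close>

lemma consistent_leaf:
  assumes c: "consistent Bs X" and low: "low Bs" and X: "touching (reached Bs) - X = {}"
  shows "weight = (1 / \<rho>) ^ length Bs / real (card (reached Bs))"
proof -
  let ?j = "length Bs"
  note C = c[unfolded consistent_def]
  have jk: "?j < k" using low_chain_length low C by blast
  have early: "cl e div L \<le> ?j" if "e \<in> E" "crossing (reached Bs) e" for e
  proof -
    have "\<exists>B\<in>touching (reached Bs). cl e = cb B"
      using crossing_batch[OF that] C low by blast
    then show ?thesis using X C by (auto simp: slot_def)
  qed
  have cg: "grown v A ?j = reached Bs" using C by blast
  have fr0: "front (grown v A i) A i = {}" if i: "?j \<le> i" "coll v A i = coll v A ?j" for i
  proof (rule ccontr)
    assume "front (grown v A i) A i \<noteq> {}"
    then obtain e c where ec: "(e, c) \<in> front (grown v A i) A i" by auto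
    have "grown v A i = reached Bs" using i(2) cg by simp
    then have "e \<in> E" "crossing (reached Bs) e" "cl e div L = Suc i"
      using ec A_cell[of e c] by (auto simp: front_def)
    then show False using early[of e] i(1) by simp
  qed
  have eq: "coll v A i = coll v A ?j" if "?j \<le> i" for i
    using that
  proof (induction i rule: dec_induct)
    case (step i)
    then show ?case using coll_front_empty[of i] fr0[of i] by simp
  qed simp
  have fr: "front (grown v A i) A i = {}" if "?j \<le> i" for i
    by (rule fr0[OF that eq[OF that]])
  have nv: "\<not> violation v A u" if u: "u \<in> items" for u
  proof
    assume "violation v A u"
    then obtain e i where e: "e \<in> E" "i < k" "Suc i < cl e div L" "crossing (grown v A i) e"
      "\<forall>p\<in>front (grown v A i) A i. key e < key (fst p)"
      using u by (auto simp: violation_def items_def)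
    show False
    proof (cases "i < ?j")
      case True
      then obtain p where "p \<in> front (grown v A i) A i" "key (fst p) \<le> key e" using C e by meson
      then show False using e(5) by force
    next
      case False
      then have "grown v A i = reached Bs" using eq[of i] cg by simp
      then show False using early[of e] e False by simp
    qed
  qed
  have "\<And>i. i < ?j \<Longrightarrow> front (grown v A i) A i \<noteq> {}" using C by blast
  then have lv: "{i. i < k \<and> front (grown v A i) A i \<noteq> {}} = {..<?j}"
  proof (intro set_eqI iffI)
    fix i assume "i \<in> {i. i < k \<and> front (grown v A i) A i \<noteq> {}}"
    then show "i \<in> {..<?j}" using fr[of i] by (cases "i < ?j") auto
  qed (use jk in auto)
  have "coll v A k = coll v A ?j" using eq[of k] jk by simp
  then have gk: "grown v A k = reached Bs" using cg by metis
  have nv': "\<not> (\<exists>u\<in>items. violation v A u)" using nv by blast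
  have lev: "levels v A = ?j" unfolding levels_def lv by simp
  have "\<not> k < card (reached Bs)" using low by (simp add: low_def)
  then show ?thesis
    unfolding weight_def gk lev using nv' by (simp only: if_False simp_thms)
qed

lemma consistent_block:
  "consistent Bs X \<Longrightarrow> B \<in> relevant \<Longrightarrow> slot B \<le> length Bs \<Longrightarrow> consistent Bs (insert B X)"
  by (auto simp: consistent_def)

text \<open>A crossing edge in a slot after \<open>length Bs\<close> is not in a blocked batch, so
  the queried edge is preferred to it. Thus the tree, which skips the blocked batches, and the
  tracker, which has not seen them, look for the same edge.\<close>

lemma next_batch_properties:
  assumes c: "consistent Bs X" and low: "low Bs" and ne: "touching (reached Bs) - X \<noteq> {}"
    and B_def: "B = next_batch (reached Bs) X" and nb: "\<not> slot B \<le> length Bs"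
  shows "B \<in> touching (reached Bs) - X" "B \<in> relevant"
    "\<exists>e\<in>B. crossing (reached Bs) e \<and> e \<in> E \<and> cl e = cb B \<and>
      (\<forall>e'\<in>E. crossing (reached Bs) e' \<longrightarrow> length Bs < cl e' div L \<longrightarrow> key e \<le> key e')"
proof -
  note C = c[unfolded consistent_def]
  show B: "B \<in> touching (reached Bs) - X" unfolding B_def using next_batch[OF ne] by blast
  show rel: "B \<in> relevant" using B C low by (auto simp: relevant_def)
  obtain e where e: "e \<in> B" "crossing (reached Bs) e"
      "\<forall>B'\<in>touching (reached Bs) - X. \<forall>e'\<in>B'. crossing (reached Bs) e' \<longrightarrow> key e \<le> key e'"
    using next_batch(2)[OF ne] B_def by blast
  have "key e \<le> key e'" if "e' \<in> E" "crossing (reached Bs) e'" "length Bs < cl e' div L" for e'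
  proof -
    have "\<exists>B'. e' \<in> B' \<and> B' \<in> touching (reached Bs) \<and> cl e' = cb B'"
      using crossing_batch[OF that(1,2)] C low by blast
    then obtain B' where "e' \<in> B'" "B' \<in> touching (reached Bs)" "cl e' = cb B'" by blast
    moreover from this have "B' \<notin> X" using C that(3) by (auto simp: slot_def)
    ultimately show ?thesis using e that by blast
  qed
  moreover have "e \<in> E" using e B batch_subset by (auto simp: touching_def)
  ultimately show "\<exists>e\<in>B. crossing (reached Bs) e \<and> e \<in> E \<and> cl e = cb B \<and>
      (\<forall>e'\<in>E. crossing (reached Bs) e' \<longrightarrow> length Bs < cl e' div L \<longrightarrow> key e \<le> key e')"
    using e cell[OF rel] by blast
qed

lemma consistent_later:
  assumes c: "consistent Bs X" and low: "low Bs" and ne: "touching (reached Bs) - X \<noteq> {}"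
    and B_def: "B = next_batch (reached Bs) X" and nb: "Suc (length Bs) < slot B"
  shows "weight = 0"
proof -
  let ?j = "length Bs"
  note C = c[unfolded consistent_def]
  have jk: "?j < k" using low_chain_length low C by blast
  obtain e where e: "e \<in> B" "crossing (reached Bs) e" "e \<in> E" "cl e = cb B"
    "\<forall>e'\<in>E. crossing (reached Bs) e' \<longrightarrow> ?j < cl e' div L \<longrightarrow> key e \<le> key e'"
    using next_batch_properties[OF c low ne B_def] nb by auto
  have "key e < key e'" if "(e', c') \<in> front (grown v A ?j) A ?j" for e' c'
  proof -
    have e': "e' \<in> E" "cl e' div L = Suc ?j" "crossing (reached Bs) e'"
      using that A_cell C by (auto simp: front_def)
    then have "key e \<le> key e'" using e(5) by simp
    moreover have "e \<noteq> e'" using e' e(4) nb by (auto simp: slot_def)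
    then have "key e \<noteq> key e'" using inj_key e(3) e'(1) E by (meson inj_onD subsetD)
    ultimately show ?thesis by simp
  qed
  then have "violation v A (e, cl e)"
    by (intro violationI[of ?j]) (use jk e nb C in \<open>auto simp: slot_def\<close>)
  then show ?thesis using e(3) by (auto simp: weight_def items_def)
qed

text \<open>The least crossing edge of \<open>B\<close> is the best one at this level, so the cell
  of \<open>B\<close> is taken. Equality of the grown set with \<open>reached\<close> needs
  \<open>low\<close>: otherwise other edges of that cell might be attached to the set.\<close>

lemma consistent_take:
  assumes c: "consistent Bs X" and low: "low Bs" and ne: "touching (reached Bs) - X \<noteq> {}"
    and B_def: "B = next_batch (reached Bs) X" and sb: "slot B = Suc (length Bs)"
  shows "Bs @ [B] \<in> chains"
    "reached (Bs @ [B]) \<subseteq> grown v A (Suc (length Bs))"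
    "low (Bs @ [B]) \<Longrightarrow> consistent (Bs @ [B]) X"
proof -
  let ?j = "length Bs"
  note C = c[unfolded consistent_def]
  have jk: "?j < k" using low_chain_length low C by blast
  note P = next_batch_properties[OF c low ne B_def]
  have B: "B \<in> touching (reached Bs) - X" "B \<in> relevant" using P sb by auto
  obtain e where e: "e \<in> B" "crossing (reached Bs) e" "e \<in> E" "cl e = cb B"
    "\<forall>e'\<in>E. crossing (reached Bs) e' \<longrightarrow> ?j < cl e' div L \<longrightarrow> key e \<le> key e'"
    using P sb by auto
  show ch: "Bs @ [B] \<in> chains" using B C low chains.snoc by blast
  have cbk: "1 \<le> cb B div L" "cb B div L \<le> k" using sb jk by (auto simp: slot_def)
  have eA: "(e, cb B) \<in> A" using kept[OF B(2) cbk e(3,4)] e(4) by simp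
  have fr: "(e, cb B) \<in> front (grown v A ?j) A ?j"
    using eA e C sb by (auto simp: front_def slot_def)
  have be: "best (grown v A ?j) A ?j (e, cb B)"
    unfolding best_def
  proof (intro conjI ballI fr)
    fix p assume "p \<in> front (grown v A ?j) A ?j"
    then have "fst p \<in> E" "cl (fst p) div L = Suc ?j" "crossing (reached Bs) (fst p)"
      using A_cell C by (auto simp: front_def)
    then show "key (fst (e, cb B)) \<le> key (fst p)" using e(5) by simp
  qed
  have cellA: "(e', cb B) \<in> A \<longleftrightarrow> e' \<in> E \<and> cl e' = cb B" for e'
    using A_cell kept[OF B(2) cbk, of e'] by auto
  have "coll v A (Suc ?j) = coll v A ?j \<union> {e'. (e', cb B) \<in> A}"
    unfolding coll.simps using be best_unique[OF proper_A _ be] by blast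
  then have coll: "coll v A (Suc ?j) = {e \<in> E. cl e \<in> cb ` set (Bs @ [B])}"
    using C cellA by auto
  have "\<Union>(set (Bs @ [B])) \<subseteq> coll v A (Suc ?j)"
  proof
    fix e' assume "e' \<in> \<Union>(set (Bs @ [B]))"
    then obtain B' where "e' \<in> B'" "B' \<in> set (Bs @ [B])" by blast
    then have B': "e' \<in> B'" "B' \<in> set (Bs @ [B])" "B' \<in> relevant" using chain_relevant[OF ch] by blast+
    then have "e' \<in> E" "cl e' = cb B'" using cell relevant_subset batch_subset by blast+
    then show "e' \<in> coll v A (Suc ?j)" using coll B' by auto
  qed
  then show sub: "reached (Bs @ [B]) \<subseteq> grown v A (Suc ?j)"
    unfolding reached_def by (rule component_mono)
  assume low': "low (Bs @ [B])"
  \<comment> \<open>The collected cells may contain edges of further batches. Such an edge, if it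
    crossed the reached set, would lie in a relevant batch that shares a cell with a batch of the
    chain, hence in that batch itself, and batches of the chain do not cross.\<close>
  have "grown v A (Suc ?j) \<subseteq> reached (Bs @ [B])"
  proof (rule component_subset_uncrossed)
    show "v \<in> reached (Bs @ [B])" by (simp add: reached_def component_self)
    fix e' assume "e' \<in> coll v A (Suc ?j)"
    then obtain B1 where e': "e' \<in> E" "B1 \<in> set (Bs @ [B])" "cl e' = cb B1" using coll by auto
    show "\<not> crossing (reached (Bs @ [B])) e'"
    proof
      assume "crossing (reached (Bs @ [B])) e'"
      then obtain B' where B': "B' \<in> touching (reached (Bs @ [B]))" "B' \<in> relevant" "cl e' = cb B'"
        using crossing_batch[OF e'(1) _ ch low'] by blast
      then have "B' = B1" using inj chain_relevant[OF ch] e' by (metis inj_onD subsetD)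
      then show False using touching_fresh[OF ch] B' e' by blast
    qed
  qed
  then have grown: "grown v A (Suc ?j) = reached (Bs @ [B])" using sub by blast
  have key: "\<exists>p\<in>front (grown v A ?j) A ?j. key (fst p) \<le> key e'"
    if "e' \<in> E" "Suc ?j < cl e' div L" "crossing (grown v A ?j) e'" for e'
    using that e(5) C by (intro bexI[OF _ fr]) auto
  show "consistent (Bs @ [B]) X"
    unfolding consistent_def
  proof (intro conjI)
    show "\<forall>i<length (Bs @ [B]). front (grown v A i) A i \<noteq> {}"
      using C fr by (auto simp: less_Suc_eq)
    show "\<forall>i<length (Bs @ [B]). \<forall>e\<in>E. Suc i < cl e div L \<longrightarrow> crossing (grown v A i) e \<longrightarrow>
        (\<exists>p\<in>front (grown v A i) A i. key (fst p) \<le> key e)"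
      using C key by (auto simp: less_Suc_eq)
  qed (use ch C coll grown in auto)
qed

lemma weight_eq_tree:
  assumes "consistent Bs X" "card (\<B> - X - set Bs) < f"
  shows "weight = (1 / \<rho>) ^ length Bs * tval \<rho> slot (mk_tree f Bs X) (length Bs)"
  using assms
proof (induction f arbitrary: Bs X)
  case (Suc f)
  let ?j = "length Bs" and ?B = "next_batch (reached Bs) X"
  note C = Suc.prems(1)[unfolded consistent_def]
  have jk: "?j \<le> k" using chain_length_le C by blast
  show ?case
  proof (cases "low Bs")
    case False
    then have "weight = 0"
      using not_low_weight[OF _ False consistent_grown_subset[OF Suc.prems(1) jk]] C by blast
    then show ?thesis using False by simp
  next
    case low: True
    show ?thesis
    proof (cases "touching (reached Bs) - X = {}")
      case True
      then show ?thesis using consistent_leaf[OF Suc.prems(1) low True] low by simp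
    next
      case ne: False
      have B: "?B \<in> touching (reached Bs) - X" using next_batch[OF ne] by blast
      then have rel: "?B \<in> relevant" using C low by (auto simp: relevant_def)
      have fresh: "?B \<in> \<B> - X - set Bs"
        using B rel relevant_subset touching_fresh[of Bs] C by blast
      have less: "card Y < f" if "Y \<subset> \<B> - X - set Bs" for Y
        using psubset_card_mono[OF _ that] finite_\<B> Suc.prems(2) by simp
      have sub: "\<B> - insert b X - S \<subset> \<B> - X - S" "\<B> - X - insert b S \<subset> \<B> - X - S"
        if "b \<in> \<B> - X - S" for b S using that by blast+
      have snoc: "set (Bs @ [?B]) = insert ?B (set Bs)" by simp
      have card: "card (\<B> - insert ?B X - set Bs) < f" "card (\<B> - X - set (Bs @ [?B])) < f"
        unfolding snoc by (rule less[OF sub(1)[OF fresh]], rule less[OF sub(2)[OF fresh]])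
      consider "slot ?B \<le> ?j" | "slot ?B = Suc ?j" | "Suc ?j < slot ?B" by linarith
      then show ?thesis
      proof cases
        case 1
        then show ?thesis
          using Suc.IH[OF consistent_block[OF Suc.prems(1) rel 1] card(1)] low ne by simp
      next
        case 2
        note T = consistent_take[OF Suc.prems(1) low ne refl 2]
        show ?thesis
        proof (cases "low (Bs @ [?B])")
          case True
          then show ?thesis using Suc.IH[OF T(3)[OF True] card(2)] low ne 2 by simp
        next
          case False
          have "Suc ?j \<le> k" using chain_length_le[OF T(1)] by simp
          then have "reached (Bs @ [?B]) \<subseteq> grown v A k"
            using T(2) component_mono[OF coll_mono] by blast
          then have "weight = 0" using not_low_weight[OF T(1) False] by blast
          moreover have "mk_tree f (Bs @ [?B]) X = Leaf 0" using False by (cases f) auto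
          ultimately show ?thesis using low ne 2 by simp
        qed
      next
        case 3
        then show ?thesis using consistent_later[OF Suc.prems(1) low ne refl 3] low ne by simp
      qed
    qed
  qed
qed simp

theorem weight_eq: "weight = tval \<rho> slot (mk_tree (Suc (card \<B>)) [] {}) 0"
proof -
  have "consistent [] {}"
    by (auto simp: consistent_def chains.Nil reached_def)
  from weight_eq_tree[OF this, of "Suc (card \<B>)"] show ?thesis by simp
qed

end

section \<open>Functions of finitely many independent coordinates\<close>

definition depends_on :: "'i set \<Rightarrow> (('i \<Rightarrow> 'a) \<Rightarrow> 'b) \<Rightarrow> bool" where
  "depends_on J f \<longleftrightarrow> (\<forall>s t. (\<forall>i\<in>J. s i = t i) \<longrightarrow> f s = f t)"

lemma depends_onD: "depends_on J f \<Longrightarrow> (\<And>i. i \<in> J \<Longrightarrow> s i = t i) \<Longrightarrow> f s = f t"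
  by (auto simp: depends_on_def)

lemma depends_on_mono: "depends_on J f \<Longrightarrow> J \<subseteq> J' \<Longrightarrow> depends_on J' f"
  unfolding depends_on_def by blast

lemma depends_on_comp2:
  assumes "depends_on J f" "depends_on J g" shows "depends_on J (\<lambda>x. h (f x) (g x))"
  unfolding depends_on_def using depends_onD[OF assms(1)] depends_onD[OF assms(2)] by metis

text \<open>Fubini for the coordinates in \<open>J\<close> and the rest: \<open>merge\<close>
  assembles a point from the two blocks, and each block feeds one factor.\<close>

lemma (in product_prob_space) integral_mult_depends_on:
  fixes f g :: "('i \<Rightarrow> 'a) \<Rightarrow> real" and a b :: real
  assumes fin: "finite I" and J: "J \<subseteq> I"
    and f: "f \<in> borel_measurable (Pi\<^sub>M I M)" "\<And>x. \<bar>f x\<bar> \<le> a" "depends_on J f"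
    and g: "g \<in> borel_measurable (Pi\<^sub>M I M)" "\<And>x. \<bar>g x\<bar> \<le> b" "depends_on (I - J) g"
  shows "(\<integral>x. f x * g x \<partial>Pi\<^sub>M I M) = (\<integral>x. f x \<partial>Pi\<^sub>M I M) * (\<integral>x. g x \<partial>Pi\<^sub>M I M)"
proof -
  define K where "K = I - J"
  have I: "J \<union> K = I" "J \<inter> K = {}" "finite J" "finite K"
    using J fin finite_subset by (auto simp: K_def)
  interpret J: product_prob_space M J by unfold_locales
  interpret K: product_prob_space M K by unfold_locales
  define F where "F x = f (merge J K (x, \<lambda>_. undefined))" for x
  define G where "G y = g (merge J K (\<lambda>_. undefined, y))" for y
  have fF: "f (merge J K (x, y)) = F x" for x y
    unfolding F_def by (rule depends_onD[OF f(3)]) (simp add: merge_def)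
  have gG: "g (merge J K (x, y)) = G y" for x y
    unfolding G_def by (rule depends_onD[OF g(3)]) (use I in \<open>auto simp: merge_def K_def\<close>)
  have ab: "0 \<le> a" "0 \<le> b" using f(2)[of undefined] g(2)[of undefined] by linarith+
  have int: "integrable (Pi\<^sub>M I M) h" if "h \<in> borel_measurable (Pi\<^sub>M I M)" "\<And>x. \<bar>h x\<bar> \<le> c"
    for h :: "_ \<Rightarrow> real" and c :: real
    by (rule P.integrable_const_bound[of _ c]) (use that in auto)
  have fold: "(\<integral>x. h x \<partial>Pi\<^sub>M I M) = (\<integral>x. (\<integral>y. h (merge J K (x, y)) \<partial>Pi\<^sub>M K M) \<partial>Pi\<^sub>M J M)"
    if "integrable (Pi\<^sub>M I M) h" for h :: "_ \<Rightarrow> real"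
    using product_integral_fold[of J K h] I that by simp
  have "\<bar>f x * g x\<bar> \<le> a * b" for x
    unfolding abs_mult using f(2) g(2) ab by (intro mult_mono) auto
  then have "integrable (Pi\<^sub>M I M) (\<lambda>x. f x * g x)"
    using f(1) g(1) by (intro int[of _ "a * b"]) auto
  from fold[OF this] have "(\<integral>x. f x * g x \<partial>Pi\<^sub>M I M) = (\<integral>x. F x \<partial>Pi\<^sub>M J M) * (\<integral>y. G y \<partial>Pi\<^sub>M K M)"
    by (simp add: fF gG)
  moreover have "(\<integral>x. f x \<partial>Pi\<^sub>M I M) = (\<integral>x. F x \<partial>Pi\<^sub>M J M)"
    using fold[OF int[OF f(1,2)]] by (simp add: fF K.P.prob_space)
  moreover have "(\<integral>x. g x \<partial>Pi\<^sub>M I M) = (\<integral>y. G y \<partial>Pi\<^sub>M K M)"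
    using fold[OF int[OF g(1,2)]] by (simp add: gG J.P.prob_space)
  ultimately show ?thesis by simp
qed

text \<open>Covariances vanish for pairs that read disjoint sets of coordinates; at most
  \<open>card S * d\<close> pairs remain, each contributing at most
  \<open>c\<^sup>2\<close>.\<close>

lemma (in product_prob_space) sum_second_moment_le:
  fixes X :: "'j \<Rightarrow> ('i \<Rightarrow> 'a) \<Rightarrow> real" and c :: real
  assumes fin: "finite I" "finite S"
    and X: "\<And>i. i \<in> S \<Longrightarrow> X i \<in> borel_measurable (Pi\<^sub>M I M)" "\<And>i x. i \<in> S \<Longrightarrow> 0 \<le> X i x \<and> X i x \<le> c"
    and D: "\<And>i. i \<in> S \<Longrightarrow> D i \<subseteq> I \<and> depends_on (D i) (X i)"
    and d: "\<And>i. i \<in> S \<Longrightarrow> card {j \<in> S. D i \<inter> D j \<noteq> {}} \<le> d"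
  shows "(\<integral>x. ((\<Sum>i\<in>S. X i x) - (\<Sum>i\<in>S. \<integral>y. X i y \<partial>Pi\<^sub>M I M))\<^sup>2 \<partial>Pi\<^sub>M I M) \<le> real (card S) * real d * c\<^sup>2"
proof -
  define Y where "Y i x = X i x - (\<integral>y. X i y \<partial>Pi\<^sub>M I M)" for i x
  have int: "integrable (Pi\<^sub>M I M) h" if "h \<in> borel_measurable (Pi\<^sub>M I M)" "\<And>x. \<bar>h x\<bar> \<le> c"
    for h :: "_ \<Rightarrow> real" and c :: real
    by (rule P.integrable_const_bound[of _ c]) (use that in auto)
  have Xint: "integrable (Pi\<^sub>M I M) (X i)" if "i \<in> S" for i
    using X[OF that] by (intro int[of _ c]) auto
  have EX: "0 \<le> (\<integral>y. X i y \<partial>Pi\<^sub>M I M)" "(\<integral>y. X i y \<partial>Pi\<^sub>M I M) \<le> c" if "i \<in> S" for i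
  proof -
    show "0 \<le> (\<integral>y. X i y \<partial>Pi\<^sub>M I M)" using X(2)[OF that] by simp
    have "(\<integral>y. X i y \<partial>Pi\<^sub>M I M) \<le> (\<integral>y. c \<partial>Pi\<^sub>M I M)"
      by (rule integral_mono) (use X(2)[OF that] Xint[OF that] in auto)
    then show "(\<integral>y. X i y \<partial>Pi\<^sub>M I M) \<le> c" by (simp add: P.prob_space)
  qed
  have Ym: "Y i \<in> borel_measurable (Pi\<^sub>M I M)" if "i \<in> S" for i
    unfolding Y_def using X(1)[OF that] by measurable
  have Yc: "\<bar>Y i x\<bar> \<le> c" if "i \<in> S" for i x
    using X(2)[OF that, of x] EX[OF that] unfolding Y_def by linarith
  have Y0: "(\<integral>x. Y i x \<partial>Pi\<^sub>M I M) = 0" if "i \<in> S" for i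
    unfolding Y_def using Xint[OF that] by (simp add: P.prob_space)
  have Yd: "depends_on (D i) (Y i)" if "i \<in> S" for i
    using D[OF that] depends_on_comp2[of "D i" "X i" "X i" "\<lambda>a b. a - (\<integral>y. X i y \<partial>Pi\<^sub>M I M)"]
    unfolding Y_def by simp
  have YY: "\<bar>Y i x * Y j x\<bar> \<le> c\<^sup>2" if "i \<in> S" "j \<in> S" for i j x
  proof -
    have "0 \<le> c" using Yc[OF that(1), of x] by linarith
    then show ?thesis unfolding abs_mult power2_eq_square using Yc that by (intro mult_mono) auto
  qed
  have YYint: "integrable (Pi\<^sub>M I M) (\<lambda>x. Y i x * Y j x)" if "i \<in> S" "j \<in> S" for i j
    using Ym that YY[OF that] by (intro int[of _ "c\<^sup>2"]) auto
  have cov: "(\<integral>x. Y i x * Y j x \<partial>Pi\<^sub>M I M) \<le> (if D i \<inter> D j \<noteq> {} then c\<^sup>2 else 0)"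
    if "i \<in> S" "j \<in> S" for i j
  proof (cases "D i \<inter> D j = {}")
    case True
    have "(\<integral>x. Y i x * Y j x \<partial>Pi\<^sub>M I M) = (\<integral>x. Y i x \<partial>Pi\<^sub>M I M) * (\<integral>x. Y j x \<partial>Pi\<^sub>M I M)"
    proof (rule integral_mult_depends_on[OF fin(1)])
      show "D i \<subseteq> I" using D that by blast
      show "depends_on (I - D i) (Y j)" by (rule depends_on_mono[OF Yd]) (use D True that in blast)+
    qed (use Ym Yc Yd that in blast)+
    then show ?thesis using Y0 that True by simp
  next
    case False
    have "(\<integral>x. Y i x * Y j x \<partial>Pi\<^sub>M I M) \<le> (\<integral>x. c\<^sup>2 \<partial>Pi\<^sub>M I M)"
      using YY[OF that] by (intro integral_mono YYint that) (auto simp: abs_le_iff)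
    then show ?thesis using False by (simp add: P.prob_space)
  qed
  have "(\<integral>x. ((\<Sum>i\<in>S. X i x) - (\<Sum>i\<in>S. \<integral>y. X i y \<partial>Pi\<^sub>M I M))\<^sup>2 \<partial>Pi\<^sub>M I M)
      = (\<integral>x. (\<Sum>i\<in>S. \<Sum>j\<in>S. Y i x * Y j x) \<partial>Pi\<^sub>M I M)"
    by (simp add: Y_def sum_subtractf[symmetric] power2_eq_square sum_product)
  also have "\<dots> = (\<Sum>i\<in>S. \<Sum>j\<in>S. \<integral>x. Y i x * Y j x \<partial>Pi\<^sub>M I M)"
    using YYint by (simp add: Bochner_Integration.integral_sum Bochner_Integration.integrable_sum)
  also have "\<dots> \<le> (\<Sum>i\<in>S. \<Sum>j\<in>S. if D i \<inter> D j \<noteq> {} then c\<^sup>2 else 0)"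
    by (intro sum_mono cov)
  also have "\<dots> = (\<Sum>i\<in>S. real (card {j \<in> S. D i \<inter> D j \<noteq> {}}) * c\<^sup>2)"
    using fin(2) by (simp add: sum.If_cases Int_def)
  also have "\<dots> \<le> (\<Sum>i\<in>S. real d * c\<^sup>2)"
    by (intro sum_mono mult_right_mono) (use d in auto)
  finally show ?thesis by simp
qed

text \<open>The elementary inequality 2 a |y| \<le> y^2 + a^2 takes the place of
  Cauchy-Schwarz.\<close>

lemma (in prob_space) abs_expectation_le_of_square:
  fixes Y :: "'a \<Rightarrow> real"
  assumes i1: "integrable M Y" and i2: "integrable M (\<lambda>x. (Y x)\<^sup>2)"
    and sq: "(\<integral>x. (Y x)\<^sup>2 \<partial>M) \<le> a\<^sup>2" and a: "0 < a"
  shows "(\<integral>x. \<bar>Y x\<bar> \<partial>M) \<le> a"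
proof -
  have "2 * a * (\<integral>x. \<bar>Y x\<bar> \<partial>M) = (\<integral>x. 2 * a * \<bar>Y x\<bar> \<partial>M)" by simp
  also have "\<dots> \<le> (\<integral>x. (Y x)\<^sup>2 + a\<^sup>2 \<partial>M)"
  proof (rule integral_mono)
    fix x
    have "0 \<le> (\<bar>Y x\<bar> - a)\<^sup>2" by simp
    then show "2 * a * \<bar>Y x\<bar> \<le> (Y x)\<^sup>2 + a\<^sup>2" by (simp add: power2_diff algebra_simps)
  qed (use i1 i2 in auto)
  also have "\<dots> = (\<integral>x. (Y x)\<^sup>2 \<partial>M) + a\<^sup>2" using i2 by (simp add: prob_space)
  also have "\<dots> \<le> 2 * a * a" using sq by (simp add: power2_eq_square)
  finally show ?thesis using a by simp
qed

section \<open>Independent uniform start times\<close>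

abbreviation unif01 :: "real measure" where
  "unif01 \<equiv> uniform_measure lborel {0..1}"

lemma prob_space_unif01: "prob_space unif01"
  by (rule prob_space_uniform_measure) auto

lemma measure_unif01: "A \<in> sets borel \<Longrightarrow> measure unif01 A = measure lborel ({0..1} \<inter> A)"
  by simp

lemma measure_unif01_le:
  assumes "A \<in> sets borel" "A \<inter> {0..1} \<subseteq> C" "C \<in> sets borel" "emeasure lborel C < \<infinity>"
  shows "measure unif01 A \<le> measure lborel C"
  unfolding measure_unif01[OF assms(1)]
  by (rule measure_mono_fmeasurable) (use assms in \<open>auto intro: fmeasurableI\<close>)

lemma measure_unif01_near:
  assumes "0 \<le> a" shows "measure unif01 {z. \<bar>z - y\<bar> \<le> a} \<le> 2 * a"
proof -
  have "measure unif01 {z. \<bar>z - y\<bar> \<le> a} \<le> measure lborel {y - a..y + a}"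
    by (rule measure_unif01_le) (use assms in \<open>auto simp: abs_le_iff\<close>)
  then show ?thesis using assms by simp
qed

lemma measure_unif01_less: "0 \<le> p \<Longrightarrow> measure unif01 {z. z < p} \<le> p"
proof -
  assume "0 \<le> p"
  moreover have "{z. z < p} \<inter> {0..1} \<subseteq> {0..p}" by auto
  ultimately show ?thesis using measure_unif01_le[of "{z. z < p}" "{0..p}"] by simp
qed

text \<open>The value must be exactly \<rho>, because the factor 1/\<rho> has to cancel it;
  therefore the slot must lie entirely within the unit interval.\<close>

lemma measure_unif01_slot:
  assumes "0 < \<rho>" "(real i + 1) * \<rho> \<le> 1"
  shows "measure unif01 {z. nat \<lfloor>z / \<rho>\<rfloor> = i} = \<rho>"
proof -
  have "0 \<le> i * \<rho>" using assms by simp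
  have eq: "nat \<lfloor>z / \<rho>\<rfloor> = i \<longleftrightarrow> i * \<rho> \<le> z \<and> z < (real i + 1) * \<rho>" if "0 \<le> z" for z
  proof -
    have "nat \<lfloor>z / \<rho>\<rfloor> = i \<longleftrightarrow> \<lfloor>z / \<rho>\<rfloor> = int i" using that assms by (simp add: nat_eq_iff)
    also have "\<dots> \<longleftrightarrow> i * \<rho> \<le> z \<and> z < (real i + 1) * \<rho>"
      using assms by (simp add: floor_eq_iff pos_le_divide_eq pos_divide_less_eq)
    finally show ?thesis .
  qed
  have set: "{0..1} \<inter> {z. nat \<lfloor>z / \<rho>\<rfloor> = i} = {i * \<rho>..<(real i + 1) * \<rho>}"
  proof (intro set_eqI iffI)
    fix z assume "z \<in> {0..1} \<inter> {z. nat \<lfloor>z / \<rho>\<rfloor> = i}"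
    then show "z \<in> {i * \<rho>..<(real i + 1) * \<rho>}" using eq[of z] by simp
  next
    fix z assume "z \<in> {i * \<rho>..<(real i + 1) * \<rho>}"
    then have z: "i * \<rho> \<le> z" "z < (real i + 1) * \<rho>" by auto
    then have "0 \<le> z" "z \<le> 1" using assms \<open>0 \<le> i * \<rho>\<close> by linarith+
    then show "z \<in> {0..1} \<inter> {z. nat \<lfloor>z / \<rho>\<rfloor> = i}" using eq[of z] z by simp
  qed
  have "(\<lambda>z::real. nat \<lfloor>z / \<rho>\<rfloor>) \<in> borel \<rightarrow>\<^sub>M count_space UNIV" by measurable
  then have "{z. nat \<lfloor>z / \<rho>\<rfloor> = i} \<in> sets borel" by measurable
  then show ?thesis
    using assms by (simp add: measure_unif01 set algebra_simps)
qed

lemma measure_unif01_slot_le: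
  assumes "0 < \<rho>"
  shows "measure unif01 {z. nat \<lfloor>z / \<rho>\<rfloor> \<le> i} \<le> (real i + 1) * \<rho>"
proof -
  have "(\<lambda>z::real. nat \<lfloor>z / \<rho>\<rfloor>) \<in> borel \<rightarrow>\<^sub>M count_space UNIV" by measurable
  then have m: "{z. nat \<lfloor>z / \<rho>\<rfloor> \<le> i} \<in> sets borel" by measurable
  have "z \<le> (real i + 1) * \<rho>" if "nat \<lfloor>z / \<rho>\<rfloor> \<le> i" for z
  proof -
    have "\<lfloor>z / \<rho>\<rfloor> \<le> int i" using that by linarith
    then have "z / \<rho> < real i + 1" by linarith
    then show ?thesis using assms by (simp add: pos_divide_less_eq)
  qed
  then have "{z. nat \<lfloor>z / \<rho>\<rfloor> \<le> i} \<inter> {0..1} \<subseteq> {0..(real i + 1) * \<rho>}" by auto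
  from measure_unif01_le[OF m this] show ?thesis using assms by simp
qed

text \<open>The offending times form intervals of length \<open>w\<close> to the left of multiples
  of \<open>h\<close>. Only positive multiples up to 2 matter, since both \<open>z\<close> and
  \<open>w\<close> are at most 1, and there are at most 2 / h of them.\<close>

lemma measure_unif01_straddle:
  fixes h w :: real
  assumes "0 < h" "0 \<le> w" "w \<le> 1"
  shows "{z. \<exists>c::int. z < c * h \<and> c * h \<le> z + w} \<in> sets borel"
    "measure unif01 {z. \<exists>c::int. z < c * h \<and> c * h \<le> z + w} \<le> 2 * w / h"
proof -
  let ?A = "{z. \<exists>c::int. z < c * h \<and> c * h \<le> z + w}"
  have "?A = (\<Union>c::int. {c * h - w..<c * h})" by (auto simp: diff_le_eq)
  then show m: "?A \<in> sets borel" by simp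
  let ?N = "\<lfloor>2 / h\<rfloor>" let ?C = "\<Union>c\<in>{1..?N}. {c * h - w..c * h}"
  have N: "0 \<le> ?N" using assms by simp
  have "c \<in> {1..?N}" if "z \<in> {0..1}" "z < c * h" "c * h \<le> z + w" for z and c :: int
  proof -
    have "0 < c * h" "c * h \<le> 2" using that assms by auto
    then have "0 < c" "c \<le> 2 / h" using assms by (auto simp: zero_less_mult_iff pos_le_divide_eq)
    then show ?thesis by (simp add: le_floor_iff)
  qed
  then have sub: "?A \<inter> {0..1} \<subseteq> ?C" by fastforce
  have em: "emeasure lborel ?C < \<infinity>"
  proof -
    have "emeasure lborel ?C \<le> (\<Sum>c\<in>{1..?N}. emeasure lborel {c * h - w..c * h})"
      by (rule emeasure_subadditive_finite) auto
    also have "\<dots> < \<infinity>" using assms(2) by (simp add: ennreal_mult_less_top of_nat_less_top)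
    finally show ?thesis .
  qed
  have "measure unif01 ?A \<le> measure lborel ?C"
    by (rule measure_unif01_le[OF m sub _ em]) auto
  also have "\<dots> \<le> (\<Sum>c\<in>{1..?N}. measure lborel {c * h - w..c * h})"
    by (rule measure_UNION_le) auto
  also have "\<dots> = real_of_int ?N * w" using assms N by simp
  also have "\<dots> \<le> 2 / h * w" using assms by (intro mult_right_mono) auto
  finally show "measure unif01 ?A \<le> 2 * w / h" by simp
qed

locale batch_times =
  fixes \<B> :: "nat set set set"
  assumes finite_batches: "finite \<B>"
begin

sublocale T: product_prob_space "\<lambda>_ :: nat set set. unif01" \<B>
  by (rule product_prob_spaceI) (rule prob_space_unif01)

lemma start_times_PiM: "start_times \<B> = (\<Pi>\<^sub>M B\<in>\<B>. unif01)"
  by (simp add: start_times_def)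

sublocale S: prob_space "start_times \<B>"
  unfolding start_times_PiM by (rule T.P.prob_space_axioms)

lemma time_measurable [measurable]: "B \<in> \<B> \<Longrightarrow> (\<lambda>t. t B) \<in> borel_measurable (start_times \<B>)"
  using measurable_component_singleton[of B \<B> "\<lambda>_. unif01"]
  by (simp add: start_times_PiM measurable_def)

lemma integrable_bounded:
  "f \<in> borel_measurable (start_times \<B>) \<Longrightarrow> (\<And>t. \<bar>f t\<bar> \<le> (c :: real)) \<Longrightarrow> integrable (start_times \<B>) (f :: _ \<Rightarrow> real)"
  by (rule S.integrable_const_bound[of _ c]) auto

lemma measure_time:
  assumes "B \<in> \<B>" "A \<in> sets borel"
  shows "measure (start_times \<B>) {t \<in> space (start_times \<B>). t B \<in> A} = measure unif01 A"
  using T.emeasure_PiM_Collect_single[OF assms(1), of A] assms(2)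
  by (simp add: measure_def start_times_PiM)

lemma integral_time:
  assumes "B \<in> \<B>" "A \<in> sets borel"
  shows "(\<integral>t. indicator A (t B) \<partial>start_times \<B>) = measure unif01 A"
proof -
  have "(\<integral>t. indicator A (t B) \<partial>start_times \<B>)
      = (\<integral>t. indicator {t \<in> space (start_times \<B>). t B \<in> A} t \<partial>start_times \<B>)"
    by (rule Bochner_Integration.integral_cong) (auto simp: indicator_def)
  also have "\<dots> = measure (start_times \<B>) ({t \<in> space (start_times \<B>). t B \<in> A} \<inter> space (start_times \<B>))"
    by simp
  also have "{t \<in> space (start_times \<B>). t B \<in> A} \<inter> space (start_times \<B>) = {t \<in> space (start_times \<B>). t B \<in> A}"
    by auto
  also have "measure (start_times \<B>) \<dots> = measure unif01 A" by (rule measure_time[OF assms])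
  finally show ?thesis .
qed

lemma integral_time_mult:
  fixes g :: "(nat set set \<Rightarrow> real) \<Rightarrow> real" and c :: real
  assumes "B \<in> \<B>" "A \<in> sets borel" "g \<in> borel_measurable (start_times \<B>)" "\<And>t. \<bar>g t\<bar> \<le> c"
    "depends_on (\<B> - {B}) g"
  shows "(\<integral>t. indicator A (t B) * g t \<partial>start_times \<B>) = measure unif01 A * (\<integral>t. g t \<partial>start_times \<B>)"
proof -
  have "(\<lambda>t. indicator A (t B) :: real) \<in> borel_measurable (start_times \<B>)"
    using assms(1,2) by measurable
  then have "(\<integral>t. indicator A (t B) * g t \<partial>start_times \<B>)
      = (\<integral>t. indicator A (t B) \<partial>start_times \<B>) * (\<integral>t. g t \<partial>start_times \<B>)"
    using assms finite_batches unfolding start_times_PiM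
    by (intro T.integral_mult_depends_on[of "{B}" _ 1 _ c])
       (auto simp: depends_on_def indicator_def)
  then show ?thesis using integral_time[OF assms(1,2)] by simp
qed

text \<open>The adversary is constrained only for times in this box, so statements about the stream
  hold almost surely rather than everywhere.\<close>

lemma AE_start_times: "AE t in start_times \<B>. t \<in> (\<Pi>\<^sub>E B\<in>\<B>. {0..1})"
proof -
  have "AE t in start_times \<B>. t B \<in> {0..1}" if "B \<in> \<B>" for B
  proof -
    have "measure (start_times \<B>) {t \<in> space (start_times \<B>). t B \<in> {0..1}} = 1"
      using measure_time[OF that, of "{0..1}"] by simp
    then show ?thesis by (subst (asm) S.prob_Collect_eq_1) (use that in measurable)
  qed
  then have "AE t in start_times \<B>. \<forall>B\<in>\<B>. t B \<in> {0..1}"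
    using finite_batches by (intro AE_finite_allI) auto
  then show ?thesis
    by (rule AE_mp) (auto simp: start_times_PiM space_PiM PiE_def intro!: AE_I2)
qed

subsection \<open>Expected value of a decision tree\<close>

definition slot_of :: "real \<Rightarrow> (nat set set \<Rightarrow> real) \<Rightarrow> nat set set \<Rightarrow> nat" where
  "slot_of \<rho> t B = nat \<lfloor>t B / \<rho>\<rfloor>"

lemma slot_measurable [measurable]:
  assumes [measurable]: "B \<in> \<B>"
  shows "(\<lambda>t. slot_of \<rho> t B) \<in> start_times \<B> \<rightarrow>\<^sub>M count_space UNIV"
  unfolding slot_of_def by measurable

lemma tval_measurable:
  "queries T \<subseteq> \<B> \<Longrightarrow> (\<lambda>t. tval \<rho> (slot_of \<rho> t) T j) \<in> borel_measurable (start_times \<B>)"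
proof (induction T arbitrary: j)
  case (Query B T T')
  then have [measurable]: "B \<in> \<B>" "\<And>j. (\<lambda>t. tval \<rho> (slot_of \<rho> t) T j) \<in> borel_measurable (start_times \<B>)"
    "\<And>j. (\<lambda>t. tval \<rho> (slot_of \<rho> t) T' j) \<in> borel_measurable (start_times \<B>)" by auto
  show ?case by simp
qed simp

lemma straight_measurable:
  "queries T \<subseteq> \<B> \<Longrightarrow> (\<lambda>t. straight \<rho> (slot_of \<rho> t) T j) \<in> borel_measurable (start_times \<B>)"
proof (induction T arbitrary: j)
  case (Query B T T')
  then have [measurable]: "B \<in> \<B>"
    "\<And>j. (\<lambda>t. straight \<rho> (slot_of \<rho> t) T' j) \<in> borel_measurable (start_times \<B>)" by auto
  show ?case by simp
qed simp

end

lemma wf_qtree_queries: "wf_qtree k \<B> T j \<Longrightarrow> queries T \<subseteq> \<B>"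
  by (induction T arbitrary: j) auto

lemma straight_path_queries: "straight_path T \<subseteq> queries T"
  by (induction T) auto

lemma tval_cong: "(\<And>B. B \<in> queries T \<Longrightarrow> s B = s' B) \<Longrightarrow> tval \<rho> s T j = tval \<rho> s' T j"
  by (induction T arbitrary: j) auto

lemma straight_cong:
  "(\<And>B. B \<in> straight_path T \<Longrightarrow> s B = s' B) \<Longrightarrow> straight \<rho> s T j = straight \<rho> s' T j"
  by (induction T arbitrary: j) auto

lemma tval_bounds:
  assumes "wf_qtree k \<B> T j" "0 < \<rho>" "\<rho> \<le> 1"
  shows "0 \<le> straight \<rho> s T j" "straight \<rho> s T j \<le> tval \<rho> s T j" "tval \<rho> s T j \<le> (1 / \<rho>) ^ (k - j)"
proof -
  have "0 \<le> straight \<rho> s T j \<and> straight \<rho> s T j \<le> tval \<rho> s T j \<and> tval \<rho> s T j \<le> (1 / \<rho>) ^ (k - j)"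
    using assms(1)
  proof (induction T arbitrary: j)
    case (Leaf r)
    have "1 \<le> (1 / \<rho>) ^ (k - j)" using assms by (intro one_le_power) simp
    then show ?case using Leaf by simp
  next
    case (Query B T T')
    then have 1: "0 \<le> straight \<rho> s T j \<and> straight \<rho> s T j \<le> tval \<rho> s T j \<and> tval \<rho> s T j \<le> (1 / \<rho>) ^ (k - j)"
      and 2: "0 \<le> straight \<rho> s T' (Suc j) \<and> straight \<rho> s T' (Suc j) \<le> tval \<rho> s T' (Suc j) \<and>
        tval \<rho> s T' (Suc j) \<le> (1 / \<rho>) ^ (k - Suc j)" and j: "j < k" by auto
    have "k - j = Suc (k - Suc j)" using j by simp
    then have "1 / \<rho> * tval \<rho> s T' (Suc j) \<le> (1 / \<rho>) ^ (k - j)"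
      using 2 assms by (auto intro!: divide_right_mono)
    moreover have "0 \<le> (1 / \<rho>) ^ (k - j)" using assms by simp
    moreover have "1 / \<rho> * straight \<rho> s T' (Suc j) \<le> 1 / \<rho> * tval \<rho> s T' (Suc j)"
      "0 \<le> 1 / \<rho> * straight \<rho> s T' (Suc j)"
      using 2 assms by (auto intro!: divide_right_mono)
    ultimately show ?case using 1 by auto
  qed
  then show "0 \<le> straight \<rho> s T j" "straight \<rho> s T j \<le> tval \<rho> s T j" "tval \<rho> s T j \<le> (1 / \<rho>) ^ (k - j)"
    by auto
qed

lemma straight_zero: "straight_leaf T = 0 \<Longrightarrow> straight \<rho> s T j = 0"
  by (induction T arbitrary: j) auto

lemma card_straight_path: "wf_qtree k \<B> T j \<Longrightarrow> finite (straight_path T) \<and> card (straight_path T) \<le> k - j"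
proof (induction T arbitrary: j)
  case (Query B T T')
  then have "finite (straight_path T') \<and> card (straight_path T') \<le> k - Suc j" "j < k" by auto
  then show ?case using card_insert_le_m1[of "k - j" "straight_path T'" B] by auto
qed simp

context batch_times
begin

context
  fixes \<rho> p :: real and k :: nat
  assumes \<rho>: "0 < \<rho>" and p: "p = (k + 1) * \<rho>" "p < 1"
begin

lemma rho_le: "\<rho> \<le> 1"
proof -
  have "\<rho> \<le> p" using \<rho> unfolding p(1) by simp
  then show ?thesis using p by simp
qed

lemma slot_sets: "{z. nat \<lfloor>z / \<rho>\<rfloor> \<le> j} \<in> sets borel" "{z. nat \<lfloor>z / \<rho>\<rfloor> = j} \<in> sets borel"
proof -
  have "(\<lambda>z::real. nat \<lfloor>z / \<rho>\<rfloor>) \<in> borel \<rightarrow>\<^sub>M count_space UNIV" by measurable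
  then show "{z. nat \<lfloor>z / \<rho>\<rfloor> \<le> j} \<in> sets borel" "{z. nat \<lfloor>z / \<rho>\<rfloor> = j} \<in> sets borel"
    by measurable
qed

lemma integral_blocked:
  assumes "B \<in> \<B>" "j < k" "g \<in> borel_measurable (start_times \<B>)" "\<And>t. 0 \<le> g t \<and> g t \<le> (c :: real)"
    "depends_on (\<B> - {B}) g"
  shows "(\<integral>t. (if slot_of \<rho> t B \<le> j then g t else 0) \<partial>start_times \<B>) \<le> p * (\<integral>t. g t \<partial>start_times \<B>)"
proof -
  have "(\<integral>t. (if slot_of \<rho> t B \<le> j then g t else 0) \<partial>start_times \<B>)
      = (\<integral>t. indicator {z. nat \<lfloor>z / \<rho>\<rfloor> \<le> j} (t B) * g t \<partial>start_times \<B>)"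
    by (rule Bochner_Integration.integral_cong) (auto simp: slot_of_def)
  also have "\<dots> = measure unif01 {z. nat \<lfloor>z / \<rho>\<rfloor> \<le> j} * (\<integral>t. g t \<partial>start_times \<B>)"
    by (rule integral_time_mult[where c = c]) (use assms slot_sets in auto)
  also have "\<dots> \<le> p * (\<integral>t. g t \<partial>start_times \<B>)"
  proof (rule mult_right_mono)
    have "(real j + 1) * \<rho> \<le> p" unfolding p using \<rho> assms(2) by (intro mult_right_mono) auto
    then show "measure unif01 {z. nat \<lfloor>z / \<rho>\<rfloor> \<le> j} \<le> p"
      using measure_unif01_slot_le[OF \<rho>, of j] by linarith
  qed (use assms(4) in simp)
  finally show ?thesis .
qed

lemma integral_taken:
  assumes "B \<in> \<B>" "j < k" "g \<in> borel_measurable (start_times \<B>)" "\<And>t. 0 \<le> g t \<and> g t \<le> (c :: real)"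
    "depends_on (\<B> - {B}) g"
  shows "(\<integral>t. (if slot_of \<rho> t B = Suc j then 1 / \<rho> * g t else 0) \<partial>start_times \<B>) = (\<integral>t. g t \<partial>start_times \<B>)"
proof -
  have "(\<integral>t. (if slot_of \<rho> t B = Suc j then 1 / \<rho> * g t else 0) \<partial>start_times \<B>)
      = (\<integral>t. 1 / \<rho> * (indicator {z. nat \<lfloor>z / \<rho>\<rfloor> = Suc j} (t B) * g t) \<partial>start_times \<B>)"
    by (rule Bochner_Integration.integral_cong) (auto simp: slot_of_def)
  also have "\<dots> = 1 / \<rho> * (\<integral>t. indicator {z. nat \<lfloor>z / \<rho>\<rfloor> = Suc j} (t B) * g t \<partial>start_times \<B>)"
    by (rule integral_mult_right_zero)
  also have "\<dots> = 1 / \<rho> * (measure unif01 {z. nat \<lfloor>z / \<rho>\<rfloor> = Suc j} * (\<integral>t. g t \<partial>start_times \<B>))"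
    by (subst integral_time_mult[where c = c]) (use assms slot_sets in auto)
  also have "measure unif01 {z. nat \<lfloor>z / \<rho>\<rfloor> = Suc j} = \<rho>"
  proof (rule measure_unif01_slot[OF \<rho>])
    have "(real (Suc j) + 1) * \<rho> \<le> p" unfolding p using \<rho> assms(2) by (intro mult_right_mono) auto
    then show "(real (Suc j) + 1) * \<rho> \<le> 1" using p by simp
  qed
  finally show ?thesis using \<rho> by simp
qed

lemma tree_depends:
  "B \<notin> queries T \<Longrightarrow> queries T \<subseteq> \<B> \<Longrightarrow> depends_on (\<B> - {B}) (\<lambda>t. tval \<rho> (slot_of \<rho> t) T j)"
  unfolding depends_on_def
proof (intro allI impI tval_cong)
  fix s t :: "nat set set \<Rightarrow> real" and B'
  assume "B \<notin> queries T" "queries T \<subseteq> \<B>" "\<forall>i\<in>\<B> - {B}. s i = t i" "B' \<in> queries T"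
  then have "s B' = t B'" by (metis Diff_iff singletonD subsetD)
  then show "slot_of \<rho> s B' = slot_of \<rho> t B'" by (simp add: slot_of_def)
qed

lemma straight_depends: "depends_on (straight_path T) (\<lambda>t. straight \<rho> (slot_of \<rho> t) T j)"
  unfolding depends_on_def by (intro allI impI straight_cong) (auto simp: slot_of_def)

text \<open>A blocked batch costs a factor p and keeps the level; for a taken one the weight cancels
  the probability and one level is used up. With m levels left the bound satisfies V_m = p V_m +
  V_(m-1), whence q^m, regardless of the number of queries. For the difference the whole blocked
  branch counts as error: D_m \<le> p q^m + D_(m-1).\<close>

lemma tree_expectation:
  assumes "wf_qtree k \<B> T j"
  defines "q \<equiv> 1 / (1 - p)"
  shows "(\<integral>t. tval \<rho> (slot_of \<rho> t) T j \<partial>start_times \<B>) \<le> q ^ (k - j)" (is ?A)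
    "(\<integral>t. straight \<rho> (slot_of \<rho> t) T j \<partial>start_times \<B>) = straight_leaf T" (is ?B)
    "(\<integral>t. tval \<rho> (slot_of \<rho> t) T j - straight \<rho> (slot_of \<rho> t) T j \<partial>start_times \<B>)
       \<le> real (k - j) * p * q ^ (k - j)" (is ?C)
proof -
  have p0: "0 < p" using \<rho> p by simp
  have q: "1 \<le> q" "p * q + 1 = q" using p0 p(2) by (auto simp: q_def field_simps)
  let ?V = "\<lambda>T j t. tval \<rho> (slot_of \<rho> t) T j" and ?W = "\<lambda>T j t. straight \<rho> (slot_of \<rho> t) T j"
  let ?M = "start_times \<B>"
  have "(\<integral>t. ?V T j t \<partial>?M) \<le> q ^ (k - j) \<and> (\<integral>t. ?W T j t \<partial>?M) = straight_leaf T \<and>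
    (\<integral>t. ?V T j t - ?W T j t \<partial>?M) \<le> real (k - j) * p * q ^ (k - j)"
    using assms(1)
  proof (induction T arbitrary: j)
    case (Leaf r)
    have "1 \<le> q ^ (k - j)" using q by (intro one_le_power) simp
    moreover have "0 \<le> real (k - j) * p * q ^ (k - j)" using p0 q by simp
    ultimately show ?case using Leaf by (simp add: S.prob_space)
  next
    case (Query B T T')
    then have wf: "wf_qtree k \<B> T j" "wf_qtree k \<B> T' (Suc j)"
      and B: "B \<in> \<B>" "B \<notin> queries T" "B \<notin> queries T'" and j: "j < k" by auto
    note IH1 = Query.IH(1)[OF wf(1)] and IH2 = Query.IH(2)[OF wf(2)]
    have [measurable]: "?V T j \<in> borel_measurable ?M" "?V T' (Suc j) \<in> borel_measurable ?M"
      "?W T' (Suc j) \<in> borel_measurable ?M"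
      using wf_qtree_queries[OF wf(1)] wf_qtree_queries[OF wf(2)] tval_measurable straight_measurable by auto
    note [measurable] = B(1)
    note b1 = tval_bounds[OF wf(1) \<rho> rho_le] and b2 = tval_bounds[OF wf(2) \<rho> rho_le]
    have V1: "0 \<le> ?V T j t \<and> ?V T j t \<le> (1 / \<rho>) ^ (k - j)" for t
      using b1[of "slot_of \<rho> t"] by linarith
    have V2: "0 \<le> ?V T' (Suc j) t \<and> ?V T' (Suc j) t \<le> (1 / \<rho>) ^ (k - Suc j)"
      and W2: "0 \<le> ?W T' (Suc j) t \<and> ?W T' (Suc j) t \<le> (1 / \<rho>) ^ (k - Suc j)"
      and D2: "0 \<le> ?V T' (Suc j) t - ?W T' (Suc j) t \<and> ?V T' (Suc j) t - ?W T' (Suc j) t \<le> (1 / \<rho>) ^ (k - Suc j)" for t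
      using b2[of "slot_of \<rho> t"] by linarith+
    have d1: "depends_on (\<B> - {B}) (?V T j)" and d2: "depends_on (\<B> - {B}) (?V T' (Suc j))"
      using tree_depends B wf_qtree_queries wf by blast+
    have d3: "depends_on (\<B> - {B}) (?W T' (Suc j))"
      by (rule depends_on_mono[OF straight_depends])
         (use straight_path_queries[of T'] wf_qtree_queries[OF wf(2)] B in blast)
    have d4: "depends_on (\<B> - {B}) (\<lambda>t. ?V T' (Suc j) t - ?W T' (Suc j) t)"
      by (rule depends_on_comp2[OF d2 d3])
    have bl: "(\<integral>t. (if slot_of \<rho> t B \<le> j then ?V T j t else 0) \<partial>?M) \<le> p * (\<integral>t. ?V T j t \<partial>?M)"
      by (rule integral_blocked[OF B(1) j _ V1 d1]) measurable
    have t1: "(\<integral>t. (if slot_of \<rho> t B = Suc j then 1 / \<rho> * ?V T' (Suc j) t else 0) \<partial>?M) = (\<integral>t. ?V T' (Suc j) t \<partial>?M)"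
      by (rule integral_taken[OF B(1) j _ V2 d2]) measurable
    have t2: "(\<integral>t. (if slot_of \<rho> t B = Suc j then 1 / \<rho> * ?W T' (Suc j) t else 0) \<partial>?M) = (\<integral>t. ?W T' (Suc j) t \<partial>?M)"
      by (rule integral_taken[OF B(1) j _ W2 d3]) measurable
    have t3: "(\<integral>t. (if slot_of \<rho> t B = Suc j then 1 / \<rho> * (?V T' (Suc j) t - ?W T' (Suc j) t) else 0) \<partial>?M)
        = (\<integral>t. ?V T' (Suc j) t - ?W T' (Suc j) t \<partial>?M)"
      by (rule integral_taken[OF B(1) j _ D2 d4]) measurable
    have r: "0 \<le> (1 / \<rho>) ^ (k - j)" "0 \<le> 1 / \<rho> * (1 / \<rho>) ^ (k - Suc j)" using \<rho> by auto
    have i1: "integrable ?M (\<lambda>t. if slot_of \<rho> t B \<le> j then ?V T j t else 0)"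
      using V1 r by (intro integrable_bounded[of _ "(1 / \<rho>) ^ (k - j)"]) auto
    have i2: "integrable ?M (\<lambda>t. if slot_of \<rho> t B = Suc j then 1 / \<rho> * ?V T' (Suc j) t else 0)"
      using V2 \<rho> by (intro integrable_bounded[of _ "1 / \<rho> * (1 / \<rho>) ^ (k - Suc j)"])
        (auto intro!: divide_right_mono)
    have i3: "integrable ?M (\<lambda>t. if slot_of \<rho> t B = Suc j then 1 / \<rho> * (?V T' (Suc j) t - ?W T' (Suc j) t) else 0)"
      using D2 \<rho> by (intro integrable_bounded[of _ "1 / \<rho> * (1 / \<rho>) ^ (k - Suc j)"])
        (auto intro!: divide_right_mono)
    have kj: "k - j = Suc (k - Suc j)" using j by simp
    have e1: "?V (Query B T T') j t = (if slot_of \<rho> t B \<le> j then ?V T j t else 0)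
        + (if slot_of \<rho> t B = Suc j then 1 / \<rho> * ?V T' (Suc j) t else 0)" for t by auto
    have e3: "?V (Query B T T') j t - ?W (Query B T T') j t = (if slot_of \<rho> t B \<le> j then ?V T j t else 0)
        + (if slot_of \<rho> t B = Suc j then 1 / \<rho> * (?V T' (Suc j) t - ?W T' (Suc j) t) else 0)" for t
      by (auto simp: right_diff_distrib diff_divide_distrib)
    have "(\<integral>t. ?V (Query B T T') j t \<partial>?M) \<le> p * (\<integral>t. ?V T j t \<partial>?M) + (\<integral>t. ?V T' (Suc j) t \<partial>?M)"
      unfolding e1 using i1 i2 bl t1 by simp
    also have "\<dots> \<le> p * q ^ (k - j) + q ^ (k - Suc j)"
      using IH1 IH2 p0 by (intro add_mono mult_left_mono) auto
    also have "\<dots> = (p * q + 1) * q ^ (k - Suc j)" unfolding kj by (simp add: algebra_simps)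
    finally have A: "(\<integral>t. ?V (Query B T T') j t \<partial>?M) \<le> q ^ (k - j)" unfolding q(2) kj by simp
    have Bq: "(\<integral>t. ?W (Query B T T') j t \<partial>?M) = straight_leaf (Query B T T')"
      using t2 IH2 by simp
    have "(\<integral>t. ?V (Query B T T') j t - ?W (Query B T T') j t \<partial>?M)
        \<le> p * (\<integral>t. ?V T j t \<partial>?M) + (\<integral>t. ?V T' (Suc j) t - ?W T' (Suc j) t \<partial>?M)"
      unfolding e3 using i1 i3 bl t3 by simp
    also have "\<dots> \<le> p * q ^ (k - j) + real (k - Suc j) * p * q ^ (k - Suc j)"
      using IH1 IH2 p0 by (intro add_mono mult_left_mono) auto
    also have "\<dots> \<le> p * q ^ (k - j) + real (k - Suc j) * p * q ^ (k - j)"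
      using q(1) p0 unfolding kj by (intro add_left_mono mult_left_mono) auto
    also have "\<dots> = real (k - j) * p * q ^ (k - j)" unfolding kj by (simp add: algebra_simps)
    finally show ?case using A Bq by blast
  qed
  then show ?A ?B ?C by blast+
qed

end

end

section \<open>Unlikely events\<close>

lemma (in prob_space) prob_Bex_le:
  fixes c :: real
  assumes "finite I" "\<And>i. i \<in> I \<Longrightarrow> {x \<in> space M. P i x} \<in> events"
    "\<And>i. i \<in> I \<Longrightarrow> prob {x \<in> space M. P i x} \<le> c"
  shows "prob {x \<in> space M. \<exists>i\<in>I. P i x} \<le> card I * c"
proof -
  have "{x \<in> space M. \<exists>i\<in>I. P i x} = (\<Union>i\<in>I. {x \<in> space M. P i x})" by auto
  then have "prob {x \<in> space M. \<exists>i\<in>I. P i x} \<le> (\<Sum>i\<in>I. prob {x \<in> space M. P i x})"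
    using finite_measure_subadditive_finite[OF assms(1), of "\<lambda>i. {x \<in> space M. P i x}"] assms(2) by auto
  also have "\<dots> \<le> card I * c" using sum_mono[of I, OF assms(3)] by simp
  finally show ?thesis .
qed

context batch_times
begin

text \<open>Once the time of \<open>B'\<close> is fixed, that of \<open>B\<close> has to fall into
  an interval of length 2 a.\<close>

lemma prob_near:
  fixes a :: real
  assumes B: "B \<in> \<B>" "B' \<in> \<B>" "B \<noteq> B'" and a: "0 \<le> a"
  shows "measure (start_times \<B>) {t \<in> space (start_times \<B>). \<bar>t B - t B'\<bar> \<le> a} \<le> 2 * a"
proof -
  note [measurable] = B(1,2)
  let ?J = "\<B> - {B}" and ?A = "{t \<in> space (start_times \<B>). \<bar>t B - t B'\<bar> \<le> a}"
  have IJ: "?J \<union> {B} = \<B>" "?J \<inter> {B} = {}" "finite ?J" using B finite_batches by auto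
  interpret J: product_prob_space "\<lambda>_ :: nat set set. unif01" ?J by unfold_locales
  interpret K: product_prob_space "\<lambda>_ :: nat set set. unif01" "{B}" by unfold_locales
  have A: "?A \<in> sets (start_times \<B>)" by measurable
  let ?f = "\<lambda>t. indicator {t. \<bar>t B - t B'\<bar> \<le> a} t :: ennreal"
  have m: "?f \<in> borel_measurable (Pi\<^sub>M (?J \<union> {B}) (\<lambda>_. unif01))"
    unfolding IJ(1) start_times_PiM[symmetric] indicator_def by measurable
  have near: "{z. \<bar>z - y\<bar> \<le> a} \<in> sets unif01" for y :: real
  proof -
    have "{z. \<bar>z - y\<bar> \<le> a} = {y - a..y + a}" by (auto simp: abs_le_iff)
    then show ?thesis by simp
  qed
  have "emeasure (start_times \<B>) ?A = (\<integral>\<^sup>+t. indicator ?A t \<partial>start_times \<B>)" using A by simp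
  also have "\<dots> = (\<integral>\<^sup>+t. ?f t \<partial>start_times \<B>)"
    by (rule nn_integral_cong) (auto simp: indicator_def)
  also have "\<dots> = (\<integral>\<^sup>+x. (\<integral>\<^sup>+y. ?f (merge ?J {B} (x, y)) \<partial>Pi\<^sub>M {B} (\<lambda>_. unif01)) \<partial>Pi\<^sub>M ?J (\<lambda>_. unif01))"
    using T.product_nn_integral_fold[OF IJ(2,3) _ m] unfolding IJ(1) start_times_PiM by simp
  also have "\<dots> \<le> (\<integral>\<^sup>+x. ennreal (2 * a) \<partial>Pi\<^sub>M ?J (\<lambda>_. unif01))"
  proof (rule nn_integral_mono)
    fix x :: "nat set set \<Rightarrow> real"
    have "(\<integral>\<^sup>+y. ?f (merge ?J {B} (x, y)) \<partial>Pi\<^sub>M {B} (\<lambda>_. unif01))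
        = (\<integral>\<^sup>+y. indicator {z. \<bar>z - x B'\<bar> \<le> a} (y B) \<partial>Pi\<^sub>M {B} (\<lambda>_. unif01))"
      using B by (intro nn_integral_cong) (auto simp: merge_def indicator_def)
    also have "\<dots> = (\<integral>\<^sup>+z. indicator {z. \<bar>z - x B'\<bar> \<le> a} z \<partial>unif01)"
      by (rule T.product_nn_integral_singleton) (use near in measurable)
    also have "\<dots> = emeasure unif01 {z. \<bar>z - x B'\<bar> \<le> a}" using near by simp
    also have "\<dots> \<le> ennreal (2 * a)"
      using measure_unif01_near[OF a, of "x B'"] T.M.emeasure_eq_measure by (metis ennreal_leI)
    finally show "(\<integral>\<^sup>+y. ?f (merge ?J {B} (x, y)) \<partial>Pi\<^sub>M {B} (\<lambda>_. unif01)) \<le> ennreal (2 * a)" .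
  qed
  also have "\<dots> = ennreal (2 * a)" by (simp add: J.P.emeasure_space_1)
  finally show ?thesis using a by (simp add: S.emeasure_eq_measure)
qed

lemma prob_early:
  fixes p :: real
  assumes "J \<subseteq> \<B>" "0 \<le> p"
  shows "measure (start_times \<B>) {t \<in> space (start_times \<B>). \<forall>B\<in>J. t B < p} \<le> p ^ card J"
proof -
  have J: "finite J" using assms finite_batches finite_subset by blast
  have "emeasure (start_times \<B>) {t \<in> space (start_times \<B>). \<forall>B\<in>J. t B \<in> {z. z < p}}
      = (\<Prod>B\<in>J. emeasure unif01 {z. z < p})"
    unfolding start_times_PiM by (rule T.emeasure_PiM_Collect) (use assms J in auto)
  then have "ennreal (measure (start_times \<B>) {t \<in> space (start_times \<B>). \<forall>B\<in>J. t B < p})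
      = ennreal (measure unif01 {z. z < p} ^ card J)"
    by (simp add: S.emeasure_eq_measure T.M.emeasure_eq_measure ennreal_power del: emeasure_uniform_measure)
  then have "measure (start_times \<B>) {t \<in> space (start_times \<B>). \<forall>B\<in>J. t B < p}
      = measure unif01 {z. z < p} ^ card J"
    by (simp del: measure_uniform_measure)
  also have "\<dots> \<le> p ^ card J"
    by (intro power_mono measure_unif01_less assms) simp
  finally show ?thesis .
qed

lemma few_late_measurable:
  assumes "D \<subseteq> \<B>"
  shows "{t \<in> space (start_times \<B>). card {B \<in> D. p \<le> t B} \<le> a} \<in> S.events"
proof -
  have fin: "finite D" using assms finite_batches finite_subset by blast
  have "(\<lambda>t. real (card {B \<in> D. p \<le> t B})) = (\<lambda>t. \<Sum>B\<in>D. if p \<le> t B then 1 else 0)"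
    using fin by (simp add: sum.If_cases Int_def)
  moreover have "(\<lambda>t. \<Sum>B\<in>D. if p \<le> t B then 1 else 0 :: real) \<in> borel_measurable (start_times \<B>)"
  proof (rule borel_measurable_sum)
    fix B assume "B \<in> D"
    then have [measurable]: "B \<in> \<B>" using assms by blast
    show "(\<lambda>t. if p \<le> t B then 1 else 0 :: real) \<in> borel_measurable (start_times \<B>)" by measurable
  qed
  ultimately have [measurable]: "(\<lambda>t. real (card {B \<in> D. p \<le> t B})) \<in> borel_measurable (start_times \<B>)"
    by simp
  have "{t \<in> space (start_times \<B>). real (card {B \<in> D. p \<le> t B}) \<le> real a} \<in> S.events" by measurable
  then show ?thesis by simp
qed

text \<open>Among any \<open>a + c\<close> batches of \<open>D\<close> at least \<open>c\<close>
  would start before \<open>p\<close>. The union bound runs over the subsets of size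
  \<open>c\<close>, crudely counted as all subsets.\<close>

lemma prob_few_late:
  fixes p :: real
  assumes D: "D \<subseteq> \<B>" "a + c \<le> card D" and p: "0 \<le> p"
  shows "measure (start_times \<B>) {t \<in> space (start_times \<B>). card {B \<in> D. p \<le> t B} \<le> a}
    \<le> 2 ^ (a + c) * p ^ c"
proof -
  obtain D' where D': "D' \<subseteq> D" "card D' = a + c" "finite D'"
    using obtain_subset_with_card_n[OF D(2)] by blast
  let ?I = "{J. J \<subseteq> D' \<and> card J = c}"
  have I: "finite ?I" "card ?I \<le> 2 ^ (a + c)"
    using card_mono[of "Pow D'" ?I] D' by (auto simp: card_Pow)
  have ev: "{t \<in> space (start_times \<B>). \<forall>B\<in>J. t B < p} \<in> S.events" if "J \<in> ?I" for J
  proof -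
    have "finite J" "J \<subseteq> \<B>" using that D' D finite_subset by blast+
    then show ?thesis by (intro sets.sets_Collect_finite_All) auto
  qed
  have sub: "{t \<in> space (start_times \<B>). card {B \<in> D. p \<le> t B} \<le> a}
      \<subseteq> {t \<in> space (start_times \<B>). \<exists>J\<in>?I. \<forall>B\<in>J. t B < p}"
  proof
    fix t assume t: "t \<in> {t \<in> space (start_times \<B>). card {B \<in> D. p \<le> t B} \<le> a}"
    have finD: "finite D" using D(1) finite_batches finite_subset by blast
    have "card {B \<in> D'. p \<le> t B} \<le> card {B \<in> D. p \<le> t B}"
      by (rule card_mono) (use finD D' in auto)
    moreover have "card D' = card ({B \<in> D'. p \<le> t B} \<union> {B \<in> D'. t B < p})"
      by (rule arg_cong[where f = card]) auto
    moreover have "\<dots> = card {B \<in> D'. p \<le> t B} + card {B \<in> D'. t B < p}"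
      by (rule card_Un_disjoint) (use D'(3) in auto)
    moreover have "card {B \<in> D. p \<le> t B} \<le> a" using t by blast
    ultimately have "c \<le> card {B \<in> D'. t B < p}" using D'(2) by linarith
    then obtain J where "J \<subseteq> {B \<in> D'. t B < p}" "card J = c"
      by (rule obtain_subset_with_card_n)
    then show "t \<in> {t \<in> space (start_times \<B>). \<exists>J\<in>?I. \<forall>B\<in>J. t B < p}" using t by blast
  qed
  have "measure (start_times \<B>) {t \<in> space (start_times \<B>). card {B \<in> D. p \<le> t B} \<le> a}
      \<le> measure (start_times \<B>) {t \<in> space (start_times \<B>). \<exists>J\<in>?I. \<forall>B\<in>J. t B < p}"
    by (rule S.finite_measure_mono[OF sub]) (rule sets.sets_Collect_finite_Ex[OF ev I(1)])
  also have "\<dots> \<le> card ?I * p ^ c"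
  proof (rule S.prob_Bex_le)
    show "finite ?I" by (rule I(1))
    fix J assume J: "J \<in> ?I"
    show "{t \<in> space (start_times \<B>). \<forall>B\<in>J. t B < p} \<in> S.events" by (rule ev[OF J])
    from J show "measure (start_times \<B>) {t \<in> space (start_times \<B>). \<forall>B\<in>J. t B < p} \<le> p ^ c"
      using prob_early[of J p] D D' p by auto
  qed
  also have "\<dots> \<le> 2 ^ (a + c) * p ^ c"
    using I(2) p by (intro mult_right_mono) (auto simp flip: of_nat_le_iff)
  finally show ?thesis .
qed

lemma prob_straddle:
  fixes h w :: real
  assumes "B \<in> \<B>" "0 < h" "0 \<le> w" "w \<le> 1"
  shows "{t \<in> space (start_times \<B>). \<exists>c::int. t B < c * h \<and> c * h \<le> t B + w} \<in> S.events"
    "measure (start_times \<B>) {t \<in> space (start_times \<B>). \<exists>c::int. t B < c * h \<and> c * h \<le> t B + w}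
      \<le> 2 * w / h"
proof -
  note U = measure_unif01_straddle[OF assms(2-4)]
  have "(\<lambda>t. t B) -` {z. \<exists>c::int. z < c * h \<and> c * h \<le> z + w} \<inter> space (start_times \<B>) \<in> S.events"
    using assms(1) U(1) by measurable
  then show "{t \<in> space (start_times \<B>). \<exists>c::int. t B < c * h \<and> c * h \<le> t B + w} \<in> S.events"
    by (simp add: vimage_def Int_def conj_commute)
  show "measure (start_times \<B>) {t \<in> space (start_times \<B>). \<exists>c::int. t B < c * h \<and> c * h \<le> t B + w}
      \<le> 2 * w / h"
    using measure_time[OF assms(1) U(1)] U(2) by simp
qed

definition crowd :: "real \<Rightarrow> nat set set \<Rightarrow> (nat set set \<Rightarrow> real) \<Rightarrow> real" where
  "crowd a B t = (\<Sum>B'\<in>\<B> - {B}. real (card B') * (if \<bar>t B - t B'\<bar> \<le> a then 1 else 0))"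

lemma crowd_measurable: "B \<in> \<B> \<Longrightarrow> crowd a B \<in> borel_measurable (start_times \<B>)"
  unfolding crowd_def
proof (rule borel_measurable_sum)
  fix B' assume "B \<in> \<B>" "B' \<in> \<B> - {B}"
  then have [measurable]: "B \<in> \<B>" "B' \<in> \<B>" by auto
  show "(\<lambda>t. real (card B') * (if \<bar>t B - t B'\<bar> \<le> a then 1 else 0)) \<in> borel_measurable (start_times \<B>)"
    by measurable
qed

text \<open>Markov's inequality: each other batch is near with probability at most 2 a, so the
  expected number of edges in near batches is at most 2 a m.\<close>

lemma prob_crowd:
  fixes a C :: real
  assumes B: "B \<in> \<B>" and a: "0 \<le> a" and C: "0 < C" and m: "(\<Sum>B\<in>\<B>. card B) \<le> m"
  shows "{t \<in> space (start_times \<B>). C < crowd a B t} \<in> S.events"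
    "measure (start_times \<B>) {t \<in> space (start_times \<B>). C < crowd a B t} \<le> 2 * a * m / C"
proof -
  note [measurable] = crowd_measurable[OF B]
  show "{t \<in> space (start_times \<B>). C < crowd a B t} \<in> S.events" by measurable
  have near: "{t \<in> space (start_times \<B>). \<bar>t B - t B'\<bar> \<le> a} \<in> S.events" if "B' \<in> \<B>" for B'
  proof -
    note [measurable] = B that
    show ?thesis by measurable
  qed
  have trm: "integrable (start_times \<B>) (\<lambda>t. real (card B') * (if \<bar>t B - t B'\<bar> \<le> a then 1 else 0))"
      "(\<integral>t. real (card B') * (if \<bar>t B - t B'\<bar> \<le> a then 1 else 0) \<partial>start_times \<B>) \<le> card B' * (2 * a)"
    if "B' \<in> \<B> - {B}" for B'
  proof -
    have "B' \<in> \<B>" using that by simp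
    note [measurable] = B this
    have "(\<lambda>t. real (card B') * (if \<bar>t B - t B'\<bar> \<le> a then 1 else 0)) \<in> borel_measurable (start_times \<B>)"
      by measurable
    then show "integrable (start_times \<B>) (\<lambda>t. real (card B') * (if \<bar>t B - t B'\<bar> \<le> a then 1 else 0))"
      by (rule integrable_bounded[of _ "card B'"]) simp
    have "(\<integral>t. (if \<bar>t B - t B'\<bar> \<le> a then 1 else 0 :: real) \<partial>start_times \<B>)
      = (\<integral>t. indicator {t \<in> space (start_times \<B>). \<bar>t B - t B'\<bar> \<le> a} t \<partial>start_times \<B>)"
      by (rule Bochner_Integration.integral_cong) (auto simp: indicator_def)
    also have "\<dots> = measure (start_times \<B>) {t \<in> space (start_times \<B>). \<bar>t B - t B'\<bar> \<le> a}"
      using near[OF \<open>B' \<in> \<B>\<close>] by (simp add: Int_absorb2 subset_eq)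
    also have "\<dots> \<le> 2 * a" using prob_near[OF B \<open>B' \<in> \<B>\<close> _ a] that by blast
    finally show "(\<integral>t. real (card B') * (if \<bar>t B - t B'\<bar> \<le> a then 1 else 0) \<partial>start_times \<B>) \<le> card B' * (2 * a)"
      by (simp add: mult_left_mono)
  qed
  have int: "integrable (start_times \<B>) (crowd a B)"
    unfolding crowd_def by (rule Bochner_Integration.integrable_sum) (rule trm)
  have "(\<integral>t. crowd a B t \<partial>start_times \<B>) = (\<Sum>B'\<in>\<B> - {B}.
      \<integral>t. real (card B') * (if \<bar>t B - t B'\<bar> \<le> a then 1 else 0) \<partial>start_times \<B>)"
    unfolding crowd_def by (rule Bochner_Integration.integral_sum) (rule trm(1))
  also have "\<dots> \<le> (\<Sum>B'\<in>\<B> - {B}. card B' * (2 * a))"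
    by (rule sum_mono) (rule trm(2))
  also have "\<dots> \<le> (\<Sum>B'\<in>\<B>. card B' * (2 * a))"
    using finite_batches a by (intro sum_mono2) auto
  also have "\<dots> = real (\<Sum>B\<in>\<B>. card B) * (2 * a)" by (simp add: sum_distrib_right)
  also have "\<dots> \<le> real m * (2 * a)"
  proof (rule mult_right_mono)
    show "real (\<Sum>B\<in>\<B>. card B) \<le> real m" using m by (simp only: of_nat_le_iff)
  qed (use a in simp)
  finally have E: "(\<integral>t. crowd a B t \<partial>start_times \<B>) \<le> 2 * a * m" by (simp add: mult.commute)
  have "measure (start_times \<B>) {t \<in> space (start_times \<B>). C < crowd a B t}
      \<le> measure (start_times \<B>) {t \<in> space (start_times \<B>). C \<le> crowd a B t}"
    by (rule S.finite_measure_mono) auto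
  also have "\<dots> \<le> (1 / C) * (\<integral>t. crowd a B t \<partial>start_times \<B>)"
  proof -
    have "AE t in start_times \<B>. 0 \<le> crowd a B t" by (auto simp: crowd_def intro!: AE_I2 sum_nonneg)
    from integral_Markov_inequality_measure[OF int sets.empty_sets this C] show ?thesis by simp
  qed
  also have "\<dots> \<le> (1 / C) * (2 * a * m)" using E C by (intro mult_left_mono) auto
  finally show "measure (start_times \<B>) {t \<in> space (start_times \<B>). C < crowd a B t} \<le> 2 * a * m / C"
    by simp
qed

definition early_edges :: "real \<Rightarrow> (nat set set \<Rightarrow> real) \<Rightarrow> real" where
  "early_edges a t = (\<Sum>B\<in>\<B>. real (card B) * (if t B < a then 1 else 0))"

text \<open>Chebyshev's inequality for a sum over edges. Two edges are correlated only within a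
  batch, so the variance is at most \<open>card E * b\<close>, against the squared deviation (a card
  E / 2)^2.\<close>

lemma prob_few_early:
  fixes a :: real
  assumes E: "finite E" "partition_on E \<B>" and b: "\<And>B. B \<in> \<B> \<Longrightarrow> card B \<le> b"
    and a: "0 < a" "a \<le> 1" and m: "0 < card E"
  shows "{t \<in> space (start_times \<B>). early_edges a t < a * card E / 2} \<in> S.events"
    "measure (start_times \<B>) {t \<in> space (start_times \<B>). early_edges a t < a * card E / 2}
      \<le> 4 * real b / (a\<^sup>2 * real (card E))"
proof -
  let ?m = "card E"
  define bt where "bt e = (THE B. B \<in> \<B> \<and> e \<in> B)" for e
  have bt: "bt e = B" if "B \<in> \<B>" "e \<in> B" for e B
    unfolding bt_def using that partition_onD2[OF E(2)] by (intro the_equality) (auto simp: disjoint_def)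
  have btE: "bt e \<in> \<B> \<and> e \<in> bt e" if "e \<in> E" for e
    using that bt partition_onD1[OF E(2)] by blast
  define X where "X e t = (indicator {z. z < a} (t (bt e)) :: real)" for e and t :: "nat set set \<Rightarrow> real"
  have finB: "finite B" if "B \<in> \<B>" for B
    using that E finite_subset partition_onD1[OF E(2)] by (metis Union_upper)
  have sumX: "(\<Sum>e\<in>E. X e t) = early_edges a t" for t
  proof -
    have "(\<Sum>e\<in>E. X e t) = (\<Sum>B\<in>\<B>. \<Sum>e\<in>B. X e t)"
      unfolding partition_onD1[OF E(2), THEN arg_cong[where f = "sum (\<lambda>e. X e t)"]]
      by (subst sum.Union_disjoint) (use finB partition_onD2[OF E(2)] in \<open>auto simp: disjoint_def\<close>)
    also have "\<dots> = (\<Sum>B\<in>\<B>. real (card B) * (if t B < a then 1 else 0))"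
      by (intro sum.cong refl) (use bt in \<open>simp add: X_def indicator_def\<close>)
    finally show ?thesis by (simp add: early_edges_def)
  qed
  have sets_a: "{z. z < a} \<in> sets borel" by simp
  have Xm: "X e \<in> borel_measurable (start_times \<B>)" if "e \<in> E" for e
  proof -
    have [measurable]: "bt e \<in> \<B>" using btE[OF that] by blast
    show ?thesis unfolding X_def by measurable
  qed
  then have [measurable]: "early_edges a \<in> borel_measurable (start_times \<B>)"
    using borel_measurable_sum[of E X "start_times \<B>"] sumX by simp
  show "{t \<in> space (start_times \<B>). early_edges a t < a * card E / 2} \<in> S.events" by measurable
  have "measure unif01 {z. z < a} = a"
  proof -
    have "{0..1} \<inter> {z. z < a} = {0..<a}" using a by auto
    then show ?thesis using a by simp
  qed
  then have EX: "(\<integral>t. X e t \<partial>start_times \<B>) = a" if "e \<in> E" for e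
    unfolding X_def using integral_time[OF _ sets_a, of "bt e"] btE[OF that] by metis
  have Y: "(\<integral>t. (early_edges a t - ?m * a)\<^sup>2 \<partial>start_times \<B>) \<le> real ?m * real b * 1\<^sup>2"
  proof -
    have "(\<integral>t. ((\<Sum>e\<in>E. X e t) - (\<Sum>e\<in>E. \<integral>t. X e t \<partial>start_times \<B>))\<^sup>2 \<partial>start_times \<B>) \<le> real ?m * real b * 1\<^sup>2"
      unfolding start_times_PiM
    proof (rule T.sum_second_moment_le[OF finite_batches E(1), where D = "\<lambda>e. {bt e}"])
      fix e assume e: "e \<in> E"
      show "X e \<in> borel_measurable (Pi\<^sub>M \<B> (\<lambda>_. unif01))" using Xm[OF e] by (simp add: start_times_PiM)
      show "{bt e} \<subseteq> \<B> \<and> depends_on {bt e} (X e)" using btE[OF e] by (auto simp: depends_on_def X_def)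
      have "{j \<in> E. {bt e} \<inter> {bt j} \<noteq> {}} \<subseteq> bt e" using btE by auto
      then have "card {j \<in> E. {bt e} \<inter> {bt j} \<noteq> {}} \<le> card (bt e)"
        using btE[OF e] finB by (intro card_mono) auto
      then show "card {j \<in> E. {bt e} \<inter> {bt j} \<noteq> {}} \<le> b" using b btE[OF e] by (meson order_trans)
    qed (auto simp: X_def)
    moreover have "(\<Sum>e\<in>E. \<integral>t. X e t \<partial>start_times \<B>) = ?m * a" using EX by simp
    ultimately show ?thesis by (simp add: sumX)
  qed
  let ?c = "(a * ?m / 2)\<^sup>2"
  have c: "0 < ?c" using a m by simp
  have bd: "\<bar>early_edges a t - ?m * a\<bar> \<le> ?m + ?m * a" for t
  proof -
    have "0 \<le> (\<Sum>e\<in>E. X e t)" by (rule sum_nonneg) (simp add: X_def)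
    moreover have "(\<Sum>e\<in>E. X e t) \<le> (\<Sum>e\<in>E. 1)" by (rule sum_mono) (simp add: X_def indicator_def)
    moreover have "0 \<le> ?m * a" using a by simp
    moreover have "(\<Sum>e\<in>E. 1 :: real) = ?m" by simp
    ultimately show ?thesis unfolding sumX by linarith
  qed
  have sq: "(early_edges a t - ?m * a)\<^sup>2 \<le> (?m + ?m * a)\<^sup>2" for t
    using bd[of t] a by (simp add: abs_le_square_iff[symmetric])
  have "(\<lambda>t. (early_edges a t - ?m * a)\<^sup>2) \<in> borel_measurable (start_times \<B>)" by measurable
  then have int: "integrable (start_times \<B>) (\<lambda>t. (early_edges a t - ?m * a)\<^sup>2)"
    by (rule integrable_bounded[of _ "(?m + ?m * a)\<^sup>2"]) (use sq in simp)
  have "measure (start_times \<B>) {t \<in> space (start_times \<B>). early_edges a t < a * ?m / 2}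
      \<le> measure (start_times \<B>) {t \<in> space (start_times \<B>). ?c \<le> (early_edges a t - ?m * a)\<^sup>2}"
  proof (rule S.finite_measure_mono)
    show "{t \<in> space (start_times \<B>). early_edges a t < a * ?m / 2}
      \<subseteq> {t \<in> space (start_times \<B>). ?c \<le> (early_edges a t - ?m * a)\<^sup>2}"
    proof clarify
      fix t assume "early_edges a t < a * ?m / 2"
      then have "early_edges a t - ?m * a \<le> - (a * ?m / 2)" by (simp add: mult.commute)
      then have "a * ?m / 2 \<le> \<bar>early_edges a t - ?m * a\<bar>" by linarith
      then have "\<bar>a * ?m / 2\<bar> \<le> \<bar>early_edges a t - ?m * a\<bar>" using a by simp
      then show "?c \<le> (early_edges a t - ?m * a)\<^sup>2" by (simp only: abs_le_square_iff)
    qed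
  qed measurable
  also have "\<dots> \<le> (1 / ?c) * (\<integral>t. (early_edges a t - ?m * a)\<^sup>2 \<partial>start_times \<B>)"
  proof -
    have "AE t in start_times \<B>. 0 \<le> (early_edges a t - ?m * a)\<^sup>2" by simp
    from integral_Markov_inequality_measure[OF int sets.empty_sets this c] show ?thesis by simp
  qed
  also have "\<dots> \<le> (1 / ?c) * (real ?m * real b)" using Y c by (intro mult_left_mono) auto
  also have "\<dots> = 4 * real b / (a\<^sup>2 * real ?m)"
    using a m by (simp add: power2_eq_square field_simps)
  finally show "measure (start_times \<B>) {t \<in> space (start_times \<B>). early_edges a t < a * card E / 2}
      \<le> 4 * real b / (a\<^sup>2 * real (card E))" .
qed

end

section \<open>Sampling with replacement\<close>

text \<open>When the first sample is split off, the cross term vanishes because the samples are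
  independent with mean zero.\<close>

lemma replicate_pmf_second_moment:
  fixes g :: "'a \<Rightarrow> real"
  assumes fin: "finite (set_pmf p)" and mean: "measure_pmf.expectation p g = 0"
    and g: "\<And>x. x \<in> set_pmf p \<Longrightarrow> \<bar>g x\<bar> \<le> c"
  shows "measure_pmf.expectation (replicate_pmf s p) (\<lambda>xs. sum_list (map g xs)) = 0 \<and>
    measure_pmf.expectation (replicate_pmf s p) (\<lambda>xs. (sum_list (map g xs))\<^sup>2) \<le> s * c\<^sup>2"
proof (induction s)
  case (Suc s)
  let ?A = "set_pmf p" and ?R = "replicate_pmf s p" and ?G = "\<lambda>xs. sum_list (map g xs)"
  have finR: "finite (set_pmf ?R)"
    using finite_lists_length_eq[OF fin] by (simp add: set_replicate_pmf lists_eq_set conj_commute)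
  have int: "integrable (measure_pmf ?R) h" for h :: "_ \<Rightarrow> real"
    by (rule integrable_measure_pmf_finite[OF finR])
  have E: "measure_pmf.expectation (replicate_pmf (Suc s) p) h
      = (\<Sum>a\<in>?A. pmf p a * measure_pmf.expectation ?R (\<lambda>xs. h (a # xs)))" for h :: "_ \<Rightarrow> real"
  proof -
    have "replicate_pmf (Suc s) p = p \<bind> (\<lambda>x. map_pmf ((#) x) ?R)"
      by (simp add: map_pmf_def)
    then show ?thesis
      using pmf_expectation_bind[OF fin, of "\<lambda>x. map_pmf ((#) x) ?R" p h] finR by simp
  qed
  have sum0: "(\<Sum>a\<in>?A. pmf p a * g a) = 0"
    using mean integral_measure_pmf[OF fin, of p g] by (simp add: mult.commute)
  have "(\<Sum>a\<in>?A. pmf p a * measure_pmf.expectation ?R (\<lambda>xs. ?G (a # xs))) = (\<Sum>a\<in>?A. pmf p a * g a)"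
    using Suc int by (intro sum.cong) (auto simp: measure_pmf.prob_space)
  then have 1: "measure_pmf.expectation (replicate_pmf (Suc s) p) ?G = 0"
    unfolding E sum0 .
  have sq: "measure_pmf.expectation ?R (\<lambda>xs. (?G (a # xs))\<^sup>2) \<le> c\<^sup>2 + s * c\<^sup>2" if "a \<in> ?A" for a
  proof -
    have "measure_pmf.expectation ?R (\<lambda>xs. (?G (a # xs))\<^sup>2)
        = measure_pmf.expectation ?R (\<lambda>xs. (g a)\<^sup>2 + 2 * g a * ?G xs + (?G xs)\<^sup>2)"
      by (simp add: power2_sum algebra_simps)
    also have "\<dots> = (g a)\<^sup>2 + 2 * g a * measure_pmf.expectation ?R ?G + measure_pmf.expectation ?R (\<lambda>xs. (?G xs)\<^sup>2)"
      using int by (simp add: measure_pmf.prob_space)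
    also have "\<dots> \<le> c\<^sup>2 + s * c\<^sup>2"
    proof -
      have "\<bar>g a\<bar> \<le> \<bar>c\<bar>" using g[OF that] by linarith
      then have "(g a)\<^sup>2 \<le> c\<^sup>2" by (simp add: abs_le_square_iff)
      then show ?thesis using Suc by simp
    qed
    finally show ?thesis .
  qed
  have "measure_pmf.expectation (replicate_pmf (Suc s) p) (\<lambda>xs. (?G xs)\<^sup>2)
      \<le> (\<Sum>a\<in>?A. pmf p a * (c\<^sup>2 + s * c\<^sup>2))"
    unfolding E by (intro sum_mono mult_left_mono sq) auto
  also have "\<dots> = (\<Sum>a\<in>?A. pmf p a) * (c\<^sup>2 + s * c\<^sup>2)" by (simp only: sum_distrib_right)
  also have "\<dots> = Suc s * c\<^sup>2"
    using sum_pmf_eq_1[OF fin, of p] by (simp add: algebra_simps)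
  finally show ?case using 1 by blast
qed simp

section \<open>Streaming algorithms from state machines\<close>

text \<open>Lets an algorithm be written on structured states: each step decodes the bit string and
  encodes the result, where \<open>G\<close> is the set of states on which the encoding has to be
  injective. Random bits are drawn only for the initial state.\<close>

definition machine_algorithm :: "'s pmf \<Rightarrow> ('s \<Rightarrow> nat set \<times> int \<Rightarrow> 's) \<Rightarrow> ('s \<Rightarrow> real)
    \<Rightarrow> ('s \<Rightarrow> bool list) \<Rightarrow> 's set \<Rightarrow> streaming_algorithm" where
  "machine_algorithm init upd out enc G = \<lparr>alg_init = map_pmf enc init,
     alg_step = (\<lambda>bs x. return_pmf (enc (upd (inv_into G enc bs) x))),
     alg_output = (\<lambda>bs. out (inv_into G enc bs))\<rparr>"

lemma run_machine_algorithm: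
  assumes "inj_on enc G" "\<And>s i. s \<in> set_pmf init \<Longrightarrow> i \<le> length xs \<Longrightarrow> foldl upd s (take i xs) \<in> G"
  shows "run (machine_algorithm init upd out enc G) xs = map_pmf (\<lambda>s. enc (foldl upd s xs)) init"
  using assms(2)
proof (induction xs rule: rev_induct)
  case Nil
  then show ?case by (simp add: run_def machine_algorithm_def)
next
  case (snoc x xs)
  let ?A = "machine_algorithm init upd out enc G"
  have G: "foldl upd s (take i xs) \<in> G" if "s \<in> set_pmf init" "i \<le> length xs" for s i
    using snoc.prems[OF that(1), of i] that(2) by simp
  have "run ?A (xs @ [x]) = run ?A xs \<bind> (\<lambda>s. alg_step ?A s x)"
    by (simp add: run_def)
  also have "\<dots> = map_pmf (\<lambda>s. enc (foldl upd s xs)) init \<bind> (\<lambda>s. alg_step ?A s x)"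
    using snoc.IH[OF G] by simp
  also have "\<dots> = init \<bind> (\<lambda>s. return_pmf (enc (foldl upd s (xs @ [x]))))"
    unfolding bind_map_pmf
  proof (intro bind_pmf_cong refl)
    fix s assume "s \<in> set_pmf init"
    then have "foldl upd s xs \<in> G" using G[of s "length xs"] by simp
    then show "alg_step ?A (enc (foldl upd s xs)) x = return_pmf (enc (foldl upd s (xs @ [x])))"
      using assms(1) by (simp add: machine_algorithm_def)
  qed
  finally show ?case by (simp add: map_pmf_def)
qed

lemma output_machine_algorithm:
  assumes "inj_on enc G" "\<And>s i. s \<in> set_pmf init \<Longrightarrow> i \<le> length xs \<Longrightarrow> foldl upd s (take i xs) \<in> G"
  shows "map_pmf (alg_output (machine_algorithm init upd out enc G))
      (run (machine_algorithm init upd out enc G) xs) = map_pmf (\<lambda>s. out (foldl upd s xs)) init"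
proof -
  have "foldl upd s xs \<in> G" if "s \<in> set_pmf init" for s
    using assms(2)[OF that, of "length xs"] by simp
  note G = this
  have r: "run (machine_algorithm init upd out enc G) xs = map_pmf (\<lambda>s. enc (foldl upd s xs)) init"
    by (rule run_machine_algorithm[OF assms(1)]) (rule assms(2))
  show ?thesis
    unfolding r pmf.map_comp
    using assms(1) G by (intro map_pmf_cong) (auto simp: machine_algorithm_def)
qed

lemma space_machine_algorithm:
  assumes "inj_on enc G" "\<And>s i. s \<in> set_pmf init \<Longrightarrow> i \<le> length xs \<Longrightarrow> foldl upd s (take i xs) \<in> G"
    and "\<And>s i. s \<in> set_pmf init \<Longrightarrow> i \<le> length xs \<Longrightarrow> real (length (enc (foldl upd s (take i xs)))) \<le> S"
  shows "space_at_most (machine_algorithm init upd out enc G) xs S"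
  unfolding space_at_most_def
proof (intro allI impI ballI)
  fix i bs assume i: "i \<le> length xs" and bs: "bs \<in> set_pmf (run (machine_algorithm init upd out enc G) (take i xs))"
  have "foldl upd s (take j (take i xs)) \<in> G" if "s \<in> set_pmf init" "j \<le> length (take i xs)" for s j
  proof -
    have "min j i \<le> length xs" using i by linarith
    from assms(2)[OF that(1) this] show ?thesis by (simp only: take_take)
  qed
  then have "run (machine_algorithm init upd out enc G) (take i xs) = map_pmf (\<lambda>s. enc (foldl upd s (take i xs))) init"
    by (intro run_machine_algorithm[OF assms(1)])
  then show "real (length bs) \<le> S" using bs i assms(3) by auto
qed

lemma ex_set_encoding:
  assumes fin: "finite \<Gamma>" and card: "card \<Gamma> \<le> 2 ^ a"
  shows "\<exists>enc :: 'a set \<Rightarrow> bool list. inj_on enc (Pow \<Gamma>) \<and> (\<forall>X\<subseteq>\<Gamma>. length (enc X) \<le> (a + 1) * card X)"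
proof -
  have "card \<Gamma> \<le> card {bs :: bool list. length bs = a}"
    using card card_lists_length_eq[of "UNIV :: bool set" a] by (simp add: card_UNIV_bool)
  moreover have "finite {bs :: bool list. length bs = a}"
    using finite_lists_length_eq[of "UNIV :: bool set" a] by simp
  ultimately obtain f :: "'a \<Rightarrow> bool list" where f: "f ` \<Gamma> \<subseteq> {bs. length bs = a}" "inj_on f \<Gamma>"
    using card_le_inj[OF fin] by blast
  define l where "l X = (SOME xs. set xs = X \<and> distinct xs)" for X :: "'a set"
  have l: "set (l X) = X" "length (l X) = card X" if "X \<subseteq> \<Gamma>" for X
  proof -
    have "\<exists>xs. set xs = X \<and> distinct xs" using finite_distinct_list finite_subset[OF that fin] by blast
    from someI_ex[OF this] show "set (l X) = X" "length (l X) = card X"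
      unfolding l_def by (auto simp: distinct_card[symmetric])
  qed
  \<comment> \<open>The leading \<open>True\<close> keeps every block non-empty even if
    \<open>a = 0\<close>, so the length of the code determines the cardinality of the set.\<close>
  define enc where "enc X = concat (map (\<lambda>x. True # f x) (l X))" for X
  have len: "length (True # f x) = a + 1" if "x \<in> \<Gamma>" for x using f that by auto
  have length: "length (enc X) = (a + 1) * card X" if "X \<subseteq> \<Gamma>" for X
  proof -
    have "length (enc X) = sum_list (map (\<lambda>x. a + 1) (l X))"
      unfolding enc_def length_concat map_map o_def
      using len l(1)[OF that] that by (intro arg_cong[where f = sum_list] map_cong) auto
    then show ?thesis using l(2)[OF that] by (simp add: sum_list_triv)
  qed
  have "inj_on enc (Pow \<Gamma>)"
  proof (rule inj_onI)
    fix X Y assume X: "X \<in> Pow \<Gamma>" and Y: "Y \<in> Pow \<Gamma>" and eq: "enc X = enc Y"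
    then have "(a + 1) * card X = (a + 1) * card Y" using length by (metis PowD)
    then have "card X = card Y" by (simp only: mult_cancel1) simp
    then have ll: "length (l X) = length (l Y)" using l X Y by auto
    have "map (\<lambda>x. True # f x) (l X) = map (\<lambda>x. True # f x) (l Y)"
    proof (rule concat_injective)
      show "\<forall>(x, y)\<in>set (zip (map (\<lambda>x. True # f x) (l X)) (map (\<lambda>x. True # f x) (l Y))). length x = length y"
      proof (intro ballI, clarify)
        fix x y assume "(x, y) \<in> set (zip (map (\<lambda>x. True # f x) (l X)) (map (\<lambda>x. True # f x) (l Y)))"
        then have "x \<in> set (map (\<lambda>x. True # f x) (l X))" "y \<in> set (map (\<lambda>x. True # f x) (l Y))"
          by (rule set_zip_leftD, rule set_zip_rightD)
        then obtain x' y' where "x = True # f x'" "x' \<in> set (l X)" "y = True # f y'" "y' \<in> set (l Y)"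
          by auto
        moreover from this have "x' \<in> \<Gamma>" "y' \<in> \<Gamma>" using l(1)[of X] l(1)[of Y] X Y by blast+
        ultimately show "length x = length y" using len by metis
      qed
    qed (use eq ll in \<open>auto simp: enc_def\<close>)
    then have "(\<lambda>x. True # f x) ` X = (\<lambda>x. True # f x) ` Y"
      using l X Y by (metis PowD image_set)
    moreover have "inj_on (\<lambda>x. True # f x) \<Gamma>" using f(2) by (auto simp: inj_on_def)
    ultimately show "X = Y" using X Y by (meson PowD inj_on_image_eq_iff)
  qed
  then show ?thesis using length by (intro exI[of _ enc]) auto
qed

section \<open>Storing a spanning forest of stars\<close>

text \<open>A canonical forest: it depends on \<open>F\<close> only through the components, so it
  can be recomputed from the stored stars and the next edge.\<close>

definition stars :: "nat \<Rightarrow> nat set set \<Rightarrow> nat set set" where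
  "stars n F = {{u, Min (component u F)} |u. u < n \<and> u \<noteq> Min (component u F)}"

lemma Min_comp:
  assumes "u < n" "F \<subseteq> all_edges n" shows "Min (component u F) \<in> component u F" "Min (component u F) < n"
proof -
  show 1: "Min (component u F) \<in> component u F"
    by (rule Min_in[OF finite_comp[OF assms]]) (use component_self in blast)
  then show "Min (component u F) < n" using component_subset_vertices[OF assms] by auto
qed

lemma stars_edges: "F \<subseteq> all_edges n \<Longrightarrow> stars n F \<subseteq> all_edges n"
  unfolding stars_def using Min_comp(2)[of _ n F] by (auto simp: all_edges_def card_insert_if)

lemma stars_rtrancl:
  assumes F: "F \<subseteq> all_edges n" shows "(adj (stars n F))\<^sup>* = (adj F)\<^sup>*"
proof (intro equalityI rtrancl_subset_rtrancl subrelI)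
  fix x y assume "(x, y) \<in> adj (stars n F)"
  then obtain u where u: "{x, y} = {u, Min (component u F)}" "u < n"
    by (auto simp: adj_def stars_def)
  have "(u, Min (component u F)) \<in> (adj F)\<^sup>*" using Min_comp(1)[OF u(2) F] by (simp add: component_def)
  moreover from this have "(Min (component u F), u) \<in> (adj F)\<^sup>*"
    by (meson sym_adj sym_rtrancl symD)
  ultimately show "(x, y) \<in> (adj F)\<^sup>*" using u(1) by (auto simp: doubleton_eq_iff)
next
  fix x y assume xy: "(x, y) \<in> adj F"
  then have "{x, y} \<in> all_edges n" using F by (auto simp: adj_def)
  then have n: "x < n" "y < n" by (auto simp: all_edges_def)
  have "y \<in> component x F" using xy by (auto simp: component_def)
  then have eq: "Min (component y F) = Min (component x F)" by (simp add: component_eq)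
  have star: "(u, Min (component u F)) \<in> (adj (stars n F))\<^sup>*" if "u < n" for u
  proof (cases "u = Min (component u F)")
    case False
    then have "(u, Min (component u F)) \<in> adj (stars n F)" using that by (auto simp: adj_def stars_def)
    then show ?thesis by blast
  next
    case True
    show ?thesis by (subst True[symmetric]) (rule rtrancl_refl)
  qed
  have "(Min (component x F), y) \<in> (adj (stars n F))\<^sup>*"
    using symD[OF sym_rtrancl[OF sym_adj] star[OF n(2)]] eq by simp
  then show "(x, y) \<in> (adj (stars n F))\<^sup>*" using star[OF n(1)] by (meson rtrancl_trans)
qed

lemma component_stars: "F \<subseteq> all_edges n \<Longrightarrow> component u (stars n F) = component u F"
  by (simp add: component_def stars_rtrancl)

lemma card_stars_le_vertices: "card (stars n F) \<le> n"
proof -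
  have "stars n F \<subseteq> (\<lambda>u. {u, Min (component u F)}) ` {..<n}" by (auto simp: stars_def)
  then have "card (stars n F) \<le> card ((\<lambda>u. {u, Min (component u F)}) ` {..<n})"
    by (intro card_mono) auto
  also have "\<dots> \<le> card {..<n}" by (rule card_image_le) simp
  finally show ?thesis by simp
qed

text \<open>A vertex that is not the minimum of its component is an endpoint of an edge. This bound
  serves the case of large \<open>w\<close>, where the term \<open>w * m\<close> of the space bound
  pays for storing the forest.\<close>

lemma card_stars_le_edges:
  assumes F: "F \<subseteq> all_edges n" shows "card (stars n F) \<le> 2 * card F"
proof -
  have fin: "finite F" using F finite_all_edges finite_subset by blast
  have "u \<in> \<Union>F" if "u \<noteq> Min (component u F)" for u
  proof (rule ccontr)
    assume "u \<notin> \<Union>F"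
    then have "component u F \<subseteq> {u}" by (intro component_subset_closed) auto
    then have "component u F = {u}" using component_self by blast
    then show False using that by simp
  qed
  then have sub: "stars n F \<subseteq> (\<lambda>u. {u, Min (component u F)}) ` \<Union>F" by (auto simp: stars_def)
  have "finite e" if "e \<in> F" for e using that F by (auto simp: all_edges_def intro: finite_subset)
  then have finU: "finite (\<Union>F)" using fin by blast
  have "card (stars n F) \<le> card (\<Union>F)"
    using order_trans[OF card_mono[OF finite_imageI[OF finU] sub] card_image_le[OF finU]] .
  also have "\<dots> \<le> (\<Sum>e\<in>F. card e)" by (rule card_Union_le_sum_card)
  also have "\<dots> = 2 * card F" using F by (subst sum.cong[of F F card "\<lambda>_. 2"]) (auto simp: all_edges_def)
  finally show ?thesis .
qed

definition star_step :: "nat \<Rightarrow> nat set set \<Rightarrow> nat set \<times> int \<Rightarrow> nat set set" where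
  "star_step n F x = stars n (insert (fst x) F)"

lemma rtrancl_adj_insert:
  assumes "(adj F)\<^sup>* = (adj F')\<^sup>*" shows "(adj (insert e F))\<^sup>* = (adj (insert e F'))\<^sup>*"
proof -
  have "adj (insert e F) = adj F \<union> adj {e}" for F by (auto simp: adj_def)
  then show ?thesis using assms rtrancl_Un_rtrancl by metis
qed

lemma stars_cong: "(adj F)\<^sup>* = (adj F')\<^sup>* \<Longrightarrow> stars n F = stars n F'"
  by (simp add: stars_def component_def)

lemma foldl_star_step:
  assumes "fst ` set xs \<subseteq> all_edges n"
  shows "foldl (star_step n) {} xs = stars n (fst ` set xs)"
  using assms
proof (induction xs rule: rev_induct)
  case Nil
  then show ?case by (simp add: stars_def)
next
  case (snoc x xs)
  then have "foldl (star_step n) {} (xs @ [x]) = star_step n (stars n (fst ` set xs)) x" by simp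
  also have "\<dots> = stars n (insert (fst x) (stars n (fst ` set xs)))" by (simp only: star_step_def)
  also have "\<dots> = stars n (insert (fst x) (fst ` set xs))"
    by (intro stars_cong rtrancl_adj_insert stars_rtrancl) (use snoc.prems in auto)
  finally show ?case by simp
qed

lemma num_components_stars:
  assumes "E \<subseteq> all_edges n" shows "num_components n (stars n E) = num_components n E"
proof -
  have "real (num_components n (stars n E)) = real (num_components n E)"
    using num_components_eq_sum[OF assms] num_components_eq_sum[OF stars_edges[OF assms]]
    by (simp add: component_stars[OF assms])
  then show ?thesis by simp
qed

section \<open>The tracker on a hidden-batch stream\<close>

definition to_cell :: "nat \<Rightarrow> nat set \<times> int \<Rightarrow> nat set \<times> nat" where
  "to_cell N = (\<lambda>(e, z). (e, nat (z div int N)))"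

text \<open>Slots \<open>0\<close> to \<open>k\<close> cover the times below \<open>p\<close>.
  \<open>R\<close> is \<open>3 * k ^ 2\<close> because, if at most \<open>k ^ 2\<close> of so many
  batches start at \<open>p\<close> or later, \<open>2 * k ^ 2\<close> of them start before
  \<open>p\<close>, which is very unlikely. In the cap, \<open>C1 * h * cnt\<close> stands for
  \<open>C2 * h * m\<close>: slot \<open>0\<close> should hold about \<rho> m edges, and by
  \<open>4 * C2 \<le> C1 * \<rho>\<close> a quarter of them is enough.\<close>

locale hidden_stream = tracker n key L k \<Lambda>
  for n :: nat and key :: "nat set \<Rightarrow> nat" and L k :: nat and \<Lambda> :: "nat \<Rightarrow> nat" +
  fixes E :: "nat set set" and \<B> :: "nat set set set"
    and \<sigma> :: "(nat set set \<Rightarrow> real) \<Rightarrow> (nat set \<times> real) list"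
    and b \<kappa> N R :: nat and w h \<rho> p C1 C2 :: real
  assumes n: "1 \<le> n" and k: "1 \<le> k" and graph: "simple_graph n E"
    and adv: "hidden_batch_adversary b w \<kappa> n E \<B> \<sigma>"
    and N: "1 \<le> N" and L: "2 \<le> L" and w: "0 \<le> w" "w \<le> h"
    and h_def: "h = real N / real n ^ \<kappa>" and \<rho>_def: "\<rho> = real L * h"
    and p_def: "p = (real k + 1) * \<rho>" and p: "p < 1"
    and \<Lambda>: "\<And>cnt. \<Lambda> cnt = b + nat \<lceil>C1 * (real b + h * real cnt)\<rceil>"
    and C: "0 < C2" "4 * C2 \<le> C1 * \<rho>" and R_def: "R = 3 * k ^ 2"
begin

lemma E: "E \<subseteq> all_edges n"
  using graph by (simp add: simple_graph_def all_edges_def)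

lemma part: "partition_on E \<B>" and card_batch: "B \<in> \<B> \<Longrightarrow> card B \<le> b"
  using adv by (auto simp: hidden_batch_adversary_def)

lemma fin: "finite E" "finite \<B>"
proof -
  show f: "finite E" using E finite_all_edges finite_subset by blast
  show "finite \<B>" by (rule finite_elements[OF f part])
qed

sublocale batch_times \<B>
  by unfold_locales (rule fin)

lemma trees: "v < n \<Longrightarrow> batch_tracker n key E \<B> v"
  by unfold_locales (use E part in auto)

lemma pos: "0 < h" "0 < \<rho>" "0 < p" "h \<le> \<rho> / 2" "w \<le> \<rho> / 2" "\<rho> \<le> p" "h \<le> 1" "w \<le> 1" "\<rho> \<le> 1" "0 < C1"
proof -
  show h0: "0 < h" using n N by (simp add: h_def)
  have "2 * h \<le> real L * h" using L h0 by (intro mult_right_mono) auto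
  then show h1: "h \<le> \<rho> / 2" by (simp add: \<rho>_def)
  then show r: "0 < \<rho>" using h0 by linarith
  show "w \<le> \<rho> / 2" using w h1 by linarith
  show rp: "\<rho> \<le> p" using r unfolding p_def by simp
  show "0 < p" "h \<le> 1" "w \<le> 1" "\<rho> \<le> 1" using r rp p h1 h0 w by linarith+
  have "0 < C1 * \<rho>" using C by linarith
  then show "0 < C1" using r by (simp add: zero_less_mult_iff)
qed

definition tm :: "(nat set set \<Rightarrow> real) \<Rightarrow> nat set \<Rightarrow> real" where
  "tm t e = the (map_of (\<sigma> t) e)"

definition cl :: "(nat set set \<Rightarrow> real) \<Rightarrow> nat set \<Rightarrow> nat" where
  "cl t e = nat \<lfloor>tm t e / h\<rfloor>"

definition cb :: "(nat set set \<Rightarrow> real) \<Rightarrow> nat set set \<Rightarrow> nat" where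
  "cb t B = nat \<lfloor>t B / h\<rfloor>"

definition us :: "(nat set set \<Rightarrow> real) \<Rightarrow> (nat set \<times> nat) list" where
  "us t = map (to_cell N) (presented \<kappa> n (\<sigma> t))"

abbreviation box :: "(nat set set \<Rightarrow> real) set" where
  "box \<equiv> \<Pi>\<^sub>E B\<in>\<B>. {0..1}"

lemma box_stream:
  assumes "t \<in> box"
  shows "distinct (map fst (\<sigma> t))" "set (map fst (\<sigma> t)) = E" "sorted (map snd (\<sigma> t))"
    "\<And>B e x. B \<in> \<B> \<Longrightarrow> (e, x) \<in> set (\<sigma> t) \<Longrightarrow> e \<in> B \<Longrightarrow> t B \<le> x \<and> x \<le> t B + w"
proof -
  have *: "distinct (map fst (\<sigma> t)) \<and> set (map fst (\<sigma> t)) = E \<and> sorted (map snd (\<sigma> t)) \<and>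
        (\<forall>B\<in>\<B>. \<forall>(e, x)\<in>set (\<sigma> t). e \<in> B \<longrightarrow> t B \<le> x \<and> x \<le> t B + w)"
    using adv assms by (simp add: hidden_batch_adversary_def)
  then show "distinct (map fst (\<sigma> t))" "set (map fst (\<sigma> t)) = E" "sorted (map snd (\<sigma> t))"
    by blast+
  fix B e x assume "B \<in> \<B>" "(e, x) \<in> set (\<sigma> t)" "e \<in> B"
  then show "t B \<le> x \<and> x \<le> t B + w" using * by blast
qed

lemma tm_mem: "t \<in> box \<Longrightarrow> (e, x) \<in> set (\<sigma> t) \<Longrightarrow> tm t e = x"
  using box_stream(1)[of t] by (simp add: tm_def)

lemma tm_bounds:
  assumes "t \<in> box" "B \<in> \<B>" "e \<in> B" shows "t B \<le> tm t e" "tm t e \<le> t B + w" "0 \<le> t B" "t B \<le> 1"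
proof -
  have "e \<in> E" using assms partition_onD1[OF part] by blast
  then obtain x where x: "(e, x) \<in> set (\<sigma> t)" using box_stream(2)[OF assms(1)] by auto
  then show "t B \<le> tm t e" "tm t e \<le> t B + w"
    using box_stream(4)[OF assms(1,2) x assms(3)] tm_mem[OF assms(1) x] by auto
  show "0 \<le> t B" "t B \<le> 1" using assms by (auto simp: PiE_iff)
qed

text \<open>A cell is \<open>N\<close> units of the presented precision long, so rounding the
  timestamps down moves no edge to another cell.\<close>

lemma cell_floor: "nat (\<lfloor>x * real n ^ \<kappa>\<rfloor> div int N) = nat \<lfloor>x / h\<rfloor>"
proof -
  have "\<lfloor>x * real n ^ \<kappa>\<rfloor> div int N = \<lfloor>x * real n ^ \<kappa> / real_of_int (int N)\<rfloor>"
    by (rule floor_divide_real_eq_div[symmetric]) simp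
  also have "x * real n ^ \<kappa> / real_of_int (int N) = x / h" by (simp add: h_def)
  finally show ?thesis by simp
qed

lemma slot_floor: "0 \<le> x \<Longrightarrow> nat \<lfloor>x / h\<rfloor> div L = nat \<lfloor>x / \<rho>\<rfloor>"
proof -
  assume x: "0 \<le> x"
  have "\<lfloor>x / h\<rfloor> div int L = \<lfloor>x / h / real_of_int (int L)\<rfloor>"
    by (rule floor_divide_real_eq_div[symmetric]) simp
  also have "x / h / real_of_int (int L) = x / \<rho>" by (simp add: \<rho>_def mult.commute)
  finally have "nat (\<lfloor>x / h\<rfloor> div int L) = nat \<lfloor>x / \<rho>\<rfloor>" by simp
  moreover have "0 \<le> \<lfloor>x / h\<rfloor>" using x pos by simp
  ultimately show ?thesis by (simp add: nat_div_distrib)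
qed

lemma us_eq: "us t = map (\<lambda>(e, x). (e, nat \<lfloor>x / h\<rfloor>)) (\<sigma> t)"
  unfolding us_def presented_def map_map
  by (rule map_cong[OF refl]) (auto simp: to_cell_def cell_floor)

lemma us_properties:
  assumes "t \<in> box"
  shows "distinct (map fst (us t))" "fst ` set (us t) = E" "sorted (map snd (us t))"
    "set (us t) = (\<lambda>e. (e, cl t e)) ` E"
proof -
  have f: "map fst (us t) = map fst (\<sigma> t)" by (auto simp: us_eq)
  then show "distinct (map fst (us t))" using box_stream(1)[OF assms] by simp
  show fE: "fst ` set (us t) = E" using box_stream(2)[OF assms] f by (metis list.set_map)
  have "sorted (map (\<lambda>x. nat \<lfloor>x / h\<rfloor>) (map snd (\<sigma> t)))"
  proof -
    have "sorted_wrt (\<lambda>x y. nat \<lfloor>x / h\<rfloor> \<le> nat \<lfloor>y / h\<rfloor>) (map snd (\<sigma> t))"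
      by (rule sorted_wrt_mono_rel[OF _ box_stream(3)[OF assms]])
         (use pos in \<open>auto intro!: nat_mono floor_mono divide_right_mono\<close>)
    then show ?thesis by (simp add: sorted_wrt_map)
  qed
  moreover have "map snd (us t) = map (\<lambda>x. nat \<lfloor>x / h\<rfloor>) (map snd (\<sigma> t))"
    by (auto simp: us_eq)
  ultimately show "sorted (map snd (us t))" by simp
  have c: "c = cl t e" if "(e, c) \<in> set (us t)" for e c
    using that tm_mem[OF assms] by (auto simp: us_eq cl_def)
  show "set (us t) = (\<lambda>e. (e, cl t e)) ` E"
  proof (intro equalityI subsetI)
    fix u assume "u \<in> set (us t)"
    then show "u \<in> (\<lambda>e. (e, cl t e)) ` E" using c[of "fst u" "snd u"] fE
      by (intro image_eqI[of _ _ "fst u"]) (auto simp: prod_eq_iff)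
  next
    fix u assume "u \<in> (\<lambda>e. (e, cl t e)) ` E"
    then obtain e where e: "e \<in> E" "u = (e, cl t e)" by blast
    then obtain d where "(e, d) \<in> set (us t)" using fE by force
    then show "u \<in> set (us t)" using c e by blast
  qed
qed

section \<open>Runs outside the bad event\<close>

definition weight_of :: "nat \<Rightarrow> (nat set set \<Rightarrow> real) \<Rightarrow> real" where
  "weight_of v t = estimate \<rho> (foldl step (v, 0, False, {}) (us t))"

definition rel :: "nat \<Rightarrow> nat set set set" where
  "rel v = batch_tracker.relevant k \<B> R v"

text \<open>The sets of batches for which the condition \<open>late\<close> of
  \<open>good_run\<close> has to be ensured.\<close>

definition highs :: "nat \<Rightarrow> nat set set set set" where
  "highs v = (\<lambda>Bs. batch_tracker.touching \<B> (batch_tracker.reached v Bs)) `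
     {Bs \<in> batch_tracker.chains k \<B> R v. R < card (batch_tracker.touching \<B> (batch_tracker.reached v Bs))}"

definition tree :: "nat \<Rightarrow> nat set set qtree" where
  "tree v = batch_tracker.mk_tree key k \<B> R v (Suc (card \<B>)) [] {}"

text \<open>The first four clauses endanger, in this order, the conditions \<open>cell\<close>,
  \<open>inj\<close>, \<open>kept\<close> and \<open>late\<close> of \<open>good_run\<close>. The
  last one is an underestimate of the number of edges in slot \<open>0\<close>, which also endangers
  \<open>kept\<close>, but only when \<open>C1 * b\<close> alone does not make the cap large
  enough.\<close>

definition bad :: "nat \<Rightarrow> (nat set set \<Rightarrow> real) \<Rightarrow> bool" where
  "bad v t \<longleftrightarrow> (\<exists>B\<in>rel v. \<exists>c::int. t B < c * h \<and> c * h \<le> t B + w) \<or>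
     (\<exists>P\<in>{P \<in> rel v \<times> rel v. fst P \<noteq> snd P}. \<bar>t (fst P) - t (snd P)\<bar> \<le> 2 * h) \<or>
     (\<exists>B\<in>rel v. C2 * h * card E < crowd (2 * h) B t) \<or>
     (\<exists>D\<in>highs v. card {B \<in> D. p \<le> t B} \<le> k ^ 2) \<or>
     (C1 * b < C2 * h * card E \<and> early_edges (\<rho> - w) t < (\<rho> - w) * card E / 2)"

lemma same_cell:
  assumes "0 \<le> x" "0 \<le> y" "nat \<lfloor>x / h\<rfloor> = nat \<lfloor>y / h\<rfloor>"
  shows "\<bar>x - y\<bar> < h"
proof -
  have "0 \<le> \<lfloor>x / h\<rfloor>" "0 \<le> \<lfloor>y / h\<rfloor>" using assms pos by auto
  then have "\<lfloor>x / h\<rfloor> = \<lfloor>y / h\<rfloor>" using assms(3) eq_nat_nat_iff by blast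
  then have "\<bar>x / h - y / h\<bar> < 1" by linarith
  then have "\<bar>(x - y) / h\<bar> < 1" by (simp add: diff_divide_distrib)
  then show ?thesis using pos by (simp add: abs_divide pos_divide_less_eq)
qed

text \<open>One \<open>h\<close> accounts for the length of the cell, the other for the delay of an
  edge, which is at most \<open>w \<le> h\<close>.\<close>

lemma near_of_same_cell:
  assumes t: "t \<in> box" and B: "B \<in> \<B>" "B' \<in> \<B>" "e \<in> B'" and c: "cl t e = cb t B"
  shows "\<bar>t B - t B'\<bar> \<le> 2 * h"
proof -
  have tb: "t B' \<le> tm t e" "tm t e \<le> t B' + w" "0 \<le> t B'" using tm_bounds[OF t B(2,3)] by auto
  have "0 \<le> t B" using t B(1) by (auto simp: PiE_iff)
  then have "\<bar>tm t e - t B\<bar> < h" using same_cell[of "tm t e" "t B"] c tb by (simp add: cl_def cb_def)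
  then show ?thesis using tb w by linarith
qed

lemma cell_card:
  assumes t: "t \<in> box" and B: "B \<in> \<B>"
  shows "real (card {e \<in> E. cl t e = cb t B}) \<le> b + crowd (2 * h) B t"
proof -
  let ?D = "{B' \<in> \<B> - {B}. \<bar>t B - t B'\<bar> \<le> 2 * h}"
  have finB: "finite B'" if "B' \<in> \<B>" for B'
    using that fin partition_onD1[OF part] finite_subset by (metis Union_upper)
  have sub: "{e \<in> E. cl t e = cb t B} \<subseteq> B \<union> \<Union>?D"
  proof
    fix e assume e: "e \<in> {e \<in> E. cl t e = cb t B}"
    then obtain B' where B': "B' \<in> \<B>" "e \<in> B'" using partition_onD1[OF part] by blast
    then show "e \<in> B \<union> \<Union>?D" using near_of_same_cell[OF t B B'] e by blast
  qed
  have "card {e \<in> E. cl t e = cb t B} \<le> card (B \<union> \<Union>?D)"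
    by (rule card_mono[OF _ sub]) (use finB B fin in auto)
  also have "\<dots> \<le> card B + card (\<Union>?D)" by (rule card_Un_le)
  also have "card (\<Union>?D) \<le> (\<Sum>B'\<in>?D. card B')" by (rule card_Union_le_sum_card)
  finally have "real (card {e \<in> E. cl t e = cb t B}) \<le> real (card B) + real (\<Sum>B'\<in>?D. card B')"
    by (simp only: of_nat_add[symmetric] of_nat_le_iff)
  also have "real (\<Sum>B'\<in>?D. card B') = crowd (2 * h) B t"
  proof -
    have "(\<Sum>B'\<in>?D. real (card B'))
        = (\<Sum>B'\<in>\<B> - {B}. if \<bar>t B - t B'\<bar> \<le> 2 * h then real (card B') else 0)"
      by (rule sum.inter_filter) (use fin in simp)
    also have "\<dots> = crowd (2 * h) B t"
      unfolding crowd_def by (rule sum.cong) simp_all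
    finally show ?thesis by simp
  qed
  finally show ?thesis using card_batch[OF B] by simp
qed

text \<open>A batch starting before \<open>\<rho> - w\<close> is over before slot \<open>1\<close>
  begins, whatever delays the adversary chooses.\<close>

lemma warm_up_count:
  assumes t: "t \<in> box"
  shows "early_edges (\<rho> - w) t \<le> real (card {u \<in> set (us t). snd u div L = 0})"
proof -
  let ?D = "{B \<in> \<B>. t B < \<rho> - w}"
  have finB: "finite B'" if "B' \<in> \<B>" for B'
    using that fin partition_onD1[OF part] finite_subset by (metis Union_upper)
  have "early_edges (\<rho> - w) t = real (\<Sum>B\<in>?D. card B)"
  proof -
    have "(\<Sum>B\<in>?D. real (card B)) = (\<Sum>B\<in>\<B>. if t B < \<rho> - w then real (card B) else 0)"
      by (rule sum.inter_filter) (use fin in simp)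
    also have "\<dots> = early_edges (\<rho> - w) t"
      unfolding early_edges_def by (rule sum.cong) simp_all
    finally show ?thesis by simp
  qed
  also have "(\<Sum>B\<in>?D. card B) = card (\<Union>?D)"
    using finB partition_onD2[OF part] by (subst card_Union_disjoint) (auto simp: disjoint_def pairwise_def disjnt_def)
  also have "card (\<Union>?D) \<le> card {u \<in> set (us t). snd u div L = 0}"
  proof (rule card_inj_on_le[of "\<lambda>e. (e, cl t e)"])
    show "(\<lambda>e. (e, cl t e)) ` \<Union>?D \<subseteq> {u \<in> set (us t). snd u div L = 0}"
    proof
      fix u assume "u \<in> (\<lambda>e. (e, cl t e)) ` \<Union>?D"
      then obtain e B where e: "u = (e, cl t e)" "e \<in> B" "B \<in> \<B>" "t B < \<rho> - w" by blast
      have b: "t B \<le> tm t e" "tm t e \<le> t B + w" "0 \<le> t B" using tm_bounds[OF t e(3,2)] by auto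
      have "cl t e div L = nat \<lfloor>tm t e / \<rho>\<rfloor>" using slot_floor b by (simp add: cl_def)
      also have "\<dots> = 0"
      proof -
        have "tm t e / \<rho> < 1" using b e(4) pos by (simp add: pos_divide_less_eq)
        then show ?thesis by linarith
      qed
      finally have "cl t e div L = 0" .
      moreover have "e \<in> E" using e partition_onD1[OF part] by blast
      ultimately show "u \<in> {u \<in> set (us t). snd u div L = 0}" using us_properties(4)[OF t] e(1) by auto
    qed
  qed (auto simp: inj_on_def)
  finally show ?thesis by simp
qed

lemma weight_of_eq_tree:
  assumes v: "v < n" and t: "t \<in> box" and good: "\<not> bad v t"
  shows "weight_of v t = tval \<rho> (slot_of \<rho> t) (tree v) 0"
proof -
  interpret V: batch_tracker n key L k \<Lambda> E \<B> R v by (rule trees[OF v])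
  note us = us_properties[OF t]
  obtain v' cnt dead r where st: "foldl step (v, 0, False, {}) (us t) = (v', cnt, dead, r)"
    by (cases "foldl step (v, 0, False, {}) (us t)")
  have "fst ` set (us t) \<subseteq> all_edges n" using us(2) E by blast
  then obtain A where "run_inv v (us t) A (v', cnt, dead, r)"
    using run_inv_foldl[OF us(1) _ us(3), of v] st by auto
  then have v': "v' = v" and cnt: "cnt = card {u \<in> set (us t). snd u div L = 0}"
    and ker: "kernel v r A" and A: "A \<subseteq> set (us t)"
    and dead: "dead \<longleftrightarrow> (\<exists>u\<in>set (us t). violation v A u)"
    and cells: "\<And>c. 1 \<le> c div L \<Longrightarrow> c div L \<le> k \<Longrightarrow> card {u \<in> set (us t). snd u = c} \<le> \<Lambda> cnt \<Longrightarrow>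
        {u \<in> set (us t). snd u = c} \<subseteq> A"
    unfolding run_inv_def by auto
  have unstraddled: "\<not> (\<exists>c::int. t B < c * h \<and> c * h \<le> t B + w)" if "B \<in> rel v" for B
    using good that unfolding bad_def by blast
  have apart: "\<not> \<bar>t (fst P) - t (snd P)\<bar> \<le> 2 * h" if "P \<in> rel v \<times> rel v" "fst P \<noteq> snd P" for P
    using good that unfolding bad_def by blast
  have uncrowded: "\<not> C2 * h * card E < crowd (2 * h) B t" if "B \<in> rel v" for B
    using good that unfolding bad_def by blast
  have many_late: "k ^ 2 < card {B \<in> D. p \<le> t B}" if "D \<in> highs v" for D
    using good that unfolding bad_def by (meson not_le)
  have relB: "rel v \<subseteq> \<B>" unfolding rel_def using V.relevant_subset .
  have tpos: "0 \<le> t B" if "B \<in> \<B>" for B using t that by (auto simp: PiE_iff)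
  \<comment> \<open>The cap admits the whole cell of a relevant batch that is not crowded. Either
    \<open>C1 * b\<close> suffices by itself, or the count is at least \<rho> m / 4, where one
    factor 1/2 comes from \<rho> - w \<ge> \<rho> / 2.\<close>
  have big: "real b + C2 * h * card E \<le> \<Lambda> cnt"
  proof -
    have "C2 * h * card E \<le> C1 * (real b + h * real cnt)"
    proof (cases "C1 * b < C2 * h * card E")
      case True
      then have "(\<rho> - w) * card E / 2 \<le> early_edges (\<rho> - w) t" using good by (auto simp: bad_def)
      also have "\<dots> \<le> cnt" using warm_up_count[OF t] cnt by simp
      finally have "(\<rho> - w) * card E / 2 \<le> cnt" .
      moreover have "\<rho> / 2 * card E \<le> (\<rho> - w) * card E" using pos by (intro mult_right_mono) auto
      ultimately have "\<rho> * card E / 4 \<le> cnt" by simp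
      then have "C1 * h * (\<rho> * card E / 4) \<le> C1 * h * cnt"
        using pos by (intro mult_left_mono) auto
      moreover have "C2 * h * card E \<le> C1 * \<rho> / 4 * (h * card E)"
        using C pos mult_right_mono[of C2 "C1 * \<rho> / 4" "h * card E"] by (simp add: mult.assoc)
      moreover have "0 \<le> C1 * b" using pos by simp
      ultimately show ?thesis by (simp add: algebra_simps)
    next
      case False
      moreover have "0 \<le> C1 * (h * cnt)" using pos by simp
      ultimately show ?thesis by (simp add: distrib_left)
    qed
    also have "\<dots> \<le> real (nat \<lceil>C1 * (real b + h * real cnt)\<rceil>)" by linarith
    finally show ?thesis unfolding \<Lambda> by simp
  qed
  have G: "good_run n key L k E \<B> R v (cl t) (cb t) A"
  proof (intro good_run.intro good_run_axioms.intro trees[OF v])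
    show "A \<subseteq> (\<lambda>e. (e, cl t e)) ` E" using A us(4) by simp
  next
    fix B e assume B: "B \<in> V.relevant" "e \<in> B"
    then have BB: "B \<in> \<B>" using V.relevant_subset by blast
    have tb: "t B \<le> tm t e" "tm t e \<le> t B + w" "0 \<le> t B" using tm_bounds[OF t BB B(2)] by auto
    \<comment> \<open>The first cell boundary after the start of \<open>B\<close>; as it is not
      straddled, all edges of \<open>B\<close> arrive before it.\<close>
    define c where "c = \<lfloor>t B / h\<rfloor> + 1"
    have "t B / h < c" unfolding c_def by linarith
    then have "t B < c * h" using pos by (simp add: pos_divide_less_eq)
    moreover have "\<not> (\<exists>c::int. t B < c * h \<and> c * h \<le> t B + w)"
      using unstraddled B(1) unfolding rel_def by blast
    ultimately have "\<not> c * h \<le> t B + w" by blast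
    then have "tm t e < c * h" using tb by linarith
    then have "tm t e / h < c" using pos by (simp add: pos_divide_less_eq)
    moreover have "t B / h \<le> tm t e / h" using tb pos by (simp add: divide_right_mono)
    ultimately have "\<lfloor>tm t e / h\<rfloor> = \<lfloor>t B / h\<rfloor>" unfolding c_def by linarith
    then show "cl t e = cb t B" by (simp add: cl_def cb_def)
  next
    show "inj_on (cb t) V.relevant"
    proof (rule inj_onI, rule ccontr)
      fix B B' assume B: "B \<in> V.relevant" "B' \<in> V.relevant" "cb t B = cb t B'" "B \<noteq> B'"
      have "0 \<le> t B" "0 \<le> t B'" using B(1,2) tpos V.relevant_subset by blast+
      then have "\<bar>t B - t B'\<bar> < h"
        using same_cell[of "t B" "t B'"] B(3) unfolding cb_def by blast
      moreover have "(B, B') \<in> {P \<in> rel v \<times> rel v. fst P \<noteq> snd P}" using B by (simp add: rel_def)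
      then have "\<not> \<bar>t B - t B'\<bar> \<le> 2 * h" using apart by fastforce
      ultimately show False using pos by linarith
    qed
  next
    fix B e assume B: "B \<in> V.relevant" "1 \<le> cb t B div L" "cb t B div L \<le> k" "e \<in> E" "cl t e = cb t B"
    then have BB: "B \<in> \<B>" using V.relevant_subset by blast
    have eq: "{u \<in> set (us t). snd u = cb t B} = (\<lambda>e. (e, cl t e)) ` {e \<in> E. cl t e = cb t B}"
      using us(4) by auto
    have "card {u \<in> set (us t). snd u = cb t B} \<le> card {e \<in> E. cl t e = cb t B}"
      unfolding eq by (rule card_image_le) (use fin in simp)
    moreover have "crowd (2 * h) B t \<le> C2 * h * card E"
      using uncrowded[of B] B(1) unfolding rel_def by simp
    ultimately have "real (card {u \<in> set (us t). snd u = cb t B}) \<le> real (\<Lambda> cnt)"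
      using cell_card[OF t BB] big by linarith
    then have "{u \<in> set (us t). snd u = cb t B} \<subseteq> A" using cells[OF B(2,3)] by simp
    then show "(e, cl t e) \<in> A" using us(4) B by auto
  next
    fix Bs assume Bs: "Bs \<in> V.chains" "R < card (V.touching (V.reached Bs))"
    let ?D = "V.touching (V.reached Bs)"
    have "?D \<in> highs v" using Bs by (auto simp: highs_def)
    then have "k ^ 2 < card {B \<in> ?D. p \<le> t B}" by (rule many_late)
    also have "\<dots> \<le> card {B \<in> ?D. \<forall>e\<in>B. k < cl t e div L}"
    proof (rule card_mono)
      show "{B \<in> ?D. p \<le> t B} \<subseteq> {B \<in> ?D. \<forall>e\<in>B. k < cl t e div L}"
      proof clarify
        fix B e assume B: "B \<in> ?D" "p \<le> t B" "e \<in> B"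
        then have BB: "B \<in> \<B>" by (auto simp: V.touching_def)
        have tb: "t B \<le> tm t e" "0 \<le> t B" using tm_bounds[OF t BB B(3)] by auto
        have "(real k + 1) * \<rho> \<le> tm t e" using tb B(2) by (simp add: p_def)
        then have "real k + 1 \<le> tm t e / \<rho>" using pos by (simp add: pos_le_divide_eq)
        then have "k < nat \<lfloor>tm t e / \<rho>\<rfloor>" by linarith
        then show "k < cl t e div L" using slot_floor[of "tm t e"] tb by (simp add: cl_def)
      qed
    qed (use V.finite_touching in simp)
    finally show "k ^ 2 < card {B \<in> ?D. \<forall>e\<in>B. k < cl t e div L}" .
  qed
  interpret G: good_run n key L k \<Lambda> E \<B> R v "cl t" "cb t" A \<rho> by (rule G)
  have items: "G.items = set (us t)" using us(4) by (simp add: G.items_def)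
  have "weight_of v t = G.weight"
    unfolding weight_of_def st G.weight_def items v'
    using dead kernel_levels[OF G.proper_A ker] kernel_coll[OF G.proper_A ker, of k] by simp
  also have "\<dots> = tval \<rho> G.slot (tree v) 0"
    using G.weight_eq by (simp add: tree_def)
  also have "\<dots> = tval \<rho> (slot_of \<rho> t) (tree v) 0"
  proof (rule tval_cong)
    fix B assume "B \<in> queries (tree v)"
    then have "B \<in> \<B>"
      using wf_qtree_queries[OF V.wf_mk_tree[OF V.chains.Nil]] unfolding tree_def by blast
    then show "G.slot B = slot_of \<rho> t B"
      using slot_floor[OF tpos] by (simp add: G.slot_def cb_def slot_of_def)
  qed
  finally show ?thesis .
qed

text \<open>Valid in bad runs too, where little is known about the memory: there are at most
  \<open>k\<close> levels in any case.\<close>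

lemma weight_of_bounds: "0 \<le> weight_of v t" "weight_of v t \<le> (1 / \<rho>) ^ k"
proof -
  obtain v' cnt dead r where st: "foldl step (v, 0, False, {}) (us t) = (v', cnt, dead, r)"
    by (cases "foldl step (v, 0, False, {}) (us t)")
  have r: "1 \<le> 1 / \<rho>" using pos by simp
  have "levels v' r \<le> k"
    unfolding levels_def using card_mono[of "{..<k}" "{j. j < k \<and> front (grown v' r j) r j \<noteq> {}}"] by auto
  then have 1: "(1 / \<rho>) ^ levels v' r \<le> (1 / \<rho>) ^ k" by (rule power_increasing) (rule r)
  have "x / real c \<le> x" if "0 \<le> x" for x :: real and c :: nat
    using that by (cases "c = 0") (auto simp: divide_le_eq mult_le_cancel_left1)
  then have 2: "(1 / \<rho>) ^ levels v' r / real (card (grown v' r k)) \<le> (1 / \<rho>) ^ levels v' r"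
    using pos by simp
  have "0 \<le> (1 / \<rho>) ^ k" using pos by simp
  then show "weight_of v t \<le> (1 / \<rho>) ^ k" using 1 2 by (auto simp: weight_of_def st)
  show "0 \<le> weight_of v t" using pos by (simp add: weight_of_def st)
qed

lemma weight_of_measurable: "weight_of v \<in> borel_measurable (start_times \<B>)"
proof -
  have "(\<lambda>t. presented \<kappa> n (\<sigma> t)) \<in> start_times \<B> \<rightarrow>\<^sub>M count_space UNIV"
    using adv by (simp add: hidden_batch_adversary_def)
  from measurable_compose[OF this, of "\<lambda>xs. estimate \<rho> (foldl step (v, 0, False, {}) (map (to_cell N) xs))" borel]
  show ?thesis by (simp add: weight_of_def[abs_def] us_def)
qed

end

section \<open>Probability of the bad event\<close>

lemma (in prob_space) prob_disj_le:
  assumes "{x \<in> space M. P x} \<in> events" "prob {x \<in> space M. P x} \<le> a"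
    "{x \<in> space M. Q x} \<in> events" "prob {x \<in> space M. Q x} \<le> c"
  shows "{x \<in> space M. P x \<or> Q x} \<in> events" "prob {x \<in> space M. P x \<or> Q x} \<le> a + c"
proof -
  have eq: "{x \<in> space M. P x \<or> Q x} = {x \<in> space M. P x} \<union> {x \<in> space M. Q x}" by auto
  show "{x \<in> space M. P x \<or> Q x} \<in> events" unfolding eq using assms by blast
  show "prob {x \<in> space M. P x \<or> Q x} \<le> a + c"
    unfolding eq using measure_Un_le[OF assms(1,3)] assms(2,4) by linarith
qed

context hidden_stream
begin

lemma chain_count: "1 \<le> R" "real R \<ge> 1"
proof -
  have "1 \<le> k ^ 2" using k by simp
  then show "1 \<le> R" unfolding R_def by linarith
  then show "real R \<ge> 1" by simp
qed

definition Q :: nat where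
  "Q = (k + 1) * R ^ (k + 1)"

text \<open>One summand for each clause of \<open>bad\<close>. \<open>Q\<close> bounds both the
  number of relevant batches and the number of sets in \<open>highs\<close>.\<close>

definition \<beta> :: real where
  "\<beta> = real Q * (2 * w / h) + real (Q * Q) * (4 * h) + real Q * (4 / C2)
     + real Q * (2 ^ (3 * k ^ 2) * p ^ (2 * k ^ 2)) + 16 * C2 / (\<rho>\<^sup>2 * C1)"

lemma prob_bad:
  assumes v: "v < n"
  shows "{t \<in> space (start_times \<B>). bad v t} \<in> S.events"
    "measure (start_times \<B>) {t \<in> space (start_times \<B>). bad v t} \<le> \<beta>"
proof -
  interpret V: batch_tracker n key L k \<Lambda> E \<B> R v by (rule trees[OF v])
  have relB: "rel v \<subseteq> \<B>" unfolding rel_def by (rule V.relevant_subset)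
  have finrel: "finite (rel v)" using relB fin finite_subset by blast
  have cardrel: "card (rel v) \<le> Q"
    unfolding rel_def Q_def by (rule V.relevant_card[OF chain_count(1)])
  have finh: "finite (highs v)"
    unfolding highs_def using V.chains_card(1)[OF chain_count(1)] by simp
  have cardh: "card (highs v) \<le> Q"
  proof -
    have f: "finite {Bs \<in> V.chains. R < card (V.touching (V.reached Bs))}"
      using V.chains_card(1)[OF chain_count(1)] by simp
    have "card (highs v) \<le> card {Bs \<in> V.chains. R < card (V.touching (V.reached Bs))}"
      unfolding highs_def by (rule card_image_le[OF f])
    also have "\<dots> \<le> card V.chains" by (rule card_mono[OF V.chains_card(1)[OF chain_count(1)]]) auto
    also have "\<dots> \<le> (k + 1) * R ^ k" by (rule V.chains_card(2)[OF chain_count(1)])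
    also have "\<dots> \<le> Q"
      unfolding Q_def using chain_count(1) by (intro mult_left_mono power_increasing) auto
    finally show ?thesis .
  qed
  let ?M = "start_times \<B>"
  let ?P1 = "\<lambda>t. \<exists>B\<in>rel v. \<exists>c::int. t B < c * h \<and> c * h \<le> t B + w"
  let ?I2 = "{P \<in> rel v \<times> rel v. fst P \<noteq> snd P}"
  let ?P2 = "\<lambda>t. \<exists>P\<in>?I2. \<bar>t (fst P) - t (snd P)\<bar> \<le> 2 * h"
  let ?P3 = "\<lambda>t. \<exists>B\<in>rel v. C2 * h * card E < crowd (2 * h) B t"
  let ?P4 = "\<lambda>t. \<exists>D\<in>highs v. card {B \<in> D. p \<le> t B} \<le> k ^ 2"
  let ?P5 = "\<lambda>t. C1 * b < C2 * h * card E \<and> early_edges (\<rho> - w) t < (\<rho> - w) * card E / 2"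
  have 1: "{t \<in> space ?M. ?P1 t} \<in> S.events" "measure ?M {t \<in> space ?M. ?P1 t} \<le> real Q * (2 * w / h)"
  proof -
    have st: "{t \<in> space ?M. \<exists>c::int. t B < c * h \<and> c * h \<le> t B + w} \<in> S.events"
      "measure ?M {t \<in> space ?M. \<exists>c::int. t B < c * h \<and> c * h \<le> t B + w} \<le> 2 * w / h"
      if "B \<in> rel v" for B
      using prob_straddle[of B h w] that relB pos(1,8) w(1) by blast+
    show "{t \<in> space ?M. ?P1 t} \<in> S.events" by (rule sets.sets_Collect_finite_Ex[OF st(1) finrel])
    have "measure ?M {t \<in> space ?M. ?P1 t} \<le> real (card (rel v)) * (2 * w / h)"
      by (rule S.prob_Bex_le[OF finrel st])
    also have "\<dots> \<le> real Q * (2 * w / h)" using cardrel pos w by (intro mult_right_mono) auto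
    finally show "measure ?M {t \<in> space ?M. ?P1 t} \<le> real Q * (2 * w / h)" .
  qed
  have 2: "{t \<in> space ?M. ?P2 t} \<in> S.events" "measure ?M {t \<in> space ?M. ?P2 t} \<le> real (Q * Q) * (4 * h)"
  proof -
    have finI: "finite ?I2" using finrel by (intro finite_subset[of ?I2 "rel v \<times> rel v"]) auto
    have st: "{t \<in> space ?M. \<bar>t (fst P) - t (snd P)\<bar> \<le> 2 * h} \<in> S.events"
      "measure ?M {t \<in> space ?M. \<bar>t (fst P) - t (snd P)\<bar> \<le> 2 * h} \<le> 4 * h"
      if "P \<in> ?I2" for P
    proof -
      have B: "fst P \<in> \<B>" "snd P \<in> \<B>" "fst P \<noteq> snd P" using that relB by auto
      note [measurable] = B(1,2)
      show "{t \<in> space ?M. \<bar>t (fst P) - t (snd P)\<bar> \<le> 2 * h} \<in> S.events" by measurable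
      show "measure ?M {t \<in> space ?M. \<bar>t (fst P) - t (snd P)\<bar> \<le> 2 * h} \<le> 4 * h"
        using prob_near[OF B, of "2 * h"] pos by simp
    qed
    show "{t \<in> space ?M. ?P2 t} \<in> S.events" by (rule sets.sets_Collect_finite_Ex[OF st(1) finI])
    have "measure ?M {t \<in> space ?M. ?P2 t} \<le> real (card ?I2) * (4 * h)"
      by (rule S.prob_Bex_le[OF finI st])
    also have "\<dots> \<le> real (Q * Q) * (4 * h)"
    proof (rule mult_right_mono)
      have "card ?I2 \<le> card (rel v \<times> rel v)" by (rule card_mono) (use finrel in auto)
      also have "\<dots> = card (rel v) * card (rel v)" by (rule card_cartesian_product)
      also have "\<dots> \<le> Q * Q" by (rule mult_le_mono[OF cardrel cardrel])
      finally show "real (card ?I2) \<le> real (Q * Q)" by (simp only: of_nat_le_iff)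
    qed (use pos in simp)
    finally show "measure ?M {t \<in> space ?M. ?P2 t} \<le> real (Q * Q) * (4 * h)" .
  qed
  have 3: "{t \<in> space ?M. ?P3 t} \<in> S.events" "measure ?M {t \<in> space ?M. ?P3 t} \<le> real Q * (4 / C2)"
  proof -
    have sumB: "(\<Sum>B\<in>\<B>. card B) \<le> card E"
    proof -
      have "\<And>B. B \<in> \<B> \<Longrightarrow> finite B" using V.batch_subset fin finite_subset by blast
      then have "card (\<Union>\<B>) = (\<Sum>B\<in>\<B>. card B)"
        using partition_onD2[OF part] by (intro card_Union_disjoint) (auto simp: disjoint_def pairwise_def disjnt_def)
      then show ?thesis using partition_onD1[OF part] by simp
    qed
    have st: "{t \<in> space ?M. C2 * h * card E < crowd (2 * h) B t} \<in> S.events"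
      "measure ?M {t \<in> space ?M. C2 * h * card E < crowd (2 * h) B t} \<le> 4 / C2"
      if "B \<in> rel v" for B
    proof -
      have B: "B \<in> \<B>" using that relB by blast
      then have "B \<noteq> {}" "B \<subseteq> E" using partition_onD3[OF part] V.batch_subset by blast+
      then have m: "0 < card E" using fin card_gt_0_iff by blast
      then have C0: "0 < C2 * h * card E" using C pos by simp
      note pc = prob_crowd[OF B _ C0 sumB, of "2 * h"]
      show "{t \<in> space ?M. C2 * h * card E < crowd (2 * h) B t} \<in> S.events" using pc(1) pos by simp
      have "2 * (2 * h) * real (card E) / (C2 * h * card E) = 4 / C2" using pos C m by (simp add: field_simps)
      then show "measure ?M {t \<in> space ?M. C2 * h * card E < crowd (2 * h) B t} \<le> 4 / C2"
        using pc(2) pos by simp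
    qed
    show "{t \<in> space ?M. ?P3 t} \<in> S.events" by (rule sets.sets_Collect_finite_Ex[OF st(1) finrel])
    have "measure ?M {t \<in> space ?M. ?P3 t} \<le> real (card (rel v)) * (4 / C2)"
      by (rule S.prob_Bex_le[OF finrel st])
    also have "\<dots> \<le> real Q * (4 / C2)" using cardrel C by (intro mult_right_mono) auto
    finally show "measure ?M {t \<in> space ?M. ?P3 t} \<le> real Q * (4 / C2)" .
  qed
  have 4: "{t \<in> space ?M. ?P4 t} \<in> S.events"
    "measure ?M {t \<in> space ?M. ?P4 t} \<le> real Q * (2 ^ (3 * k ^ 2) * p ^ (2 * k ^ 2))"
  proof -
    have st: "{t \<in> space ?M. card {B \<in> D. p \<le> t B} \<le> k ^ 2} \<in> S.events"
      "measure ?M {t \<in> space ?M. card {B \<in> D. p \<le> t B} \<le> k ^ 2} \<le> 2 ^ (3 * k ^ 2) * p ^ (2 * k ^ 2)"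
      if "D \<in> highs v" for D
    proof -
      have D: "D \<subseteq> \<B>" "R < card D" using that by (auto simp: highs_def V.touching_def)
      show "{t \<in> space ?M. card {B \<in> D. p \<le> t B} \<le> k ^ 2} \<in> S.events"
        by (rule few_late_measurable[OF D(1)])
      have "k ^ 2 + 2 * k ^ 2 \<le> card D" using D(2) unfolding R_def by simp
      from prob_few_late[OF D(1) this, of p]
      show "measure ?M {t \<in> space ?M. card {B \<in> D. p \<le> t B} \<le> k ^ 2} \<le> 2 ^ (3 * k ^ 2) * p ^ (2 * k ^ 2)"
        using pos(3) by simp
    qed
    show "{t \<in> space ?M. ?P4 t} \<in> S.events" by (rule sets.sets_Collect_finite_Ex[OF st(1) finh])
    have "measure ?M {t \<in> space ?M. ?P4 t} \<le> real (card (highs v)) * (2 ^ (3 * k ^ 2) * p ^ (2 * k ^ 2))"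
      by (rule S.prob_Bex_le[OF finh st])
    also have "\<dots> \<le> real Q * (2 ^ (3 * k ^ 2) * p ^ (2 * k ^ 2))"
      using cardh pos by (intro mult_right_mono) auto
    finally show "measure ?M {t \<in> space ?M. ?P4 t} \<le> real Q * (2 ^ (3 * k ^ 2) * p ^ (2 * k ^ 2))" .
  qed
  have 5: "{t \<in> space ?M. ?P5 t} \<in> S.events" "measure ?M {t \<in> space ?M. ?P5 t} \<le> 16 * C2 / (\<rho>\<^sup>2 * C1)"
  proof -
    have "{t \<in> space ?M. ?P5 t} \<in> S.events \<and> measure ?M {t \<in> space ?M. ?P5 t} \<le> 16 * C2 / (\<rho>\<^sup>2 * C1)"
    proof (cases "C1 * b < C2 * h * card E")
      case False
      then have e: "{t \<in> space ?M. ?P5 t} = {}" by blast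
      have "0 \<le> 16 * C2 / (\<rho>\<^sup>2 * C1)" using C(1) pos(10) by simp
      then show ?thesis unfolding e by (simp only: measure_empty sets.empty_sets simp_thms)
    next
      case True
      have m: "0 < card E"
      proof (rule ccontr)
        assume "\<not> 0 < card E"
        then have "C1 * b < 0" using True by simp
        moreover have "0 \<le> C1 * b" using pos by simp
        ultimately show False by linarith
      qed
      have a: "0 < \<rho> - w" "\<rho> - w \<le> 1" "\<rho> / 2 \<le> \<rho> - w" using pos w by linarith+
      note pf = prob_few_early[OF fin(1) part card_batch a(1,2) m]
      have eq: "{t \<in> space ?M. ?P5 t} = {t \<in> space ?M. early_edges (\<rho> - w) t < (\<rho> - w) * card E / 2}"
        using True by blast
      \<comment> \<open>The Chebyshev bound is effective because the assumption of this case and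
        \<open>h \<le> 1\<close> give b / m \<le> C2 / C1, so batches are small compared with the
        graph.\<close>
      have "4 * real b / ((\<rho> - w)\<^sup>2 * real (card E)) \<le> 4 * real b / ((\<rho> / 2)\<^sup>2 * real (card E))"
        using a m pos by (intro divide_left_mono mult_right_mono power_mono mult_pos_pos) auto
      also have "\<dots> = 16 / \<rho>\<^sup>2 * (real b / real (card E))" by (simp add: power_divide)
      also have "\<dots> \<le> 16 / \<rho>\<^sup>2 * (C2 / C1)"
      proof (rule mult_left_mono)
        have "C2 * h * card E \<le> C2 * card E" using C pos by (simp add: mult_le_cancel_left1 mult_right_mono)
        then have "C1 * b \<le> C2 * card E" using True by linarith
        then show "real b / real (card E) \<le> C2 / C1"
          using m pos by (simp add: divide_le_eq le_divide_eq mult.commute)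
      qed simp
      also have "\<dots> = 16 * C2 / (\<rho>\<^sup>2 * C1)" by simp
      finally show ?thesis using pf unfolding eq by (meson order_trans)
    qed
    then show "{t \<in> space ?M. ?P5 t} \<in> S.events" "measure ?M {t \<in> space ?M. ?P5 t} \<le> 16 * C2 / (\<rho>\<^sup>2 * C1)"
      by blast+
  qed
  note d4 = S.prob_disj_le[OF 4 5]
  note d3 = S.prob_disj_le[OF 3 d4]
  note d2 = S.prob_disj_le[OF 2 d3]
  note d1 = S.prob_disj_le[OF 1 d2]
  show "{t \<in> space (start_times \<B>). bad v t} \<in> S.events"
    unfolding bad_def by (rule d1(1))
  have "measure ?M {t \<in> space ?M. bad v t} \<le> real Q * (2 * w / h) + (real (Q * Q) * (4 * h) + (real Q * (4 / C2)
     + (real Q * (2 ^ (3 * k ^ 2) * p ^ (2 * k ^ 2)) + 16 * C2 / (\<rho>\<^sup>2 * C1))))"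
    unfolding bad_def by (rule d1(2))
  then show "measure ?M {t \<in> space ?M. bad v t} \<le> \<beta>" unfolding \<beta>_def by linarith
qed

section \<open>Bias, variance and sampling error of the estimate\<close>

definition straight_of :: "nat \<Rightarrow> (nat set set \<Rightarrow> real) \<Rightarrow> real" where
  "straight_of v t = straight \<rho> (slot_of \<rho> t) (tree v) 0"

definition small_part :: real where
  "small_part = (\<Sum>v<n. if card (component v E) \<le> k then 1 / real (card (component v E)) else 0)"

lemma wf_tree: "v < n \<Longrightarrow> wf_qtree k \<B> (tree v) 0"
proof -
  assume v: "v < n"
  interpret V: batch_tracker n key L k \<Lambda> E \<B> R v by (rule trees[OF v])
  show ?thesis unfolding tree_def using V.wf_mk_tree[OF V.chains.Nil, of "Suc (card \<B>)" "{}"] by simp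
qed

lemma leaf_tree:
  "v < n \<Longrightarrow> straight_leaf (tree v) = (if card (component v E) \<le> k then 1 / real (card (component v E)) else 0)"
proof -
  assume v: "v < n"
  interpret V: batch_tracker n key L k \<Lambda> E \<B> R v by (rule trees[OF v])
  have "k ^ 2 \<le> R" unfolding R_def by simp
  then show ?thesis
    unfolding tree_def V.true_weight_def[symmetric]
    using V.straight_leaf_mk_tree[OF V.chains.Nil, of "Suc (card \<B>)"] by simp
qed

lemma straight_of_bounds: "v < n \<Longrightarrow> 0 \<le> straight_of v t" "v < n \<Longrightarrow> straight_of v t \<le> (1 / \<rho>) ^ k"
proof -
  assume v: "v < n"
  note b = tval_bounds[OF wf_tree[OF v] pos(2,9), of "slot_of \<rho> t"]
  show "0 \<le> straight_of v t" "straight_of v t \<le> (1 / \<rho>) ^ k" using b unfolding straight_of_def by auto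
qed

lemma tree_measurable:
  assumes "v < n"
  shows "(\<lambda>t. tval \<rho> (slot_of \<rho> t) (tree v) 0) \<in> borel_measurable (start_times \<B>)"
    "straight_of v \<in> borel_measurable (start_times \<B>)"
  unfolding straight_of_def[abs_def]
  using tval_measurable straight_measurable wf_qtree_queries[OF wf_tree[OF assms]] by blast+

lemma straight_of_expectation: "v < n \<Longrightarrow> (\<integral>t. straight_of v t \<partial>start_times \<B>) = straight_leaf (tree v)"
  unfolding straight_of_def using tree_expectation(2)[OF pos(2) _ p wf_tree] p_def by (simp add: add.commute)

text \<open>Outside the bad event the weight is the tree value, which exceeds the straight part by
  an amount of small mean. On the bad event both quantities lie between 0 and (1/\<rho>)^k.\<close>

lemma weight_error:
  assumes v: "v < n"
  shows "(\<integral>t. \<bar>weight_of v t - straight_of v t\<bar> \<partial>start_times \<B>)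
    \<le> real k * p * (1 / (1 - p)) ^ k + (1 / \<rho>) ^ k * \<beta>"
proof -
  let ?M = "start_times \<B>" and ?V = "\<lambda>t. tval \<rho> (slot_of \<rho> t) (tree v) 0" and ?c = "(1 / \<rho>) ^ k"
  let ?Bad = "{t \<in> space ?M. bad v t}"
  note [measurable] = weight_of_measurable[of v] tree_measurable[OF v] prob_bad(1)[OF v]
  have V: "straight_of v t \<le> ?V t" "?V t \<le> ?c" for t
    using tval_bounds[OF wf_tree[OF v] pos(2,9), of "slot_of \<rho> t"] unfolding straight_of_def by auto
  have c0: "0 \<le> ?c" using pos by simp
  have i1: "integrable ?M (\<lambda>t. ?V t - straight_of v t)"
    using V straight_of_bounds[OF v] by (intro integrable_bounded[of _ ?c]) (auto simp: abs_le_iff, smt (verit))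
  have i2: "integrable ?M (\<lambda>t. ?c * indicator ?Bad t)"
    using c0 by (intro integrable_bounded[of _ ?c]) (auto simp: indicator_def)
  have i3: "integrable ?M (\<lambda>t. \<bar>weight_of v t - straight_of v t\<bar>)"
  proof (rule integrable_bounded[of _ ?c])
    fix t show "\<bar>\<bar>weight_of v t - straight_of v t\<bar>\<bar> \<le> ?c"
      using weight_of_bounds[of v t] straight_of_bounds[OF v, of t] by linarith
  qed measurable
  have "(\<integral>t. \<bar>weight_of v t - straight_of v t\<bar> \<partial>?M)
      \<le> (\<integral>t. (?V t - straight_of v t) + ?c * indicator ?Bad t \<partial>?M)"
  proof (rule integral_mono_AE[OF i3])
    show "integrable ?M (\<lambda>t. (?V t - straight_of v t) + ?c * indicator ?Bad t)" using i1 i2 by simp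
    show "AE t in ?M. \<bar>weight_of v t - straight_of v t\<bar> \<le> (?V t - straight_of v t) + ?c * indicator ?Bad t"
      using AE_start_times AE_space
    proof eventually_elim
      case (elim t)
      show ?case
      proof (cases "bad v t")
        case True
        have "\<bar>weight_of v t - straight_of v t\<bar> \<le> ?c"
          using weight_of_bounds[of v t] straight_of_bounds[OF v, of t] by linarith
        then show ?thesis using V(1)[of t] True elim by (simp add: indicator_def)
      next
        case False
        then show ?thesis using weight_of_eq_tree[OF v elim(1) False] V(1)[of t] by (simp add: indicator_def)
      qed
    qed
  qed
  also have "\<dots> = (\<integral>t. ?V t - straight_of v t \<partial>?M) + ?c * measure ?M ?Bad"
    using i1 i2 prob_bad(1)[OF v] by (simp add: Int_absorb2 subset_eq)
  also have "\<dots> \<le> real k * p * (1 / (1 - p)) ^ k + ?c * \<beta>"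
  proof (rule add_mono)
    show "(\<integral>t. ?V t - straight_of v t \<partial>?M) \<le> real k * p * (1 / (1 - p)) ^ k"
      unfolding straight_of_def using tree_expectation(3)[OF pos(2) _ p wf_tree[OF v]] p_def
      by (simp add: add.commute)
    show "?c * measure ?M ?Bad \<le> ?c * \<beta>" using prob_bad(2)[OF v] c0 by (intro mult_left_mono) auto
  qed
  finally show ?thesis .
qed

text \<open>In a large component \<open>straight_of v\<close> is identically \<open>0\<close> and
  depends on no time. Setting such vertices apart allows conflicts to be counted through components
  of at most \<open>k\<close> vertices.\<close>

definition dep :: "nat \<Rightarrow> nat set set set" where
  "dep v = (if card (component v E) \<le> k then straight_path (tree v) else {})"

text \<open>\<open>dep v\<close> has at most \<open>k\<close> batches with at most \<open>b\<close>
  edges each. A vertex sharing one of these batches has an edge of it inside its own component, so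
  it is one of at most \<open>k\<close> vertices connected to that edge.\<close>

lemma dep_conflicts:
  assumes v: "v < n"
  shows "card {u \<in> {..<n}. dep v \<inter> dep u \<noteq> {}} \<le> k * b * k"
proof -
  have finB: "finite B" if "B \<in> \<B>" for B
    using that fin partition_onD1[OF part] finite_subset by (metis Union_upper)
  have dB: "dep u \<subseteq> \<B>" if "u < n" for u
    using wf_qtree_queries[OF wf_tree[OF that]] straight_path_queries[of "tree u"] unfolding dep_def by auto
  have fd: "finite (dep v)" "card (dep v) \<le> k"
    using card_straight_path[OF wf_tree[OF v]] unfolding dep_def by auto
  \<comment> \<open>\<open>Min\<close> merely selects an endpoint: both endpoints of an edge have
    the same component.\<close>
  let ?C = "\<lambda>e. if card (component (Min e) E) \<le> k \<and> Min e < n then component (Min e) E else {}"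
  have cC: "card (?C e) \<le> k" "finite (?C e)" for e using finite_comp[OF _ E] by auto
  have sub: "{u \<in> {..<n}. dep v \<inter> dep u \<noteq> {}} \<subseteq> (\<Union>B\<in>dep v. \<Union>e\<in>B. ?C e)"
  proof
    fix u assume "u \<in> {u \<in> {..<n}. dep v \<inter> dep u \<noteq> {}}"
    then obtain B where u: "u < n" and B: "B \<in> dep v" "B \<in> dep u" by blast
    interpret U: batch_tracker n key L k \<Lambda> E \<B> R u by (rule trees[OF u])
    have ck: "card (component u E) \<le> k" and Bp: "B \<in> straight_path (tree u)"
      using B(2) by (auto simp: dep_def split: if_splits)
    then obtain e where e: "B \<in> \<B>" "e \<in> B" "e \<subseteq> component u E"
      using U.straight_path_mk_tree[OF U.chains.Nil] unfolding tree_def by blast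
    then have "e \<in> all_edges n" using U.batch_subset E by blast
    then have "finite e" "e \<noteq> {}" by (auto simp: all_edges_def intro: finite_subset)
    then have "Min e \<in> component u E" using e(3) Min_in by blast
    moreover from this have "Min e < n" using component_subset_vertices[OF u E] by blast
    ultimately have "u \<in> ?C e" using component_eq[of "Min e" u E] ck component_self[of u E] by simp
    then show "u \<in> (\<Union>B\<in>dep v. \<Union>e\<in>B. ?C e)" using B(1) e(2) by blast
  qed
  have finC: "finite (\<Union>e\<in>B. ?C e)" if "B \<in> dep v" for B
    using finB dB[OF v] that cC(2) by (intro finite_UN_I) auto
  have "card {u \<in> {..<n}. dep v \<inter> dep u \<noteq> {}} \<le> card (\<Union>B\<in>dep v. \<Union>e\<in>B. ?C e)"
    by (rule card_mono[OF _ sub]) (use fd finC in blast)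
  also have "\<dots> \<le> (\<Sum>B\<in>dep v. card (\<Union>e\<in>B. ?C e))" by (rule card_UN_le[OF fd(1)])
  also have "\<dots> \<le> (\<Sum>B\<in>dep v. b * k)"
  proof (rule sum_mono)
    fix B assume "B \<in> dep v"
    then have B: "B \<in> \<B>" using dB[OF v] by blast
    have "card (\<Union>e\<in>B. ?C e) \<le> (\<Sum>e\<in>B. card (?C e))" by (rule card_UN_le[OF finB[OF B]])
    also have "\<dots> \<le> (\<Sum>e\<in>B. k)" by (rule sum_mono) (rule cC(1))
    also have "\<dots> \<le> b * k" using card_batch[OF B] by simp
    finally show "card (\<Union>e\<in>B. ?C e) \<le> b * k" .
  qed
  also have "\<dots> \<le> k * (b * k)" using fd(2) by simp
  finally show ?thesis by (simp add: mult.assoc)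
qed

lemma straight_sum_error:
  assumes \<theta>: "0 < \<theta>" and var: "real n * real (k * b * k) * ((1 / \<rho>) ^ k)\<^sup>2 \<le> (\<theta> * real n)\<^sup>2"
  shows "(\<integral>t. \<bar>(\<Sum>v<n. straight_of v t) - small_part\<bar> \<partial>start_times \<B>) \<le> \<theta> * real n"
proof -
  let ?M = "start_times \<B>" and ?c = "(1 / \<rho>) ^ k"
  let ?Y = "\<lambda>t. (\<Sum>v<n. straight_of v t) - small_part"
  have sp: "small_part = (\<Sum>v<n. \<integral>t. straight_of v t \<partial>?M)"
    unfolding small_part_def by (rule sum.cong) (auto simp: straight_of_expectation leaf_tree)
  have m: "?Y \<in> borel_measurable ?M" using tree_measurable(2) by simp
  have "(\<integral>t. ((\<Sum>v<n. straight_of v t) - (\<Sum>v<n. \<integral>t. straight_of v t \<partial>?M))\<^sup>2 \<partial>?M)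
    \<le> real (card {..<n}) * real (k * b * k) * ?c\<^sup>2"
    unfolding start_times_PiM
  proof (rule T.sum_second_moment_le[OF fin(2) finite_lessThan, where D = dep])
    fix v assume "v \<in> {..<n}"
    then have v: "v < n" by simp
    show "straight_of v \<in> borel_measurable (Pi\<^sub>M \<B> (\<lambda>_. unif01))"
      using tree_measurable(2)[OF v] by (simp add: start_times_PiM)
    show "0 \<le> straight_of v t \<and> straight_of v t \<le> ?c" for t using straight_of_bounds[OF v] by blast
    have "dep v \<subseteq> \<B>"
      using wf_qtree_queries[OF wf_tree[OF v]] straight_path_queries[of "tree v"] unfolding dep_def by auto
    moreover have "depends_on (dep v) (straight_of v)"
    proof (cases "card (component v E) \<le> k")
      case True
      then show ?thesis using straight_depends[OF pos(2) _ p, of k "tree v" 0] p_def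
        by (simp add: dep_def straight_of_def[abs_def] add.commute)
    next
      case False
      then have "straight_of v t = 0" for t
        unfolding straight_of_def by (intro straight_zero) (simp add: leaf_tree[OF v])
      then show ?thesis by (simp add: depends_on_def)
    qed
    ultimately show "dep v \<subseteq> \<B> \<and> depends_on (dep v) (straight_of v)" by blast
    show "card {u \<in> {..<n}. dep v \<inter> dep u \<noteq> {}} \<le> k * b * k" by (rule dep_conflicts[OF v])
  qed
  then have "(\<integral>t. (?Y t)\<^sup>2 \<partial>?M) \<le> real n * real (k * b * k) * ?c\<^sup>2" unfolding sp[symmetric] by simp
  then have sq: "(\<integral>t. (?Y t)\<^sup>2 \<partial>?M) \<le> (\<theta> * real n)\<^sup>2" using var by linarith
  have bd: "\<bar>?Y t\<bar> \<le> real n * ?c + \<bar>small_part\<bar>" for t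
  proof -
    have "0 \<le> (\<Sum>v<n. straight_of v t)" by (rule sum_nonneg) (use straight_of_bounds in auto)
    moreover have "(\<Sum>v<n. straight_of v t) \<le> (\<Sum>v<n. ?c)" by (rule sum_mono) (use straight_of_bounds in auto)
    ultimately show ?thesis by simp
  qed
  have i1: "integrable ?M ?Y" by (rule integrable_bounded[OF m bd])
  have i2: "integrable ?M (\<lambda>t. (?Y t)\<^sup>2)"
  proof (rule integrable_bounded[of _ "(real n * ?c + \<bar>small_part\<bar>)\<^sup>2"])
    fix t
    have "\<bar>?Y t\<bar> \<le> \<bar>real n * ?c + \<bar>small_part\<bar>\<bar>" using bd[of t] by linarith
    then have "(?Y t)\<^sup>2 \<le> (real n * ?c + \<bar>small_part\<bar>)\<^sup>2" by (simp only: abs_le_square_iff)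
    then show "\<bar>(?Y t)\<^sup>2\<bar> \<le> (real n * ?c + \<bar>small_part\<bar>)\<^sup>2" by simp
  qed (use m in measurable)
  show ?thesis
    by (rule S.abs_expectation_le_of_square[OF i1 i2 sq]) (use \<theta> n in simp)
qed

text \<open>For fixed times the weight is a function of the vertex, so the trackers average
  independent samples bounded by (1/\<rho>)^k, and their number has to make up for the square of
  this bound.\<close>

lemma sample_error:
  assumes \<theta>: "0 < \<theta>" and s: "1 \<le> s" "((1 / \<rho>) ^ k)\<^sup>2 \<le> real s * \<theta>\<^sup>2"
  shows "measure_pmf.expectation (replicate_pmf s (pmf_of_set {..<n}))
    (\<lambda>vs. \<bar>real n / real s * sum_list (map (\<lambda>v. weight_of v t) vs) - (\<Sum>v<n. weight_of v t)\<bar>) \<le> \<theta> * real n"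
proof -
  let ?p = "pmf_of_set {..<n}" and ?F = "\<Sum>v<n. weight_of v t" and ?c = "(1 / \<rho>) ^ k"
  let ?R = "replicate_pmf s ?p"
  have ne: "{..<n} \<noteq> {}" using n by (auto simp: lessThan_empty_iff)
  have setp: "set_pmf ?p = {..<n}" using ne by simp
  define g where "g v = weight_of v t - ?F / n" for v
  have F: "0 \<le> ?F / n" "?F / n \<le> ?c"
  proof -
    show "0 \<le> ?F / n" by (intro divide_nonneg_nonneg sum_nonneg weight_of_bounds) simp
    have "?F \<le> (\<Sum>v<n. ?c)" by (rule sum_mono) (rule weight_of_bounds)
    then show "?F / n \<le> ?c" using n by (simp add: divide_le_eq mult.commute)
  qed
  have mean: "measure_pmf.expectation ?p g = 0"
    using n ne by (subst integral_pmf_of_set) (auto simp: g_def sum_subtractf)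
  have gc: "\<bar>g v\<bar> \<le> ?c" for v using F weight_of_bounds[of v t] unfolding g_def by linarith
  have finp: "finite (set_pmf ?p)" unfolding setp by simp
  note sm = replicate_pmf_second_moment[OF finp mean gc, of s]
  have finR: "finite (set_pmf ?R)"
    using finite_lists_length_eq[OF finp] by (simp add: set_replicate_pmf lists_eq_set conj_commute)
  have eq: "real n / real s * sum_list (map (\<lambda>v. weight_of v t) vs) - ?F = real n / real s * sum_list (map g vs)"
    if "vs \<in> set_pmf ?R" for vs
  proof -
    have len: "length vs = s" using that by (simp add: set_replicate_pmf)
    have "sum_list (map g vs) = sum_list (map (\<lambda>v. weight_of v t) vs) - real (length vs) * (?F / n)"
    proof -
      have "sum_list (map (\<lambda>v. weight_of v t - y) vs) = sum_list (map (\<lambda>v. weight_of v t) vs) - real (length vs) * y"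
        for y vs by (induction vs) (auto simp: algebra_simps)
      then show ?thesis unfolding g_def .
    qed
    then show ?thesis using len s(1) n by (simp add: right_diff_distrib)
  qed
  have "measure_pmf.expectation ?R
    (\<lambda>vs. \<bar>real n / real s * sum_list (map (\<lambda>v. weight_of v t) vs) - ?F\<bar>)
      = measure_pmf.expectation ?R (\<lambda>vs. \<bar>real n / real s * sum_list (map g vs)\<bar>)"
    by (rule integral_cong_AE) (simp, simp, rule AE_pmfI, simp only: eq)
  also have "\<dots> \<le> \<theta> * real n"
  proof (rule measure_pmf.abs_expectation_le_of_square)
    have "measure_pmf.expectation ?R (\<lambda>vs. (real n / real s * sum_list (map g vs))\<^sup>2)
        = (real n / real s)\<^sup>2 * measure_pmf.expectation ?R (\<lambda>vs. (sum_list (map g vs))\<^sup>2)"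
      unfolding power_mult_distrib by (rule integral_mult_right_zero)
    also have "\<dots> \<le> (real n / real s)\<^sup>2 * (real s * ?c\<^sup>2)"
      using sm by (intro mult_left_mono) auto
    also have "\<dots> = (real n)\<^sup>2 * (?c\<^sup>2 / real s)" using s(1) by (simp add: power2_eq_square)
    also have "\<dots> \<le> (real n)\<^sup>2 * \<theta>\<^sup>2"
      using s by (intro mult_left_mono) (auto simp: divide_le_eq mult.commute)
    finally show "measure_pmf.expectation ?R (\<lambda>vs. (real n / real s * sum_list (map g vs))\<^sup>2) \<le> (\<theta> * real n)\<^sup>2"
      by (simp add: power_mult_distrib mult.commute)
  qed (use \<theta> n finR in \<open>auto intro: integrable_measure_pmf_finite\<close>)
  finally show ?thesis .
qed

text \<open>A vertex that is left out would contribute less than 1 / k \<le> \<epsilon> / 4.\<close>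

lemma small_part_close:
  assumes "4 \<le> \<epsilon> * real k"
  shows "\<bar>small_part - real (num_components n E)\<bar> \<le> \<epsilon> * real n / 4"
proof -
  have e: "1 / real k \<le> \<epsilon> / 4" using assms k by (simp add: field_simps)
  have "real (num_components n E) - small_part
      = (\<Sum>v<n. 1 / real (card (component v E)) - (if card (component v E) \<le> k then 1 / real (card (component v E)) else 0))"
    unfolding num_components_eq_sum[OF E] small_part_def by (simp add: sum_subtractf)
  also have "\<dots> = (\<Sum>v<n. if card (component v E) \<le> k then 0 else 1 / real (card (component v E)))"
    by (rule sum.cong) auto
  finally have eq: "real (num_components n E) - small_part
      = (\<Sum>v<n. if card (component v E) \<le> k then 0 else 1 / real (card (component v E)))" .
  have "(\<Sum>v<n. if card (component v E) \<le> k then 0 else 1 / real (card (component v E))) \<le> (\<Sum>v<n. \<epsilon> / 4)"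
  proof (rule sum_mono)
    fix v
    have "1 / real (card (component v E)) \<le> 1 / real k" if "\<not> card (component v E) \<le> k"
      using that k by (intro divide_left_mono) auto
    moreover have "0 \<le> 1 / real k" by simp
    then have "0 \<le> \<epsilon> / 4" using e by linarith
    ultimately show "(if card (component v E) \<le> k then 0 else 1 / real (card (component v E))) \<le> \<epsilon> / 4"
      using e by auto
  qed
  moreover have "0 \<le> (\<Sum>v<n. if card (component v E) \<le> k then 0 else 1 / real (card (component v E)))"
    by (rule sum_nonneg) simp
  moreover have "(\<Sum>v<n. \<epsilon> / 4) = \<epsilon> * real n / 4" by simp
  ultimately show ?thesis using eq by linarith
qed

text \<open>Errors are added in mean absolute value: \<theta> n for the sampling, 2 \<theta> n for
  the difference between weights and straight parts, \<theta> n for the fluctuation of the straight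
  sum. Leaving out large components takes \<epsilon> n / 4, and Markov's inequality against the
  remaining 3 \<epsilon> n / 4 bounds the failure probability by 16 \<theta> / (3 \<epsilon>) \<le>
  \<delta>.\<close>

theorem estimate_accuracy:
  assumes \<epsilon>: "0 < \<epsilon>" "4 \<le> \<epsilon> * real k" and \<theta>: "0 < \<theta>" "16 * \<theta> \<le> 3 * \<epsilon> * \<delta>"
    and s: "1 \<le> s" "((1 / \<rho>) ^ k)\<^sup>2 \<le> real s * \<theta>\<^sup>2"
    and var: "real n * real (k * b * k) * ((1 / \<rho>) ^ k)\<^sup>2 \<le> (\<theta> * real n)\<^sup>2"
    and false: "real k * p * (1 / (1 - p)) ^ k \<le> \<theta>" and bad: "(1 / \<rho>) ^ k * \<beta> \<le> \<theta>"
    and f: "f \<in> start_times \<B> \<rightarrow>\<^sub>M subprob_algebra (count_space UNIV)"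
    and feq: "\<And>t. t \<in> box \<Longrightarrow> f t = measure_pmf (map_pmf
        (\<lambda>vs. real n / real s * sum_list (map (\<lambda>v. weight_of v t) vs)) (replicate_pmf s (pmf_of_set {..<n})))"
  shows "1 - \<delta> \<le> measure (start_times \<B> \<bind> f) {c. \<bar>c - real (num_components n E)\<bar> \<le> \<epsilon> * real n}"
proof -
  let ?M = "start_times \<B>" and ?cc = "real (num_components n E)" and ?R = "replicate_pmf s (pmf_of_set {..<n})"
  let ?A = "{c. \<bar>c - ?cc\<bar> \<le> \<epsilon> * real n}" and ?F = "\<lambda>t. \<Sum>v<n. weight_of v t"
  let ?a = "3 / 4 * (\<epsilon> * real n)"
  have a0: "0 < ?a" using \<epsilon> n by simp
  have setp: "set_pmf (pmf_of_set {..<n}) = {..<n}" using n by (intro set_pmf_of_set) (auto simp: lessThan_empty_iff)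
  have finR: "finite (set_pmf ?R)"
    using finite_lists_length_eq[of "{..<n}" s] by (simp add: set_replicate_pmf lists_eq_set conj_commute setp)
  have int: "integrable (measure_pmf ?R) h" for h :: "_ \<Rightarrow> real"
    by (rule integrable_measure_pmf_finite[OF finR])
  have point: "1 - (\<theta> * n + \<bar>?F t - small_part\<bar>) / ?a \<le> measure (f t) ?A" if t: "t \<in> box" for t
  proof -
    have tri: "\<bar>x - z\<bar> \<le> \<bar>x - y\<bar> + \<bar>y - z\<bar>" for x y z :: real by linarith
    have far: "3 / 4 * e \<le> \<bar>z - y\<bar>" if "\<not> \<bar>z - c\<bar> \<le> e" "\<bar>y - c\<bar> \<le> e / 4" for z y c e :: real
      using that by linarith
    let ?Z = "\<lambda>vs. real n / real s * sum_list (map (\<lambda>v. weight_of v t) vs)"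
    have "{vs. \<not> \<bar>?Z vs - ?cc\<bar> \<le> \<epsilon> * real n} \<subseteq> {vs. ?a \<le> \<bar>?Z vs - small_part\<bar>}"
    proof (intro subsetI CollectI)
      fix vs assume "vs \<in> {vs. \<not> \<bar>?Z vs - ?cc\<bar> \<le> \<epsilon> * real n}"
      then have "\<not> \<bar>?Z vs - ?cc\<bar> \<le> \<epsilon> * real n" by (rule CollectD)
      then show "?a \<le> \<bar>?Z vs - small_part\<bar>" by (rule far[OF _ small_part_close[OF \<epsilon>(2)]])
    qed
    then have "measure_pmf.prob ?R {vs. \<not> \<bar>?Z vs - ?cc\<bar> \<le> \<epsilon> * real n}
        \<le> measure_pmf.prob ?R {vs. ?a \<le> \<bar>?Z vs - small_part\<bar>}"
      by (intro measure_pmf.finite_measure_mono) auto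
    also have "\<dots> \<le> measure_pmf.expectation ?R (\<lambda>vs. \<bar>?Z vs - small_part\<bar>) / ?a"
      using integral_Markov_inequality_measure[OF int sets.empty_sets _ a0, of "\<lambda>vs. \<bar>?Z vs - small_part\<bar>"] by simp
    also have "\<dots> \<le> (\<theta> * n + \<bar>?F t - small_part\<bar>) / ?a"
    proof (rule divide_right_mono)
      have "measure_pmf.expectation ?R (\<lambda>vs. \<bar>?Z vs - small_part\<bar>)
          \<le> measure_pmf.expectation ?R (\<lambda>vs. \<bar>?Z vs - ?F t\<bar> + \<bar>?F t - small_part\<bar>)"
        by (rule integral_mono[OF int int]) (rule tri)
      also have "\<dots> = measure_pmf.expectation ?R (\<lambda>vs. \<bar>?Z vs - ?F t\<bar>) + \<bar>?F t - small_part\<bar>"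
        using int by (simp add: measure_pmf.prob_space)
      finally show "measure_pmf.expectation ?R (\<lambda>vs. \<bar>?Z vs - small_part\<bar>) \<le> \<theta> * n + \<bar>?F t - small_part\<bar>"
        using sample_error[OF \<theta>(1) s, of t] by linarith
    qed (use a0 in simp)
    finally have le: "measure_pmf.prob ?R {vs. \<not> \<bar>?Z vs - ?cc\<bar> \<le> \<epsilon> * real n} \<le> (\<theta> * n + \<bar>?F t - small_part\<bar>) / ?a" .
    have "measure (f t) ?A = measure_pmf.prob ?R {vs. \<bar>?Z vs - ?cc\<bar> \<le> \<epsilon> * real n}"
      unfolding feq[OF t] by (simp add: vimage_def)
    also have "\<dots> = 1 - measure_pmf.prob ?R {vs. \<not> \<bar>?Z vs - ?cc\<bar> \<le> \<epsilon> * real n}"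
      using measure_pmf.prob_compl[of "{vs. \<not> \<bar>?Z vs - ?cc\<bar> \<le> \<epsilon> * real n}" ?R]
      by (simp add: Compl_eq_Diff_UNIV[symmetric] Collect_neg_eq[symmetric])
    finally show ?thesis using le by linarith
  qed
  have [measurable]: "weight_of v \<in> borel_measurable ?M" for v by (rule weight_of_measurable)
  have iF: "integrable ?M (\<lambda>t. \<bar>?F t - small_part\<bar>)"
  proof (rule integrable_bounded[of _ "real n * (1 / \<rho>) ^ k + \<bar>small_part\<bar>"])
    fix t
    have "0 \<le> ?F t" by (rule sum_nonneg) (rule weight_of_bounds)
    moreover have "?F t \<le> (\<Sum>v<n. (1 / \<rho>) ^ k)" by (rule sum_mono) (rule weight_of_bounds)
    moreover have "(\<Sum>v<n. (1 / \<rho>) ^ k) = real n * (1 / \<rho>) ^ k" by simp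
    ultimately show "\<bar>\<bar>?F t - small_part\<bar>\<bar> \<le> real n * (1 / \<rho>) ^ k + \<bar>small_part\<bar>" by linarith
  qed measurable
  have iE: "integrable ?M (\<lambda>t. \<bar>weight_of v t - straight_of v t\<bar>)" if "v < n" for v
  proof (rule integrable_bounded[of _ "(1 / \<rho>) ^ k"])
    fix t show "\<bar>\<bar>weight_of v t - straight_of v t\<bar>\<bar> \<le> (1 / \<rho>) ^ k"
      using weight_of_bounds[of v t] straight_of_bounds[OF that, of t] by linarith
  qed (use tree_measurable(2)[OF that] in measurable)
  have iS: "integrable ?M (\<lambda>t. \<bar>(\<Sum>v<n. straight_of v t) - small_part\<bar>)"
  proof (rule integrable_bounded[of _ "real n * (1 / \<rho>) ^ k + \<bar>small_part\<bar>"])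
    fix t
    have "0 \<le> (\<Sum>v<n. straight_of v t)" by (rule sum_nonneg) (use straight_of_bounds in auto)
    moreover have "(\<Sum>v<n. straight_of v t) \<le> (\<Sum>v<n. (1 / \<rho>) ^ k)"
      by (rule sum_mono) (use straight_of_bounds in auto)
    moreover have "(\<Sum>v<n. (1 / \<rho>) ^ k) = real n * (1 / \<rho>) ^ k" by simp
    ultimately show "\<bar>\<bar>(\<Sum>v<n. straight_of v t) - small_part\<bar>\<bar> \<le> real n * (1 / \<rho>) ^ k + \<bar>small_part\<bar>"
      by linarith
  qed (use tree_measurable(2) in simp)
  have EF: "(\<integral>t. \<bar>?F t - small_part\<bar> \<partial>?M) \<le> 3 * \<theta> * n"
  proof -
    have "(\<integral>t. \<bar>?F t - small_part\<bar> \<partial>?M)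
        \<le> (\<integral>t. (\<Sum>v<n. \<bar>weight_of v t - straight_of v t\<bar>) + \<bar>(\<Sum>v<n. straight_of v t) - small_part\<bar> \<partial>?M)"
    proof (rule integral_mono[OF iF])
      show "integrable ?M (\<lambda>t. (\<Sum>v<n. \<bar>weight_of v t - straight_of v t\<bar>) + \<bar>(\<Sum>v<n. straight_of v t) - small_part\<bar>)"
        using iE iS by (intro Bochner_Integration.integrable_add Bochner_Integration.integrable_sum) auto
      fix t
      have "?F t - (\<Sum>v<n. straight_of v t) = (\<Sum>v<n. weight_of v t - straight_of v t)"
        by (simp add: sum_subtractf)
      then have "\<bar>?F t - (\<Sum>v<n. straight_of v t)\<bar> \<le> (\<Sum>v<n. \<bar>weight_of v t - straight_of v t\<bar>)"
        by (simp only: sum_abs)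
      then show "\<bar>?F t - small_part\<bar>
          \<le> (\<Sum>v<n. \<bar>weight_of v t - straight_of v t\<bar>) + \<bar>(\<Sum>v<n. straight_of v t) - small_part\<bar>"
        by linarith
    qed
    also have "\<dots> = (\<Sum>v<n. \<integral>t. \<bar>weight_of v t - straight_of v t\<bar> \<partial>?M)
        + (\<integral>t. \<bar>(\<Sum>v<n. straight_of v t) - small_part\<bar> \<partial>?M)"
      using iE iS by (subst Bochner_Integration.integral_add)
        (auto intro!: Bochner_Integration.integrable_sum Bochner_Integration.integral_sum)
    also have "\<dots> \<le> (\<Sum>v<n. 2 * \<theta>) + \<theta> * n"
    proof (rule add_mono[OF sum_mono])
      fix v assume "v \<in> {..<n}"
      then show "(\<integral>t. \<bar>weight_of v t - straight_of v t\<bar> \<partial>?M) \<le> 2 * \<theta>"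
        using weight_error[of v] false bad by simp
    qed (rule straight_sum_error[OF \<theta>(1) var])
    also have "\<dots> = 3 * \<theta> * n" by simp
    finally show ?thesis .
  qed
  have "1 - \<delta> \<le> 1 - (\<theta> * n + 3 * \<theta> * n) / ?a"
  proof -
    have "(\<theta> * n + 3 * \<theta> * n) / ?a \<le> \<delta>"
      using \<theta>(2) a0 n \<epsilon> by (simp add: divide_le_eq) (simp add: field_simps)
    then show ?thesis by linarith
  qed
  also have "\<dots> \<le> 1 - (\<theta> * n + (\<integral>t. \<bar>?F t - small_part\<bar> \<partial>?M)) / ?a"
    using EF a0 by (intro diff_left_mono divide_right_mono) auto
  also have "\<dots> = (\<integral>t. 1 - (\<theta> * n + \<bar>?F t - small_part\<bar>) / ?a \<partial>?M)"
    using iF by (simp add: S.prob_space)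
  also have "\<dots> \<le> (\<integral>t. measure (f t) ?A \<partial>?M)"
  proof (rule integral_mono_AE)
    show "integrable ?M (\<lambda>t. 1 - (\<theta> * n + \<bar>?F t - small_part\<bar>) / ?a)" using iF by simp
    have "(\<lambda>t. measure (f t) ?A) \<in> borel_measurable ?M"
      by (rule measurable_compose[OF f measurable_measure_subprob_algebra]) simp
    moreover have "AE t in ?M. \<bar>measure (f t) ?A\<bar> \<le> 1"
      using AE_space
    proof eventually_elim
      case (elim t)
      then have "f t \<in> space (subprob_algebra (count_space UNIV))" using f by (simp add: measurable_space)
      then interpret F: subprob_space "f t" by (simp add: space_subprob_algebra)
      show ?case using F.subprob_measure_le_1[of ?A] by simp
    qed
    ultimately show "integrable ?M (\<lambda>t. measure (f t) ?A)"
      by (intro S.integrable_const_bound[of _ 1]) auto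
    show "AE t in ?M. 1 - (\<theta> * n + \<bar>?F t - small_part\<bar>) / ?a \<le> measure (f t) ?A"
      using AE_start_times by eventually_elim (rule point)
  qed
  also have "\<dots> = measure (?M \<bind> f) ?A"
    using S.measure_bind[OF f, of ?A] by simp
  finally show ?thesis .
qed

end

section \<open>Memory of the trackers\<close>

context tracker
begin

text \<open>Each level chooses at most one cell, which together with the current one leaves
  \<open>k + 1\<close> cells. The cap is monotone in the count, so older cells stay within
  it.\<close>

lemma step_retained:
  assumes propr: "proper (insert (e, c) r)" and mono: "mono \<Lambda>"
    and cells: "\<And>c. card {e. (e, c) \<in> r} \<le> \<Lambda> cnt" "cnt \<le> cnt'" and slots: "\<forall>(e, c)\<in>r. c div L \<le> k"
    and r': "r' = prune v c (add_item cnt r (e, c))"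
  shows "r' \<subseteq> insert (e, c) r" "card {e. (e, c') \<in> r'} \<le> \<Lambda> cnt'" "card (snd ` r') \<le> k + 1"
    "\<forall>(e, c)\<in>r'. c div L \<le> k"
proof -
  let ?r = "add_item cnt r (e, c)"
  have sub: "r' \<subseteq> ?r" "?r \<subseteq> insert (e, c) r" by (auto simp: r' prune_def add_item_def)
  then show "r' \<subseteq> insert (e, c) r" by blast
  have pr: "proper ?r" by (rule proper_mono[OF propr sub(2)])
  show "\<forall>(e, c)\<in>r'. c div L \<le> k" using sub(1) slots by (auto simp: add_item_def split: if_splits)
  have finr: "finite ?r" using pr by (simp add: proper_def)
  have fin1: "finite {e. (e, c') \<in> ?r}"
    by (rule finite_subset[of _ "fst ` ?r"]) (use finr in \<open>force+\<close>)
  have "finite r" using propr by (simp add: proper_def)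
  then have fin0: "finite {e. (e, c) \<in> r}"
    by (intro finite_subset[of "{e. (e, c) \<in> r}" "fst ` r"]) force+
  have "card {e. (e, c') \<in> r'} \<le> card {e. (e, c') \<in> ?r}"
    by (rule card_mono[OF fin1]) (use sub in blast)
  also have "\<dots> \<le> \<Lambda> cnt"
  proof (cases "c' = c \<and> ?r \<noteq> r")
    case True
    then have lt: "card {e. (e, c) \<in> r} < \<Lambda> cnt" and eq: "?r = insert (e, c) r"
      by (auto simp: add_item_def split: if_splits)
    have "{e'. (e', c') \<in> ?r} = insert e {e'. (e', c) \<in> r}" using True unfolding eq by auto
    then show ?thesis using lt card_insert_le_m1[of "\<Lambda> cnt" "{e'. (e', c) \<in> r}" e] by simp
  next
    case False
    then have "{e'. (e', c') \<in> ?r} = {e'. (e', c') \<in> r}" by (auto simp: add_item_def split: if_splits)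
    then show ?thesis using cells(1) by simp
  qed
  also have "\<dots> \<le> \<Lambda> cnt'" by (rule monoD[OF mono cells(2)])
  finally show "card {e. (e, c') \<in> r'} \<le> \<Lambda> cnt'" .
  define g where "g j = snd (SOME q. best (grown v ?r j) ?r j q)" for j
  have "snd ` r' \<subseteq> insert c (g ` {..<k})"
  proof
    fix c1 assume "c1 \<in> snd ` r'"
    then obtain e1 where "(e1, c1) \<in> r'" by auto
    then consider "c1 = c" | j e2 where "j < k" "best (grown v ?r j) ?r j (e2, c1)"
      unfolding r' prune_def by blast
    then show "c1 \<in> insert c (g ` {..<k})"
    proof cases
      case 2
      then have "best (grown v ?r j) ?r j (SOME q. best (grown v ?r j) ?r j q)" by (rule_tac someI)
      then have "(SOME q. best (grown v ?r j) ?r j q) = (e2, c1)" using best_unique[OF pr] 2(2) by blast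
      then have "g j = c1" by (simp add: g_def)
      then show ?thesis using 2(1) by blast
    qed simp
  qed
  then have "card (snd ` r') \<le> card (insert c (g ` {..<k}))" by (intro card_mono) auto
  also have "\<dots> \<le> k + 1"
    using card_image_le[of "{..<k}" g] card_insert_le_m1[of "k + 1" "g ` {..<k}" c] by simp
  finally show "card (snd ` r') \<le> k + 1" .
qed

lemma foldl_retained:
  assumes mono: "mono \<Lambda>" and dist: "distinct (map fst us)" and E: "fst ` set us \<subseteq> all_edges n"
    and st: "foldl step (v, 0, False, {}) us = (v', cnt, dead, r)"
  shows "v' = v" "cnt \<le> length us" "r \<subseteq> set us" "card r \<le> (k + 1) * \<Lambda> cnt" "\<forall>(e, c)\<in>r. c div L \<le> k"
proof -
  have "v' = v \<and> cnt \<le> length us \<and> r \<subseteq> set us \<and> (\<forall>c. card {e. (e, c) \<in> r} \<le> \<Lambda> cnt) \<and>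
    card (snd ` r) \<le> k + 1 \<and> (\<forall>(e, c)\<in>r. c div L \<le> k)"
    using dist E st
  proof (induction us arbitrary: v' cnt dead r rule: rev_induct)
    case (snoc u us)
    obtain e c where u: "u = (e, c)" by (cases u)
    obtain v0 cnt0 dead0 r0 where st0: "foldl step (v, 0, False, {}) us = (v0, cnt0, dead0, r0)"
      by (cases "foldl step (v, 0, False, {}) us")
    have IH: "v0 = v" "cnt0 \<le> length us" "r0 \<subseteq> set us" "\<And>c. card {e. (e, c) \<in> r0} \<le> \<Lambda> cnt0"
      "\<forall>(e, c)\<in>r0. c div L \<le> k"
      using snoc.IH[OF _ _ st0] snoc.prems by auto
    have s: "v' = v0" "cnt = (if c div L = 0 then cnt0 + 1 else cnt0)" "r = prune v0 c (add_item cnt0 r0 (e, c))"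
      using snoc.prems(3) st0 u by auto
    have "proper (set (us @ [u]))"
      using snoc.prems(1,2) distinct_map[of fst "us @ [u]"] by (auto simp: proper_def)
    then have pr: "proper (insert (e, c) r0)" by (rule proper_mono) (use IH(3) u in auto)
    have le: "cnt0 \<le> cnt" using s(2) by simp
    note R = step_retained[OF pr mono IH(4) le IH(5) s(3)]
    have "r \<subseteq> set (us @ [u])" using R(1) IH(3) u by auto
    moreover have "cnt \<le> length (us @ [u])" using s(2) IH(2) by simp
    ultimately show ?case using s(1) IH(1) R(2,3,4) by blast
  qed auto
  then have *: "v' = v" "cnt \<le> length us" "r \<subseteq> set us" "\<And>c. card {e. (e, c) \<in> r} \<le> \<Lambda> cnt"
    "card (snd ` r) \<le> k + 1" "\<forall>(e, c)\<in>r. c div L \<le> k" by auto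
  then show "v' = v" "cnt \<le> length us" "r \<subseteq> set us" "\<forall>(e, c)\<in>r. c div L \<le> k" by blast+
  have fin: "finite r" by (rule finite_subset[OF *(3)]) simp
  have cellcard: "card {p \<in> r. snd p = c} \<le> \<Lambda> cnt" for c
  proof -
    have "card {p \<in> r. snd p = c} \<le> card {e. (e, c) \<in> r}"
    proof (rule card_inj_on_le[of fst])
      show "finite {e. (e, c) \<in> r}" by (rule finite_subset[of _ "fst ` r"]) (use fin in \<open>force+\<close>)
    qed (auto simp: inj_on_def)
    then show ?thesis using *(4) order_trans by blast
  qed
  have "r = (\<Union>c\<in>snd ` r. {p \<in> r. snd p = c})" by auto
  then have "card r \<le> (\<Sum>c\<in>snd ` r. card {p \<in> r. snd p = c})"
    using card_UN_le[of "snd ` r" "\<lambda>c. {p \<in> r. snd p = c}"] fin by simp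
  also have "\<dots> \<le> (\<Sum>c\<in>snd ` r. \<Lambda> cnt)" by (rule sum_mono) (rule cellcard)
  also have "\<dots> \<le> (k + 1) * \<Lambda> cnt" using *(5) by (simp only: sum_constant of_nat_id mult_le_mono1)
  finally show "card r \<le> (k + 1) * \<Lambda> cnt" .
qed

end

text \<open>A list of tracker states is stored as a set of letters; a letter carries the index of its tracker
  and a tag for the component of the state that it describes.\<close>

definition letters :: "(nat set \<Rightarrow> nat) \<Rightarrow> nat \<Rightarrow> nat \<times> nat \<times> bool \<times> (nat set \<times> nat) set
    \<Rightarrow> (nat \<times> nat \<times> nat \<times> nat) set" where
  "letters key i = (\<lambda>(v, cnt, dead, r). {(i, 0, v, 0), (i, 1, cnt, 0)} \<union> (if dead then {(i, 2, 0, 0)} else {})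
     \<union> (\<lambda>(e, c). (i, 3, key e, c)) ` r)"

definition all_letters :: "(nat set \<Rightarrow> nat) \<Rightarrow> (nat \<times> nat \<times> bool \<times> (nat set \<times> nat) set) list
    \<Rightarrow> (nat \<times> nat \<times> nat \<times> nat) set" where
  "all_letters key ts = (\<Union>i<length ts. letters key i (ts ! i))"

definition storable :: "nat \<Rightarrow> nat \<Rightarrow> nat \<Rightarrow> (nat \<times> nat \<times> bool \<times> (nat set \<times> nat) set) list set" where
  "storable n s M = {ts. length ts = s \<and> (\<forall>(v, cnt, dead, r)\<in>set ts. v \<le> n ^ 2 \<and> cnt \<le> n ^ 2 \<and>
     finite r \<and> r \<subseteq> all_edges n \<times> {..M})}"

lemma letters_index: "(i, y) \<in> letters key j T \<Longrightarrow> i = j"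
  by (auto simp: letters_def split: prod.splits if_splits)

lemma all_letters_nth: "i < length ts \<Longrightarrow> (i, y) \<in> all_letters key ts \<longleftrightarrow> (i, y) \<in> letters key i (ts ! i)"
  unfolding all_letters_def using letters_index by blast

lemma letters_eqD:
  assumes eq: "letters key i (v, cnt, dead, r) = letters key i (v', cnt', dead', r')"
    and key: "inj_on key (all_edges n)" and r: "r \<subseteq> all_edges n \<times> C" "r' \<subseteq> all_edges n \<times> C"
  shows "(v, cnt, dead, r) = (v', cnt', dead', r')"
proof -
  have m: "y \<in> letters key i (v, cnt, dead, r) \<longleftrightarrow> y \<in> letters key i (v', cnt', dead', r')" for y
    using eq by simp
  have "v = v'" using m[of "(i, 0, v, 0)"] by (auto simp: letters_def split: if_splits)
  moreover have "cnt = cnt'" using m[of "(i, 1, cnt, 0)"] by (auto simp: letters_def split: if_splits)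
  moreover have "dead = dead'" using m[of "(i, 2, 0, 0)"] by (auto simp: letters_def split: if_splits)
  moreover have "(\<lambda>(e, c). (key e, c)) ` r = (\<lambda>(e, c). (key e, c)) ` r'"
  proof -
    have im: "(\<lambda>(e, c). (key e, c)) ` r0 = {y. (i, 3, y) \<in> letters key i (v0, cnt0, dead0, r0)}"
      for r0 v0 cnt0 dead0
    proof (intro equalityI subsetI)
      fix y assume "y \<in> (\<lambda>(e, c). (key e, c)) ` r0"
      then obtain e c where "(e, c) \<in> r0" "y = (key e, c)" by auto
      then show "y \<in> {y. (i, 3, y) \<in> letters key i (v0, cnt0, dead0, r0)}"
        by (force simp: letters_def)
    next
      fix y assume "y \<in> {y. (i, 3, y) \<in> letters key i (v0, cnt0, dead0, r0)}"
      then have "(i, 3, y) \<in> (\<lambda>(e, c). (i, 3, key e, c)) ` r0"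
        by (auto simp: letters_def split: if_splits)
      then obtain e c where "(e, c) \<in> r0" "y = (key e, c)" by auto
      then show "y \<in> (\<lambda>(e, c). (key e, c)) ` r0" by force
    qed
    show ?thesis unfolding im[of r v cnt dead] im[of r' v' cnt' dead'] eq ..
  qed
  then have "r = r'"
    using inj_on_image_eq_iff[of "\<lambda>(e, c). (key e, c)" "all_edges n \<times> C" r r'] r key
    by (auto simp: inj_on_def)
  ultimately show ?thesis by simp
qed

lemma inj_on_all_letters:
  assumes "inj_on key (all_edges n)" shows "inj_on (all_letters key) (storable n s M)"
proof (rule inj_onI)
  fix ts ts' assume ts: "ts \<in> storable n s M" "ts' \<in> storable n s M" and eq: "all_letters key ts = all_letters key ts'"
  then have len: "length ts = s" "length ts' = s" by (auto simp: storable_def)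
  show "ts = ts'"
  proof (rule nth_equalityI)
    show "length ts = length ts'" using len by simp
    fix i assume i: "i < length ts"
    have "letters key i (ts ! i) = letters key i (ts' ! i)"
    proof (rule set_eqI)
      fix z :: "nat \<times> nat \<times> nat \<times> nat"
      obtain j y where z: "z = (j, y)" by (cases z)
      show "z \<in> letters key i (ts ! i) \<longleftrightarrow> z \<in> letters key i (ts' ! i)"
      proof (cases "j = i")
        case True
        then show ?thesis using all_letters_nth[of i ts y key] all_letters_nth[of i ts' y key] i len eq z by simp
      next
        case False
        then show ?thesis using letters_index z by blast
      qed
    qed
    moreover obtain v cnt dead r where T: "ts ! i = (v, cnt, dead, r)" by (cases "ts ! i")
    moreover obtain v' cnt' dead' r' where T': "ts' ! i = (v', cnt', dead', r')" by (cases "ts' ! i")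
    moreover have "ts ! i \<in> set ts" "ts' ! i \<in> set ts'" using i len by auto
    then have "r \<subseteq> all_edges n \<times> {..M}" "r' \<subseteq> all_edges n \<times> {..M}" using ts T T' by (auto simp: storable_def)
    ultimately show "ts ! i = ts' ! i" using letters_eqD[OF _ assms] by metis
  qed
qed

lemma card_letters: "finite r \<Longrightarrow> card (letters key i (v, cnt, dead, r)) \<le> 3 + card r"
proof -
  assume r: "finite r"
  have "card (letters key i (v, cnt, dead, r)) \<le> card ({(i, 0, v, 0), (i, 1, cnt, 0)} \<union> (if dead then {(i, 2, 0, 0)} else {})
       :: (nat \<times> nat \<times> nat \<times> nat) set)
     + card ((\<lambda>(e, c). (i, 3::nat, key e, c)) ` r)"
    unfolding letters_def prod.case by (rule card_Un_le)
  also have "\<dots> \<le> 3 + card r" using card_image_le[OF r, of "\<lambda>(e, c). (i, 3::nat, key e, c)"]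
    by (intro add_mono) (auto simp: card_insert_if)
  finally show ?thesis .
qed

lemma storable_alphabet:
  assumes key: "key ` all_edges n \<subseteq> {..<n ^ 2}" and ts: "ts \<in> storable n s M"
  shows "all_letters key ts \<subseteq> {..<s} \<times> {..<4} \<times> {..n ^ 2} \<times> {..M}"
proof
  fix z assume "z \<in> all_letters key ts"
  then obtain i where i: "i < length ts" "z \<in> letters key i (ts ! i)" by (auto simp: all_letters_def)
  obtain v cnt dead r where T: "ts ! i = (v, cnt, dead, r)" by (cases "ts ! i")
  have "ts ! i \<in> set ts" using i by simp
  then have b: "v \<le> n ^ 2" "cnt \<le> n ^ 2" "r \<subseteq> all_edges n \<times> {..M}" "i < s" using ts T i by (auto simp: storable_def)
  have "key e \<le> n ^ 2 \<and> c \<le> M" if "(e, c) \<in> r" for e c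
  proof -
    have "e \<in> all_edges n" "c \<le> M" using that b(3) by auto
    moreover from this have "key e < n ^ 2" using key by blast
    ultimately show ?thesis by simp
  qed
  then show "z \<in> {..<s} \<times> {..<4} \<times> {..n ^ 2} \<times> {..M}"
    using i(2) T b by (auto simp: letters_def split: if_splits)
qed

lemma card_all_letters:
  assumes "\<And>T. T \<in> set ts \<Longrightarrow> finite (snd (snd (snd T))) \<and> card (snd (snd (snd T))) \<le> m"
  shows "card (all_letters key ts) \<le> length ts * (3 + m)"
proof -
  have "card (all_letters key ts) \<le> (\<Sum>i<length ts. card (letters key i (ts ! i)))"
    unfolding all_letters_def by (rule card_UN_le) simp
  also have "\<dots> \<le> (\<Sum>i<length ts. 3 + m)"
  proof (rule sum_mono)
    fix i assume "i \<in> {..<length ts}"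
    then have "ts ! i \<in> set ts" by simp
    then have "finite (snd (snd (snd (ts ! i))))" "card (snd (snd (snd (ts ! i)))) \<le> m" using assms by blast+
    then show "card (letters key i (ts ! i)) \<le> 3 + m"
      using card_letters[of "snd (snd (snd (ts ! i)))" key i "fst (ts ! i)" "fst (snd (ts ! i))" "fst (snd (snd (ts ! i)))"]
      by simp
  qed
  finally show ?thesis by simp
qed

definition all_steps :: "('s \<Rightarrow> nat set \<times> nat \<Rightarrow> 's) \<Rightarrow> nat \<Rightarrow> 's list \<Rightarrow> nat set \<times> int \<Rightarrow> 's list" where
  "all_steps f N ts x = map (\<lambda>T. f T (to_cell N x)) ts"

lemma foldl_all_steps: "foldl (all_steps f N) ts xs = map (\<lambda>T. foldl f T (map (to_cell N) xs)) ts"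
  by (induction xs arbitrary: ts) (auto simp: all_steps_def)

section \<open>Choice of the parameters\<close>

text \<open>Weights reach X^(13 k), so each of the five terms of the bad probability is brought down
  to X^(-15 k). As Q \<le> X^(5 k), this dictates the exponents for \<open>w / h\<close>,
  \<open>h\<close> and \<open>C2\<close>, and then for \<open>C1\<close>, which must exceed
  \<open>C2 / \<rho>\<^sup>2\<close> by that factor. The choice of \<rho> makes \<open>k * p\<close>
  small compared with 1 / X. The bound \<open>k \<ge> 8\<close> lets multiples of k absorb additive
  constants in exponents.\<close>

locale parameters =
  fixes X \<rho> h p w C1 C2 :: real and k R Q :: nat
  assumes X: "4 \<le> X" and k8: "8 \<le> k" and kX: "real k \<le> 2 * X"
    and h: "0 < h" "h \<le> 1 / X ^ (33 * k)" and w: "0 \<le> w" "X ^ (25 * k) * w \<le> h"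
    and \<rho>: "1 / X ^ 13 \<le> \<rho>" "\<rho> \<le> 1 / X ^ 12" and p: "p = (real k + 1) * \<rho>"
    and C2: "C2 = X ^ (24 * k)" and C1: "C1 = X ^ (45 * k)"
    and R: "R = 3 * k ^ 2" and Q: "Q = (k + 1) * R ^ (k + 1)"
begin

lemma X1: "1 \<le> X" "0 < X" using X by auto

lemma pow_mono: "a \<le> b \<Longrightarrow> X ^ a \<le> X ^ b"
  using X1 by (simp add: power_increasing)

text \<open>Two powers of X absorb any constant up to 16; with this the estimates below become
  comparisons of exponents.\<close>

lemma num_le: "c \<le> 16 \<Longrightarrow> c \<le> X ^ 2"
proof -
  assume "c \<le> 16"
  have "4 ^ 2 \<le> X ^ 2" using X by (intro power_mono) auto
  then show "c \<le> X ^ 2" using \<open>c \<le> 16\<close> by simp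
qed

lemma frac_le:
  assumes "c * X ^ a \<le> X ^ (a + 2)" "a + d + 2 \<le> b" shows "c * X ^ a / X ^ b \<le> 1 / X ^ d"
proof -
  have "c * X ^ a * X ^ d \<le> X ^ (a + 2) * X ^ d" using assms(1) X1 by (intro mult_right_mono) auto
  also have "\<dots> = X ^ (a + d + 2)" by (simp add: power_add[symmetric] algebra_simps)
  also have "\<dots> \<le> X ^ b" using assms(2) by (rule pow_mono)
  finally show ?thesis using X1 by (simp add: field_simps)
qed

lemma frac16: "c \<le> 16 \<Longrightarrow> a + d + 2 \<le> b \<Longrightarrow> c * X ^ a / X ^ b \<le> 1 / X ^ d"
proof (rule frac_le)
  assume "c \<le> 16"
  then have "c * X ^ a \<le> X ^ 2 * X ^ a" using num_le X1 by (intro mult_right_mono) auto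
  also have "X ^ 2 * X ^ a = X ^ (a + 2)" by (subst power_add) (rule mult.commute)
  finally show "c * X ^ a \<le> X ^ (a + 2)" .
qed

lemma \<rho>_pos: "0 < \<rho>"
proof -
  have "0 < 1 / X ^ 13" using X1 by simp
  then show ?thesis using \<rho>(1) by linarith
qed

lemma k1: "real k + 1 \<le> X ^ 2"
proof -
  have "4 * X \<le> X * X" using X X1 by (intro mult_right_mono) auto
  then show ?thesis unfolding power2_eq_square using kX X by linarith
qed

lemma p_bounds: "0 < p" "p \<le> 1 / X ^ 10"
proof -
  show "0 < p" unfolding p using \<rho>_pos by (simp add: mult_pos_pos add_nonneg_pos)
  have "p \<le> X ^ 2 * (1 / X ^ 12)"
    unfolding p using k1 \<rho> \<rho>_pos X1 by (intro mult_mono) auto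
  also have "\<dots> = 1 / X ^ 10" using X1 power_add[of X 2 10] by (simp add: field_simps)
  finally show "p \<le> 1 / X ^ 10" .
qed

lemma p_half: "p \<le> 1 / 2"
proof -
  have "X ^ 1 \<le> X ^ 10" by (rule pow_mono) simp
  then have "2 \<le> X ^ 10" using X by simp
  then have "1 / X ^ 10 \<le> 1 / 2" using X1 by (intro divide_left_mono) auto
  then show ?thesis using p_bounds by linarith
qed

lemma R_bound: "real R \<le> X ^ 4"
proof -
  have "real k ^ 2 \<le> (2 * X) ^ 2" using kX by (intro power_mono) auto
  then have "real R \<le> 12 * X ^ 2" unfolding R by (simp add: power_mult_distrib)
  also have "\<dots> \<le> X ^ 2 * X ^ 2" using num_le[of 12] X1 by (intro mult_right_mono) auto
  finally show ?thesis by (simp add: power_add[symmetric])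
qed

lemma Q_bound: "real Q \<le> X ^ (5 * k)"
proof -
  have "real Q = (real k + 1) * real R ^ (k + 1)" unfolding Q by (simp add: algebra_simps)
  also have "\<dots> \<le> X ^ 2 * (X ^ 4) ^ (k + 1)"
    using k1 R_bound X1 by (intro mult_mono power_mono) auto
  also have "\<dots> = X ^ (2 + 4 * (k + 1))" by (simp only: power_add power_mult)
  also have "\<dots> \<le> X ^ (5 * k)" by (rule pow_mono) (use k8 in simp)
  finally show ?thesis .
qed

lemma weight_bound: "(1 / \<rho>) ^ k \<le> X ^ (13 * k)"
proof -
  have "1 / \<rho> \<le> X ^ 13"
    using \<rho>(1) \<rho>_pos X1 by (simp add: field_simps)
  then have "(1 / \<rho>) ^ k \<le> (X ^ 13) ^ k" using \<rho>_pos by (intro power_mono) auto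
  then show ?thesis by (simp add: power_mult)
qed

text \<open>This is \<open>\<beta>\<close> of \<open>hidden_stream\<close> with all its ingredients
  as plain numbers.\<close>

definition B :: real where
  "B = real Q * (2 * w / h) + real (Q * Q) * (4 * h) + real Q * (4 / C2)
     + real Q * (2 ^ (3 * k ^ 2) * p ^ (2 * k ^ 2)) + 16 * C2 / (\<rho>\<^sup>2 * C1)"

lemma B_bound: "B \<le> 5 / X ^ (15 * k)"
proof -
  have pX: "0 < X ^ a" for a using X1 by simp
  have 1: "real Q * (2 * w / h) \<le> 1 / X ^ (15 * k)"
  proof -
    have "w / h \<le> 1 / X ^ (25 * k)" using w h pX by (simp add: field_simps)
    then have "real Q * (2 * w / h) \<le> X ^ (5 * k) * (2 * (1 / X ^ (25 * k)))"
      using Q_bound w h by (intro mult_mono) auto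
    also have "\<dots> = 2 * X ^ (5 * k) / X ^ (25 * k)" by simp
    also have "\<dots> \<le> 1 / X ^ (15 * k)" by (rule frac16) (use k8 in simp_all)
    finally show ?thesis .
  qed
  have 2: "real (Q * Q) * (4 * h) \<le> 1 / X ^ (15 * k)"
  proof -
    have "real (Q * Q) * (4 * h) \<le> (X ^ (5 * k) * X ^ (5 * k)) * (4 * (1 / X ^ (33 * k)))"
      unfolding of_nat_mult using Q_bound h X1 by (intro mult_mono) auto
    also have "X ^ (5 * k) * X ^ (5 * k) = X ^ (10 * k)" by (simp only: power_add[symmetric]) simp
    also have "X ^ (10 * k) * (4 * (1 / X ^ (33 * k))) = 4 * X ^ (10 * k) / X ^ (33 * k)" by simp
    also have "\<dots> \<le> 1 / X ^ (15 * k)" by (rule frac16) (use k8 in simp_all)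
    finally show ?thesis .
  qed
  have 3: "real Q * (4 / C2) \<le> 1 / X ^ (15 * k)"
  proof -
    have "real Q * (4 / C2) \<le> X ^ (5 * k) * (4 / X ^ (24 * k))"
      unfolding C2 using Q_bound X1 by (intro mult_right_mono) auto
    also have "\<dots> = 4 * X ^ (5 * k) / X ^ (24 * k)" by simp
    also have "\<dots> \<le> 1 / X ^ (15 * k)" by (rule frac16) (use k8 in simp_all)
    finally show ?thesis .
  qed
  have 4: "real Q * (2 ^ (3 * k ^ 2) * p ^ (2 * k ^ 2)) \<le> 1 / X ^ (15 * k)"
  proof -
    \<comment> \<open>The exponent of \<open>p\<close> is quadratic in k, so neither the number
      8^(k^2) of subsets nor the union over \<open>Q\<close> sets matters.\<close>
    have "(2::real) ^ (3 * k ^ 2) * p ^ (2 * k ^ 2) = (8 * p ^ 2) ^ (k ^ 2)"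
      by (simp only: power_mult_distrib power_mult) simp
    also have "\<dots> \<le> (1 / X ^ 18) ^ (k ^ 2)"
    proof (rule power_mono)
      have "p ^ 2 \<le> (1 / X ^ 10) ^ 2" using p_bounds by (intro power_mono) auto
      also have "\<dots> = 1 / X ^ 20" by (simp add: power_divide power_mult[symmetric])
      finally have "8 * p ^ 2 \<le> 8 * X ^ 0 / X ^ 20" by simp
      also have "\<dots> \<le> 1 / X ^ 18" by (rule frac16) simp_all
      finally show "8 * p ^ 2 \<le> 1 / X ^ 18" .
    qed simp
    also have "\<dots> = 1 / X ^ (18 * k ^ 2)" by (simp add: power_divide power_mult)
    finally have le: "(2::real) ^ (3 * k ^ 2) * p ^ (2 * k ^ 2) \<le> 1 / X ^ (18 * k ^ 2)" .
    have "real Q * (2 ^ (3 * k ^ 2) * p ^ (2 * k ^ 2)) \<le> X ^ (5 * k) * (1 / X ^ (18 * k ^ 2))"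
      using Q_bound le p_bounds X1 by (intro mult_mono) auto
    also have "\<dots> = 1 * X ^ (5 * k) / X ^ (18 * k ^ 2)" by simp
    also have "\<dots> \<le> 1 / X ^ (15 * k)"
    proof (rule frac16)
      have "k * 8 \<le> k * k" using k8 by (intro mult_left_mono) auto
      then show "5 * k + 15 * k + 2 \<le> 18 * k ^ 2" unfolding power2_eq_square using k8 by linarith
    qed simp
    finally show ?thesis .
  qed
  have 5: "16 * C2 / (\<rho>\<^sup>2 * C1) \<le> 1 / X ^ (15 * k)"
  proof -
    have "(1 / X ^ 13) ^ 2 \<le> \<rho>\<^sup>2" using \<rho> X1 by (intro power_mono) auto
    then have r: "1 / X ^ 26 \<le> \<rho>\<^sup>2" by (simp add: power_divide power_mult[symmetric])
    have "16 * C2 / (\<rho>\<^sup>2 * C1) \<le> 16 * C2 / (1 / X ^ 26 * C1)"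
      unfolding C1 C2 using r \<rho>_pos X1 by (intro divide_left_mono mult_right_mono mult_pos_pos) auto
    also have "\<dots> = 16 * X ^ (24 * k + 26) / X ^ (45 * k)" unfolding C1 C2 using X1 by (simp add: power_add)
    also have "\<dots> \<le> 1 / X ^ (15 * k)" by (rule frac16) (use k8 in simp_all)
    finally show ?thesis .
  qed
  show ?thesis unfolding B_def using 1 2 3 4 5 by simp
qed

lemma B_error: "(1 / \<rho>) ^ k * B \<le> 1 / (8 * X)"
proof -
  have "0 < C1" "0 < C2" unfolding C1 C2 using X1 by simp_all
  then have B0: "0 \<le> B" unfolding B_def using w h p_bounds by (intro add_nonneg_nonneg) auto
  have "(1 / \<rho>) ^ k * B \<le> X ^ (13 * k) * (5 / X ^ (15 * k))"
    using weight_bound B_bound B0 X1 by (intro mult_mono) auto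
  also have "\<dots> = 5 * X ^ (13 * k) / X ^ (15 * k)" by simp
  also have "\<dots> \<le> 1 / X ^ 3" by (rule frac16) (use k8 in simp_all)
  also have "\<dots> \<le> 1 / (8 * X)"
  proof -
    have "8 * X \<le> X ^ 2 * X" using num_le[of 8] X1 by (intro mult_right_mono) auto
    also have "X ^ 2 * X = X ^ 3" by (simp add: power3_eq_cube power2_eq_square)
    finally show ?thesis using X1 by (intro divide_left_mono) auto
  qed
  finally show ?thesis .
qed

text \<open>Bernoulli's inequality gives (1 - p)^k \<ge> 1/2, so repeated blocking at most doubles
  the bound \<open>k * p\<close>.\<close>

lemma false_error: "real k * p * (1 / (1 - p)) ^ k \<le> 1 / (8 * X)"
proof -
  have "real k * p \<le> X ^ 2 * (1 / X ^ 10)" using k1 p_bounds X1 by (intro mult_mono) auto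
  also have "\<dots> = 1 * X ^ 2 / X ^ 10" by simp
  also have "\<dots> \<le> 1 / X ^ 5" by (rule frac16) simp_all
  finally have kp: "real k * p \<le> 1 / X ^ 5" .
  have "X ^ 1 \<le> X ^ 5" by (rule pow_mono) simp
  then have "1 / X ^ 5 \<le> 1 / 2" using X by (intro divide_left_mono) auto
  then have "1 / 2 \<le> 1 + real k * (- p)" using kp by simp
  also have "\<dots> \<le> (1 + (- p)) ^ k" by (rule Bernoulli_inequality) (use p_half in simp)
  finally have "1 / 2 \<le> (1 - p) ^ k" by simp
  then have "(1 / (1 - p)) ^ k \<le> 2" using p_half by (simp add: power_divide divide_le_eq)
  then have "real k * p * (1 / (1 - p)) ^ k \<le> 1 / X ^ 5 * 2"
    using kp p_bounds p_half X1 by (intro mult_mono) auto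
  also have "\<dots> = 2 * X ^ 0 / X ^ 5" by simp
  also have "\<dots> \<le> 1 / X ^ 3" by (rule frac16) simp_all
  also have "\<dots> \<le> 1 / (8 * X)"
  proof -
    have "8 * X \<le> X ^ 2 * X" using num_le[of 8] X1 by (intro mult_right_mono) auto
    also have "X ^ 2 * X = X ^ 3" by (simp add: power3_eq_cube power2_eq_square)
    finally show ?thesis using X1 by (intro divide_left_mono) auto
  qed
  finally show ?thesis .
qed

lemma weight_square: "((1 / \<rho>) ^ k)\<^sup>2 \<le> X ^ (26 * k)"
proof -
  have "((1 / \<rho>) ^ k)\<^sup>2 \<le> (X ^ (13 * k))\<^sup>2" using weight_bound \<rho>_pos by (intro power_mono) auto
  then show ?thesis by (simp add: power_mult[symmetric] mult.commute)
qed

lemma sample_size: "((1 / \<rho>) ^ k)\<^sup>2 \<le> X ^ (30 * k) * (1 / (8 * X))\<^sup>2"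
proof -
  have "64 * X ^ 2 \<le> X ^ 2 * X ^ 2 * X ^ 2"
  proof -
    have "8 * 8 \<le> X ^ 2 * X ^ 2" using num_le[of 8] X1 by (intro mult_mono) auto
    then show ?thesis using X1 by (intro mult_right_mono) auto
  qed
  then have "64 * X ^ 2 \<le> X ^ 6" by (simp add: power_add[symmetric])
  then have "X ^ (26 * k) * (64 * X ^ 2) \<le> X ^ (26 * k) * X ^ 6"
    by (rule mult_left_mono) (use X1 in simp)
  also have "\<dots> = X ^ (26 * k + 6)" by (simp add: power_add)
  also have "\<dots> \<le> X ^ (30 * k)" by (rule pow_mono) (use k8 in simp)
  finally have "X ^ (26 * k) \<le> X ^ (30 * k) * (1 / (8 * X))\<^sup>2"
    using X1 by (simp add: power_divide power_mult_distrib field_simps)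
  then show ?thesis using weight_square by linarith
qed

text \<open>Of the exponent 30 k, 26 k is for the squared weights; the rest covers
  \<open>k * k\<close>, the accuracy 1 / (8 X) and constants.\<close>

lemma variance:
  assumes "real b * X ^ (30 * k) \<le> real n"
  shows "real n * real (k * b * k) * ((1 / \<rho>) ^ k)\<^sup>2 \<le> (1 / (8 * X) * real n)\<^sup>2"
proof -
  have k2: "real k * real k \<le> X ^ 2 * X ^ 2" using k1 X1 by (intro mult_mono) auto
  have "8 * 8 \<le> X ^ 2 * X ^ 2" using num_le[of 8] X1 by (intro mult_mono) auto
  then have "64 * X ^ 2 \<le> X ^ 2 * X ^ 2 * X ^ 2" using X1 by (intro mult_right_mono) auto
  then have sx: "64 * X ^ 2 \<le> X ^ 6" by (simp add: power_add[symmetric])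
  have "real (k * b * k) * ((1 / \<rho>) ^ k)\<^sup>2 * (64 * X ^ 2) = real b * ((real k * real k) * ((1 / \<rho>) ^ k)\<^sup>2 * (64 * X ^ 2))"
    by (simp add: algebra_simps)
  also have "\<dots> \<le> real b * ((X ^ 2 * X ^ 2) * X ^ (26 * k) * X ^ 6)"
  proof (rule mult_left_mono)
    have "(real k * real k) * ((1 / \<rho>) ^ k)\<^sup>2 \<le> (X ^ 2 * X ^ 2) * X ^ (26 * k)"
      by (rule mult_mono[OF k2 weight_square]) (use X1 in auto)
    then show "(real k * real k) * ((1 / \<rho>) ^ k)\<^sup>2 * (64 * X ^ 2) \<le> (X ^ 2 * X ^ 2) * X ^ (26 * k) * X ^ 6"
      by (rule mult_mono[OF _ sx]) (use X1 in auto)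
  qed simp
  also have "(X ^ 2 * X ^ 2) * X ^ (26 * k) * X ^ 6 = X ^ (26 * k + 10)"
    by (simp only: power_add[symmetric]) (simp add: algebra_simps)
  also have "real b * X ^ (26 * k + 10) \<le> real b * X ^ (30 * k)"
    by (intro mult_left_mono pow_mono) (use k8 in auto)
  also have "\<dots> \<le> real n" by (rule assms)
  finally have "real n * (real (k * b * k) * ((1 / \<rho>) ^ k)\<^sup>2 * (64 * X ^ 2)) \<le> real n * real n"
    by (intro mult_left_mono) auto
  then show ?thesis using X1 by (simp add: power_mult_distrib power_divide power2_eq_square field_simps)
qed

lemma C_condition: "4 * C2 \<le> C1 * \<rho>"
proof -
  have "4 * X ^ (24 * k) * X ^ 13 \<le> X ^ 2 * X ^ (24 * k) * X ^ 13"
    using num_le[of 4] X1 by (intro mult_right_mono) auto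
  also have "\<dots> = X ^ (24 * k + 15)" by (simp only: power_add[symmetric]) (simp add: algebra_simps)
  also have "\<dots> \<le> X ^ (45 * k)" by (rule pow_mono) (use k8 in simp)
  finally have "4 * C2 \<le> C1 * (1 / X ^ 13)" unfolding C1 C2 using X1 by (simp add: field_simps)
  also have "\<dots> \<le> C1 * \<rho>" unfolding C1 using \<rho> X1 by (intro mult_left_mono) auto
  finally show ?thesis .
qed

text \<open>There are X^(30 k) trackers with \<open>k + 1\<close> cells each, a cap of order C1
  X^(25 k) = X^(70 k) times b + w m, and letters of O(X^2 (1 + log n)) bits. The summand 2 / n^4 in
  the bound on \<open>h\<close> adds only a constant to \<open>h * cnt\<close>, because m \<le>
  n^2.\<close>

lemma space_bound:
  assumes n: "1 \<le> n" and b: "1 \<le> b" and hn: "h \<le> X ^ (25 * k) * w + 2 / real n ^ 4"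
    and m: "m \<le> n ^ 2" "cnt \<le> m" and \<Lambda>: "\<Lambda> = b + nat \<lceil>C1 * (real b + h * real cnt)\<rceil>"
    and s: "real s = X ^ (30 * k)" and a: "real a \<le> 4 + 30 * real k * X + 6 * (log 2 (real n) + 1)"
    and z: "z \<le> s * (3 + (k + 1) * \<Lambda>)"
  shows "real ((a + 1) * z) \<le> X ^ (102 * k) * (71 * (1 + log 2 (real n))) * (real b + w * real m)"
proof -
  define D where "D = real b + w * real m"
  have D1: "1 \<le> D" unfolding D_def using b w by (simp add: add_increasing2)
  have lg: "0 \<le> log 2 (real n)" using n by simp
  have one: "1 \<le> X ^ e" for e using X1 by simp
  have "h * cnt \<le> (X ^ (25 * k) * w + 2 / real n ^ 4) * m"
    using hn h m(2) by (intro mult_mono) auto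
  also have "\<dots> = X ^ (25 * k) * (w * m) + 2 * (m / real n ^ 4)" by (simp add: algebra_simps)
  also have "\<dots> \<le> X ^ (25 * k) * (w * m) + 2 * 1"
  proof (intro add_left_mono mult_left_mono)
    have "real m \<le> real n ^ 2" using m(1) by (metis of_nat_le_iff of_nat_power)
    also have "\<dots> \<le> real n ^ 4" using n by (intro power_increasing) auto
    finally show "m / real n ^ 4 \<le> 1" using n by simp
  qed simp
  also have "real b + (X ^ (25 * k) * (w * m) + 2 * 1) \<le> 3 * X ^ (25 * k) * D"
  proof -
    have "1 * real b \<le> X ^ (25 * k) * real b" by (intro mult_right_mono one) simp
    moreover have "0 \<le> X ^ (25 * k) * (w * m)" using w X1 by simp
    moreover have "3 * X ^ (25 * k) * D = 3 * (X ^ (25 * k) * real b) + 3 * (X ^ (25 * k) * (w * m))"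
      unfolding D_def by (simp add: algebra_simps)
    moreover have "1 \<le> real b" using b by simp
    ultimately show ?thesis by linarith
  qed
  finally have hb: "real b + h * cnt \<le> 3 * X ^ (25 * k) * D" by simp
  have C1': "1 \<le> C1" unfolding C1 by (rule one)
  have hc: "1 \<le> real b + h * cnt" "real b \<le> real b + h * cnt" using b h by (auto simp: add_increasing2)
  have y: "real b + h * cnt \<le> C1 * (real b + h * cnt)"
    using C1' hc by (simp add: mult_le_cancel_right1)
  have "real \<Lambda> \<le> b + (C1 * (real b + h * cnt) + 1)" unfolding \<Lambda> using y hc by simp
  also have "\<dots> \<le> 3 * (C1 * (real b + h * cnt))" using y hc by linarith
  also have "\<dots> \<le> 3 * (C1 * (3 * X ^ (25 * k) * D))" using hb C1' by (intro mult_left_mono) auto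
  also have "\<dots> = 9 * X ^ (70 * k) * D"
  proof -
    have "X ^ (45 * k) * X ^ (25 * k) = X ^ (70 * k)" by (simp only: power_add[symmetric]) simp
    then show ?thesis unfolding C1 by simp
  qed
  finally have L: "real \<Lambda> \<le> 9 * (X ^ (70 * k) * D)" by simp
  let ?Y = "X ^ (70 * k) * D"
  have Y1: "1 * 1 \<le> ?Y" using one[of "70 * k"] D1 by (intro mult_mono) auto
  have "real (3 + (k + 1) * \<Lambda>) = 3 + (real k + 1) * real \<Lambda>" by (simp add: algebra_simps)
  also have "\<dots> \<le> 3 * ?Y + X ^ 2 * (9 * ?Y)" using k1 L Y1 by (intro add_mono mult_mono) auto
  also have "\<dots> = (3 + 9 * X ^ 2) * ?Y" by (simp add: algebra_simps)
  also have "\<dots> \<le> X ^ 4 * ?Y"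
  proof (rule mult_right_mono)
    have "3 + 9 * X ^ 2 \<le> 12 * X ^ 2" using one[of 2] by simp
    also have "\<dots> \<le> X ^ 2 * X ^ 2" using num_le[of 12] by (intro mult_right_mono) auto
    also have "\<dots> = X ^ 4" by (simp add: power_add[symmetric])
    finally show "3 + 9 * X ^ 2 \<le> X ^ 4" .
  qed (use Y1 in simp)
  finally have t: "real (3 + (k + 1) * \<Lambda>) \<le> X ^ 4 * ?Y" .
  have zb: "real z \<le> X ^ (30 * k) * (X ^ 4 * ?Y)"
  proof -
    have "real z \<le> real (s * (3 + (k + 1) * \<Lambda>))" using z by (simp only: of_nat_le_iff)
    also have "\<dots> = X ^ (30 * k) * real (3 + (k + 1) * \<Lambda>)" by (simp only: of_nat_mult s)
    also have "\<dots> \<le> X ^ (30 * k) * (X ^ 4 * ?Y)" using t X1 by (intro mult_left_mono) auto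
    finally show ?thesis .
  qed
  have ab: "real (a + 1) \<le> X ^ 2 * (71 * (1 + log 2 (real n)))"
  proof -
    have "real k * X \<le> 2 * X * X" using kX X1 by (intro mult_right_mono) auto
    moreover have "30 * real k * X = 30 * (real k * X)" "60 * X ^ 2 = 30 * (2 * X * X)"
      by (simp_all add: power2_eq_square)
    ultimately have kx: "30 * real k * X \<le> 60 * X ^ 2" by linarith
    have l: "6 * log 2 (real n) \<le> 71 * (X ^ 2 * log 2 (real n))"
    proof -
      have "1 * log 2 (real n) \<le> X ^ 2 * log 2 (real n)" using one[of 2] lg by (intro mult_right_mono) auto
      then show ?thesis using lg by linarith
    qed
    have lin: "c + 1 \<le> 11 + u + 6 * l" if "c \<le> 4 + d + 6 * (l + 1)" "d \<le> u" for c d u l :: real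
      using that by (simp add: algebra_simps)
    have "real (a + 1) = real a + 1" by simp
    also have "\<dots> \<le> 11 + 60 * X ^ 2 + 6 * log 2 (real n)" by (rule lin[OF a kx])
    also have "\<dots> \<le> 71 * X ^ 2 + 71 * (X ^ 2 * log 2 (real n))" using l one[of 2] by linarith
    also have "\<dots> = X ^ 2 * (71 * (1 + log 2 (real n)))" by (simp add: algebra_simps)
    finally show ?thesis .
  qed
  have "real ((a + 1) * z) = real (a + 1) * real z" by (rule of_nat_mult)
  also have "\<dots> \<le> X ^ 2 * (71 * (1 + log 2 (real n))) * (X ^ (30 * k) * (X ^ 4 * ?Y))"
    by (rule mult_mono[OF ab zb]) (use lg X1 in auto)
  also have "\<dots> = X ^ 2 * X ^ (30 * k) * X ^ 4 * X ^ (70 * k) * ((71 * (1 + log 2 (real n))) * D)"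
    by (simp only: mult_ac)
  also have "X ^ 2 * X ^ (30 * k) * X ^ 4 * X ^ (70 * k) = X ^ (100 * k + 6)"
    by (simp only: power_add[symmetric]) (simp add: algebra_simps)
  also have "X ^ (100 * k + 6) * ((71 * (1 + log 2 (real n))) * D) \<le> X ^ (102 * k) * ((71 * (1 + log 2 (real n))) * D)"
    by (intro mult_right_mono pow_mono) (use k8 lg D1 in auto)
  finally show ?thesis unfolding D_def by (simp only: mult_ac)
qed

end

section \<open>The algorithms\<close>

text \<open>The adversary has to present a measurable stream; everything applied to it afterwards
  lives on a discrete space.\<close>

lemma estimate_kernel:
  assumes "hidden_batch_adversary b w \<kappa> n E \<B> \<sigma>"
  shows "(\<lambda>t. measure_pmf (F (presented \<kappa> n (\<sigma> t)))) \<in> start_times \<B> \<rightarrow>\<^sub>M subprob_algebra (count_space UNIV)"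
proof (rule measurable_compose[where g = "\<lambda>xs. measure_pmf (F xs)" and N = "count_space UNIV"])
  show "(\<lambda>t. presented \<kappa> n (\<sigma> t)) \<in> start_times \<B> \<rightarrow>\<^sub>M count_space UNIV"
    using assms by (simp add: hidden_batch_adversary_def)
  show "(\<lambda>xs. measure_pmf (F xs)) \<in> count_space UNIV \<rightarrow>\<^sub>M subprob_algebra (count_space UNIV)"
    by (simp add: measure_pmf_in_subprob_algebra)
qed

lemma box_presented:
  assumes adv: "hidden_batch_adversary b w \<kappa> n E \<B> \<sigma>" and t: "t \<in> (\<Pi>\<^sub>E B\<in>\<B>. {0..1})"
  shows "distinct (map fst (presented \<kappa> n (\<sigma> t)))" "fst ` set (presented \<kappa> n (\<sigma> t)) = E"
    "length (presented \<kappa> n (\<sigma> t)) = card E"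
proof -
  have *: "distinct (map fst (\<sigma> t))" "set (map fst (\<sigma> t)) = E"
    using adv t by (auto simp: hidden_batch_adversary_def)
  have m: "map fst (presented \<kappa> n (\<sigma> t)) = map fst (\<sigma> t)" by (auto simp: presented_def)
  then show "distinct (map fst (presented \<kappa> n (\<sigma> t)))" using * by simp
  show "fst ` set (presented \<kappa> n (\<sigma> t)) = E" using * m by (metis list.set_map)
  show "length (presented \<kappa> n (\<sigma> t)) = card E"
    using distinct_card[OF *(1)] *(2) by (simp add: presented_def)
qed

lemma le_two_power_log:
  assumes "1 \<le> n" shows "n \<le> 2 ^ nat \<lceil>log 2 (real n)\<rceil>"
proof -
  have le: "log 2 (real n) \<le> real (nat \<lceil>log 2 (real n)\<rceil>)" by linarith
  have "real n = 2 powr log 2 (real n)" using assms by simp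
  also have "\<dots> \<le> 2 powr real (nat \<lceil>log 2 (real n)\<rceil>)" using le by (intro powr_mono) auto
  also have "\<dots> = 2 ^ nat \<lceil>log 2 (real n)\<rceil>" by (simp add: powr_realpow)
  finally have "real n \<le> real (2 ^ nat \<lceil>log 2 (real n)\<rceil>)" by simp
  then show ?thesis by (simp only: of_nat_le_iff)
qed

text \<open>The fallback. Both terms of the minimum are used: \<open>n\<close> if \<open>b\<close>
  is large or \<open>n\<close> is small, \<open>2 * card E\<close> if \<open>w\<close> is
  large.\<close>

lemma forest_algorithm:
  assumes n: "1 \<le> n"
  shows "\<exists>A. \<forall>E \<B> \<sigma> b w \<kappa> \<epsilon>. simple_graph n E \<and> hidden_batch_adversary b w \<kappa> n E \<B> \<sigma> \<and> 0 \<le> \<epsilon> \<longrightarrow>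
    measure (estimate_distribution A \<kappa> n \<B> \<sigma>) {c. \<bar>c - real (num_components n E)\<bar> \<le> \<epsilon> * real n} = 1 \<and>
    (\<forall>t \<in> (\<Pi>\<^sub>E B\<in>\<B>. {0..1}). space_at_most A (presented \<kappa> n (\<sigma> t))
       (3 * (1 + log 2 (real n)) * min (real n) (2 * real (card E))))"
proof -
  define a where "a = 2 * nat \<lceil>log 2 (real n)\<rceil>"
  have lg: "0 \<le> log 2 (real n)" using n by simp
  have "card (all_edges n) \<le> 2 ^ a"
  proof -
    have "n \<le> 2 ^ nat \<lceil>log 2 (real n)\<rceil>" by (rule le_two_power_log[OF n])
    then have "n ^ 2 \<le> (2 ^ nat \<lceil>log 2 (real n)\<rceil>) ^ 2" by (rule power_mono) simp
    then show ?thesis using card_all_edges_le[of n] unfolding a_def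
      by (simp add: power_mult[symmetric] mult.commute)
  qed
  then obtain enc :: "nat set set \<Rightarrow> bool list" where enc: "inj_on enc (Pow (all_edges n))"
      "\<And>F. F \<subseteq> all_edges n \<Longrightarrow> length (enc F) \<le> (a + 1) * card F"
    using ex_set_encoding[OF finite_all_edges] by meson
  define A where "A = machine_algorithm (return_pmf {}) (star_step n) (\<lambda>F. real (num_components n F)) enc (Pow (all_edges n))"
  show ?thesis
  proof (intro exI[of _ A] allI impI, elim conjE)
    fix E \<B> \<sigma> b \<kappa> and w \<epsilon> :: real
    assume g: "simple_graph n E" and adv: "hidden_batch_adversary b w \<kappa> n E \<B> \<sigma>" and \<epsilon>: "0 \<le> \<epsilon>"
    have E: "E \<subseteq> all_edges n" using g by (simp add: simple_graph_def all_edges_def)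
    have finE: "finite E" using E finite_all_edges finite_subset by blast
    interpret batch_times \<B>
      by unfold_locales (rule finite_elements[OF finE], use adv in \<open>simp add: hidden_batch_adversary_def\<close>)
    let ?xs = "\<lambda>t. presented \<kappa> n (\<sigma> t)" and ?box = "\<Pi>\<^sub>E B\<in>\<B>. {0..1::real}"
    have state: "foldl (star_step n) {} (take i (?xs t)) = stars n (fst ` set (take i (?xs t)))"
      and sub: "fst ` set (take i (?xs t)) \<subseteq> E" if "t \<in> ?box" for t i
    proof -
      show s: "fst ` set (take i (?xs t)) \<subseteq> E"
        using box_presented(2)[OF adv that] set_take_subset[of i "?xs t"] by blast
      show "foldl (star_step n) {} (take i (?xs t)) = stars n (fst ` set (take i (?xs t)))"
        by (rule foldl_star_step) (use s E in blast)
    qed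
    have good: "foldl (star_step n) s (take i (?xs t)) \<in> Pow (all_edges n)"
      if "t \<in> ?box" "s \<in> set_pmf (return_pmf {})" for s i t
      using state[OF that(1), of i] stars_edges[of "fst ` set (take i (?xs t))" n] sub[OF that(1), of i] E that(2)
      by auto
    have out: "map_pmf (alg_output A) (run A (?xs t)) = return_pmf (real (num_components n E))" if t: "t \<in> ?box" for t
    proof -
      have "foldl (star_step n) {} (?xs t) = stars n E"
        using state[OF t, of "length (?xs t)"] box_presented(2)[OF adv t] by simp
      then show ?thesis
        unfolding A_def using output_machine_algorithm[OF enc(1), of "return_pmf {}" "?xs t" "star_step n"] good[OF t]
        by (simp add: num_components_stars[OF E])
    qed
    let ?f = "\<lambda>t. measure_pmf (map_pmf (alg_output A) (run A (?xs t)))"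
    let ?X = "{c. \<bar>c - real (num_components n E)\<bar> \<le> \<epsilon> * real n}"
    have "measure (estimate_distribution A \<kappa> n \<B> \<sigma>) ?X = (\<integral>t. measure (?f t) ?X \<partial>start_times \<B>)"
      unfolding estimate_distribution_def
      by (rule S.measure_bind[OF estimate_kernel[OF adv, of "\<lambda>xs. map_pmf (alg_output A) (run A xs)"]]) simp
    also have "\<dots> = (\<integral>t. 1 \<partial>start_times \<B>)"
    proof (rule integral_cong_AE)
      show "(\<lambda>t. measure (?f t) ?X) \<in> borel_measurable (start_times \<B>)"
        by (rule measurable_compose[OF estimate_kernel[OF adv, of "\<lambda>xs. map_pmf (alg_output A) (run A xs)"]
              measurable_measure_subprob_algebra]) simp
      show "AE t in start_times \<B>. measure (?f t) ?X = 1"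
        using AE_start_times
      proof eventually_elim
        case (elim t)
        then show ?case unfolding out[OF elim] using \<epsilon> by (simp add: measure_return_pmf indicator_def)
      qed
    qed simp
    also have "\<dots> = 1" by (simp add: S.prob_space)
    finally have 1: "measure (estimate_distribution A \<kappa> n \<B> \<sigma>) ?X = 1" .
    have 2: "space_at_most A (?xs t) (3 * (1 + log 2 (real n)) * min (real n) (2 * real (card E)))" if t: "t \<in> ?box" for t
      unfolding A_def
    proof (rule space_machine_algorithm[OF enc(1)])
      fix s i assume s: "s \<in> set_pmf (return_pmf ({} :: nat set set))"
      then show "foldl (star_step n) s (take i (?xs t)) \<in> Pow (all_edges n)" by (rule good[OF t])
      let ?F = "fst ` set (take i (?xs t))"
      have F: "?F \<subseteq> all_edges n" using sub[OF t, of i] E by blast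
      have "card (stars n ?F) \<le> 2 * card ?F" by (rule card_stars_le_edges[OF F])
      also have "\<dots> \<le> 2 * card E" using card_mono[OF finE sub[OF t]] by simp
      finally have c: "real (card (stars n ?F)) \<le> min (real n) (2 * real (card E))"
        using card_stars_le_vertices[of n ?F] by simp
      have "real (length (enc (stars n ?F))) \<le> real ((a + 1) * card (stars n ?F))"
        using enc(2)[OF stars_edges[OF F]] by (simp only: of_nat_le_iff)
      also have "\<dots> = real (a + 1) * real (card (stars n ?F))" by (rule of_nat_mult)
      also have "\<dots> \<le> (3 * (1 + log 2 (real n))) * min (real n) (2 * real (card E))"
      proof (rule mult_mono[OF _ c])
        have "real (nat \<lceil>log 2 (real n)\<rceil>) \<le> log 2 (real n) + 1" using lg by linarith
        moreover have "real (a + 1) = 2 * real (nat \<lceil>log 2 (real n)\<rceil>) + 1" by (simp add: a_def)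
        moreover have "3 * (1 + log 2 (real n)) = 3 + 3 * log 2 (real n)" by simp
        ultimately show "real (a + 1) \<le> 3 * (1 + log 2 (real n))" using lg by linarith
      qed (use lg in auto)
      finally show "real (length (enc (foldl (star_step n) s (take i (?xs t)))))
        \<le> 3 * (1 + log 2 (real n)) * min (real n) (2 * real (card E))"
        using state[OF t, of i] s by simp
    qed
    show "measure (estimate_distribution A \<kappa> n \<B> \<sigma>) ?X = 1 \<and>
      (\<forall>t\<in>?box. space_at_most A (?xs t) (3 * (1 + log 2 (real n)) * min (real n) (2 * real (card E))))"
      using 1 2 by blast
  qed
qed

lemma tracker_algorithm:
  fixes n b x k N \<kappa> :: nat and w \<epsilon> \<delta> h :: real
  assumes n: "1 \<le> n" and b: "1 \<le> b" and w: "0 \<le> w" and x: "4 \<le> x" and k: "8 \<le> k" "k \<le> 2 * x"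
    and \<epsilon>: "0 < \<epsilon>" "4 \<le> \<epsilon> * real k" and \<delta>: "2 \<le> 3 * \<epsilon> * \<delta> * real x"
    and h_def: "h = real N / real n ^ \<kappa>" and N: "1 \<le> N" and hw: "real x ^ (25 * k) * w \<le> h"
    and hn: "1 \<le> h * real n ^ 4" "h \<le> real x ^ (25 * k) * w + 2 / real n ^ 4"
    and hx: "h \<le> 1 / real x ^ (33 * k)" and bn: "real b * real x ^ (30 * k) \<le> real n"
  shows "\<exists>A. \<forall>E \<B> \<sigma>. simple_graph n E \<and> hidden_batch_adversary b w \<kappa> n E \<B> \<sigma> \<longrightarrow>
    1 - \<delta> \<le> measure (estimate_distribution A \<kappa> n \<B> \<sigma>) {c. \<bar>c - real (num_components n E)\<bar> \<le> \<epsilon> * real n} \<and>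
    (\<forall>t \<in> (\<Pi>\<^sub>E B\<in>\<B>. {0..1}). space_at_most A (presented \<kappa> n (\<sigma> t))
       (real x ^ (102 * k) * (71 * (1 + log 2 (real n))) * (real b + w * real (card E))))"
proof -
  define X where "X = real x"
  have X: "4 \<le> X" using x by (simp add: X_def)
  have h0: "0 < h" using N n by (simp add: h_def)
  have hX: "h \<le> 1 / X ^ (33 * k)" using hx by (simp add: X_def)
  have Xp: "0 < X ^ e" "1 \<le> X ^ e" for e using X by auto
  have h14: "h \<le> 1 / X ^ 14"
  proof -
    have "X ^ 14 \<le> X ^ (33 * k)" by (rule power_increasing) (use k X in auto)
    then have "1 / X ^ (33 * k) \<le> 1 / X ^ 14" using X by (intro divide_left_mono mult_pos_pos zero_less_power) auto
    then show ?thesis using hX by linarith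
  qed
  \<comment> \<open>As many cells as fit into the length X^(-12). A cell is at most X^(-14) long, so
    rounding leaves \<rho> above X^(-13).\<close>
  define L where "L = nat \<lfloor>1 / X ^ 12 / h\<rfloor>"
  define \<rho> where "\<rho> = real L * h"
  define p where "p = (real k + 1) * \<rho>"
  define C1 where "C1 = X ^ (45 * k)"
  define C2 where "C2 = X ^ (24 * k)"
  define R where "R = 3 * k ^ 2"
  define \<Lambda> where "\<Lambda> cnt = b + nat \<lceil>C1 * (real b + h * real cnt)\<rceil>" for cnt
  define s where "s = x ^ (30 * k)"
  have q0: "0 \<le> 1 / X ^ 12 / h" using X h0 by simp
  have L: "real L \<le> 1 / X ^ 12 / h" "1 / X ^ 12 / h \<le> real L + 1" unfolding L_def using q0 by linarith+
  have r1: "\<rho> \<le> 1 / X ^ 12" using L(1) pos_le_divide_eq[OF h0] unfolding \<rho>_def by blast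
  have "1 / X ^ 12 \<le> (real L + 1) * h" using L(2) pos_divide_le_eq[OF h0] by blast
  then have r2: "1 / X ^ 12 - h \<le> \<rho>" unfolding \<rho>_def by (simp add: distrib_right)
  have r3: "1 / X ^ 13 + h \<le> 1 / X ^ 12"
  proof -
    have "X ^ 13 \<le> X ^ 14" by (rule power_increasing) (use X in auto)
    then have "1 / X ^ 14 \<le> 1 / X ^ 13" using X by (intro divide_left_mono mult_pos_pos zero_less_power) auto
    moreover have "2 * (1 / X ^ 13) \<le> X * (1 / X ^ 13)" using X by (intro mult_right_mono) auto
    moreover have "X * (1 / X ^ 13) = 1 / X ^ 12" using X power_Suc[of X 12] by (simp add: field_simps)
    ultimately show ?thesis using h14 by linarith
  qed
  then have r4: "1 / X ^ 13 \<le> \<rho>" using r2 by linarith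
  have L2: "2 \<le> L"
  proof (rule ccontr)
    assume "\<not> 2 \<le> L"
    then have "real L \<le> 1" by simp
    then have "\<rho> \<le> h" unfolding \<rho>_def using h0 by (simp add: mult_le_cancel_right1)
    moreover have "1 / X ^ 14 < 1 / X ^ 13"
    proof -
      have "X ^ 13 < X ^ 14" by (rule power_strict_increasing) (use X in auto)
      then show ?thesis using X by (intro divide_strict_left_mono mult_pos_pos zero_less_power) auto
    qed
    ultimately show False using h14 r4 by linarith
  qed
  have par: "parameters X \<rho> h p w C1 C2 k R ((k + 1) * R ^ (k + 1))"
    by unfold_locales (use X k h0 hX w hw r1 r4 in \<open>auto simp: X_def p_def C1_def C2_def R_def\<close>)
  interpret P: parameters X \<rho> h p w C1 C2 k R "(k + 1) * R ^ (k + 1)" by (rule par)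
  obtain key :: "nat set \<Rightarrow> nat" where key: "inj_on key (all_edges n)" "key ` all_edges n \<subseteq> {..<n ^ 2}"
    using ex_edge_key by blast
  interpret tracker n key L k \<Lambda> by unfold_locales (rule key)
  have C1p: "1 \<le> C1" unfolding C1_def by (rule Xp)
  have mono: "mono \<Lambda>"
    unfolding \<Lambda>_def by (intro monoI add_left_mono nat_mono ceiling_mono mult_left_mono) (use C1p h0 in auto)
  have wh: "w \<le> h"
  proof -
    have "1 * w \<le> X ^ (25 * k) * w" by (intro mult_right_mono Xp(2) w)
    then show ?thesis using hw unfolding X_def by simp
  qed
  \<comment> \<open>The alphabet has at most 16 s n^6 letters, and the sample size s = x^(30 k) is
    at most 2^(30 k x).\<close>
  define a where "a = 4 + 30 * k * x + 6 * nat \<lceil>log 2 (real n)\<rceil>"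
  let ?\<Gamma> = "{..<s} \<times> {..<4::nat} \<times> {..n ^ 2} \<times> {..n ^ 4}"
  have lg: "0 \<le> log 2 (real n)" using n by simp
  have card\<Gamma>: "card ?\<Gamma> \<le> 2 ^ a"
  proof -
    have n2: "n \<le> 2 ^ nat \<lceil>log 2 (real n)\<rceil>" by (rule le_two_power_log[OF n])
    have "x ^ (30 * k) \<le> (2 ^ x) ^ (30 * k)" by (rule power_mono[OF less_imp_le[OF less_exp]]) simp
    then have s2: "s \<le> 2 ^ (30 * k * x)" unfolding s_def by (simp add: power_mult[symmetric] mult.commute)
    have n1: "1 \<le> n ^ e" for e using n by simp
    have "card ?\<Gamma> = s * (4 * ((n ^ 2 + 1) * (n ^ 4 + 1)))" by (simp add: card_cartesian_product)
    also have "\<dots> \<le> s * (4 * ((2 * n ^ 2) * (2 * n ^ 4)))"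
      using n1[of 2] n1[of 4] by (intro mult_le_mono order_refl) auto
    also have "\<dots> = 2 ^ 4 * s * n ^ 6" by (simp add: power_add[symmetric])
    also have "\<dots> \<le> 2 ^ 4 * 2 ^ (30 * k * x) * (2 ^ nat \<lceil>log 2 (real n)\<rceil>) ^ 6"
      by (intro mult_le_mono order_refl s2 power_mono n2) simp
    also have "\<dots> = 2 ^ a" unfolding a_def by (simp add: power_add power_mult[symmetric] mult.commute)
    finally show ?thesis .
  qed
  have a_bound: "real a \<le> 4 + 30 * real k * X + 6 * (log 2 (real n) + 1)"
  proof -
    have "real (nat \<lceil>log 2 (real n)\<rceil>) \<le> log 2 (real n) + 1" using lg by linarith
    then show ?thesis unfolding a_def X_def by simp
  qed
  have fin\<Gamma>: "finite ?\<Gamma>" by simp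
  obtain enc :: "(nat \<times> nat \<times> nat \<times> nat) set \<Rightarrow> bool list" where enc0: "inj_on enc (Pow ?\<Gamma>) \<and> (\<forall>Y\<subseteq>?\<Gamma>. length (enc Y) \<le> (a + 1) * card Y)"
    using ex_set_encoding[OF fin\<Gamma> card\<Gamma>] by blast
  note enc = conjunct1[OF enc0] mp[OF spec[OF conjunct2[OF enc0]]]
  let ?G = "storable n s (n ^ 4)"
  have sub\<Gamma>: "all_letters key ts \<subseteq> ?\<Gamma>" if "ts \<in> ?G" for ts by (rule storable_alphabet[OF key(2) that])
  have inj: "inj_on (\<lambda>ts. enc (all_letters key ts)) ?G"
  proof (rule inj_onI)
    fix ts ts' assume *: "ts \<in> ?G" "ts' \<in> ?G" "enc (all_letters key ts) = enc (all_letters key ts')"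
    then have "all_letters key ts = all_letters key ts'" 
      by (intro inj_onD[OF enc(1)] PowI sub\<Gamma>)
    then show "ts = ts'" by (rule inj_onD[OF inj_on_all_letters[OF key(1)] _ *(1,2)])
  qed
  define init where "init = map_pmf (map (\<lambda>v. (v, 0::nat, False, {} :: (nat set \<times> nat) set))) (replicate_pmf s (pmf_of_set {..<n}))"
  define out where "out ts = real n / real s * sum_list (map (estimate \<rho>) ts)" for ts
  define A where "A = machine_algorithm init (all_steps step N) out (\<lambda>ts. enc (all_letters key ts)) ?G"
  have setp: "set_pmf (pmf_of_set {..<n}) = {..<n}" using n by (intro set_pmf_of_set) (auto simp: lessThan_empty_iff)
  show ?thesis
  proof (intro exI[of _ A] allI impI, elim conjE)
    fix E \<B> \<sigma> assume g: "simple_graph n E" and adv: "hidden_batch_adversary b w \<kappa> n E \<B> \<sigma>"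
    interpret H: hidden_stream n key L k \<Lambda> E \<B> \<sigma> b \<kappa> N R w h \<rho> p C1 C2
    proof unfold_locales
      show "p < 1" using P.p_half by simp
      show "0 < C2" unfolding C2_def by (rule Xp)
      show "4 * C2 \<le> C1 * \<rho>" by (rule P.C_condition)
    qed (use n k g adv N L2 w wh h_def \<rho>_def p_def \<Lambda>_def R_def in auto)
    let ?xs = "\<lambda>t. presented \<kappa> n (\<sigma> t)" and ?box = "\<Pi>\<^sub>E B\<in>\<B>. {0..1::real}"
    have mE: "card E \<le> n ^ 2"
      using card_mono[OF finite_all_edges H.E] card_all_edges_le[of n] by linarith
    have fold: "foldl (all_steps step N) (map (\<lambda>v. (v, 0, False, {})) vs) xs
        = map (\<lambda>v. foldl step (v, 0, False, {}) (map (to_cell N) xs)) vs" for vs xs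
      by (simp add: foldl_all_steps)
    have tr: "v' = v" "cnt \<le> card E" "finite r" "r \<subseteq> all_edges n \<times> {..n ^ 4}" "card r \<le> (k + 1) * \<Lambda> cnt"
      if t: "t \<in> ?box" and st: "foldl step (v, 0, False, {}) (map (to_cell N) (take i (?xs t))) = (v', cnt, dead, r)"
      for t i v v' cnt dead r
    proof -
      have us: "map (to_cell N) (take i (?xs t)) = take i (H.us t)" by (simp add: H.us_def take_map)
      note pr = H.us_properties[OF t]
      have d: "distinct (map fst (take i (H.us t)))" using pr(1) by (simp add: take_map[symmetric])
      have sb: "fst ` set (take i (H.us t)) \<subseteq> all_edges n"
        using pr(2) H.E set_take_subset[of i "H.us t"] by blast
      note F = foldl_retained[OF mono d sb st[unfolded us]]
      show "v' = v" "card r \<le> (k + 1) * \<Lambda> cnt" using F by blast+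
      have "length (H.us t) = card E" using box_presented(3)[OF adv t] by (simp add: H.us_def)
      then show "cnt \<le> card E" using F(2) by simp
      show "finite r" by (rule finite_subset[OF F(3)]) simp
      \<comment> \<open>Retained cells start before time \<open>p \<le> 1\<close>, and a cell has
        length at least n^(-4).\<close>
      have "c \<le> n ^ 4" if "(e, c) \<in> r" for e c
      proof -
        have "c div L < k + 1" using F(5) that by fastforce
        then have "c < (k + 1) * L" by (subst (asm) div_less_iff_less_mult) (use L2 in auto)
        then have "real c \<le> real ((k + 1) * L)" by (simp only: of_nat_le_iff less_imp_le)
        then have "real c \<le> (real k + 1) * real L" by (simp add: algebra_simps)
        then have "real c * h \<le> (real k + 1) * real L * h" using h0 by (intro mult_right_mono) auto
        also have "\<dots> = p" by (simp add: p_def \<rho>_def mult.assoc)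
        also have "\<dots> \<le> 1" using P.p_half by simp
        also have "\<dots> \<le> real n ^ 4 * h" using hn(1) by (simp add: mult.commute)
        finally have "real c \<le> real n ^ 4" using h0 by simp
        then show "c \<le> n ^ 4" by (metis of_nat_le_iff of_nat_power)
      qed
      moreover have "e \<in> all_edges n" if "(e, c) \<in> r" for e c using F(3) sb that by force
      ultimately show "r \<subseteq> all_edges n \<times> {..n ^ 4}" by auto
    qed
    have state: "foldl (all_steps step N) ts (take i (?xs t)) \<in> ?G \<and>
        (\<forall>T\<in>set (foldl (all_steps step N) ts (take i (?xs t))).
           finite (snd (snd (snd T))) \<and> card (snd (snd (snd T))) \<le> (k + 1) * \<Lambda> (card E))"
      if ts: "ts \<in> set_pmf init" and t: "t \<in> ?box" for ts t i
    proof -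
      obtain vs where vs: "ts = map (\<lambda>v. (v, 0, False, {})) vs" "length vs = s" "set vs \<subseteq> {..<n}"
        using ts unfolding init_def by (auto simp: set_replicate_pmf setp)
      have T: "v \<le> n ^ 2 \<and> cnt \<le> n ^ 2 \<and> finite r \<and> r \<subseteq> all_edges n \<times> {..n ^ 4} \<and> card r \<le> (k + 1) * \<Lambda> (card E)"
        if mem: "(v, cnt, dead, r) \<in> set (foldl (all_steps step N) ts (take i (?xs t)))" for v cnt dead r
      proof -
        obtain v0 where v0: "v0 < n" "foldl step (v0, 0, False, {}) (map (to_cell N) (take i (?xs t))) = (v, cnt, dead, r)"
          using mem vs(3) unfolding vs(1) fold by auto
        note q = tr[OF t v0(2)]
        have "n \<le> n ^ 2" by (simp add: power2_eq_square)
        moreover have "\<Lambda> cnt \<le> \<Lambda> (card E)" by (rule monoD[OF mono q(2)])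
        then have "(k + 1) * \<Lambda> cnt \<le> (k + 1) * \<Lambda> (card E)" by (rule mult_le_mono2)
        ultimately show ?thesis using q v0(1) mE by auto
      qed
      have "length (foldl (all_steps step N) ts (take i (?xs t))) = s" unfolding vs(1) fold using vs(2) by simp
      then have "foldl (all_steps step N) ts (take i (?xs t)) \<in> ?G"
        unfolding storable_def
      proof (intro CollectI conjI ballI)
        fix T0 assume T0: "T0 \<in> set (foldl (all_steps step N) ts (take i (?xs t)))"
        obtain v cnt dead r where "T0 = (v, cnt, dead, r)" by (cases T0)
        then show "case T0 of (v, cnt, dead, r) \<Rightarrow> v \<le> n ^ 2 \<and> cnt \<le> n ^ 2 \<and> finite r \<and> r \<subseteq> all_edges n \<times> {..n ^ 4}"
          using T[of v cnt dead r] T0 by simp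
      qed
      moreover have "finite (snd (snd (snd T))) \<and> card (snd (snd (snd T))) \<le> (k + 1) * \<Lambda> (card E)"
        if "T \<in> set (foldl (all_steps step N) ts (take i (?xs t)))" for T
        using T[of "fst T" "fst (snd T)" "fst (snd (snd T))" "snd (snd (snd T))"] that by simp
      ultimately show ?thesis by blast
    qed
    have 1: "1 - \<delta> \<le> measure (estimate_distribution A \<kappa> n \<B> \<sigma>) {c. \<bar>c - real (num_components n E)\<bar> \<le> \<epsilon> * real n}"
      unfolding estimate_distribution_def
    proof (rule H.estimate_accuracy[where \<theta> = "1 / (8 * X)" and s = s])
      show "0 < \<epsilon>" "4 \<le> \<epsilon> * real k" by (rule \<epsilon>)+
      show "0 < 1 / (8 * X)" using X by simp
      show "16 * (1 / (8 * X)) \<le> 3 * \<epsilon> * \<delta>" using \<delta> X by (simp add: X_def divide_le_eq)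
      have sX: "real s = X ^ (30 * k)" by (simp add: s_def X_def)
      have "1 \<le> real s" unfolding sX by (rule Xp)
      then show "1 \<le> s" by simp
      show "((1 / \<rho>) ^ k)\<^sup>2 \<le> real s * (1 / (8 * X))\<^sup>2" unfolding sX by (rule P.sample_size)
      show "real n * real (k * b * k) * ((1 / \<rho>) ^ k)\<^sup>2 \<le> (1 / (8 * X) * real n)\<^sup>2"
        by (rule P.variance) (use bn in \<open>simp add: X_def\<close>)
      show "real k * p * (1 / (1 - p)) ^ k \<le> 1 / (8 * X)" by (rule P.false_error)
      have "H.\<beta> = P.B" unfolding H.\<beta>_def H.Q_def P.B_def ..
      then show "(1 / \<rho>) ^ k * H.\<beta> \<le> 1 / (8 * X)" using P.B_error by simp
      show "(\<lambda>t. measure_pmf (map_pmf (alg_output A) (run A (?xs t)))) \<in> start_times \<B> \<rightarrow>\<^sub>M subprob_algebra (count_space UNIV)"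
        by (rule estimate_kernel[OF adv, of "\<lambda>xs. map_pmf (alg_output A) (run A xs)"])
      fix t assume t: "t \<in> ?box"
      have "map_pmf (alg_output A) (run A (?xs t)) = map_pmf (\<lambda>ts. out (foldl (all_steps step N) ts (?xs t))) init"
        unfolding A_def by (rule output_machine_algorithm[OF inj]) (use state[OF _ t] in blast)
      also have "\<dots> = map_pmf (\<lambda>vs. real n / real s * sum_list (map (\<lambda>v. H.weight_of v t) vs)) (replicate_pmf s (pmf_of_set {..<n}))"
      proof -
        have "out (foldl (all_steps step N) (map (\<lambda>v. (v, 0, False, {})) vs) (?xs t))
            = real n / real s * sum_list (map (\<lambda>v. H.weight_of v t) vs)" for vs
          unfolding out_def fold H.weight_of_def H.us_def map_map o_def by (rule refl)
        then show ?thesis unfolding init_def pmf.map_comp o_def by (intro map_pmf_cong refl)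
      qed
      finally show "measure_pmf (map_pmf (alg_output A) (run A (?xs t))) = measure_pmf (map_pmf
          (\<lambda>vs. real n / real s * sum_list (map (\<lambda>v. H.weight_of v t) vs)) (replicate_pmf s (pmf_of_set {..<n})))"
        by simp
    qed
    have 2: "space_at_most A (?xs t) (X ^ (102 * k) * (71 * (1 + log 2 (real n))) * (real b + w * real (card E)))"
      if t: "t \<in> ?box" for t
      unfolding A_def
    proof (rule space_machine_algorithm[OF inj])
      fix ts i assume ts: "ts \<in> set_pmf init"
      let ?ts = "foldl (all_steps step N) ts (take i (?xs t))"
      note q = state[OF ts t, of i]
      then show G: "?ts \<in> ?G" by blast
      have "length ?ts = s" using G by (simp add: storable_def)
      then have "card (all_letters key ?ts) \<le> s * (3 + (k + 1) * \<Lambda> (card E))"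
        using card_all_letters[of ?ts "(k + 1) * \<Lambda> (card E)" key] q by simp
      then have "real ((a + 1) * card (all_letters key ?ts))
          \<le> X ^ (102 * k) * (71 * (1 + log 2 (real n))) * (real b + w * real (card E))"
        by (intro P.space_bound[where cnt = "card E" and \<Lambda> = "\<Lambda> (card E)" and s = s])
           (use n b hn(2) mE a_bound in \<open>auto simp: X_def s_def \<Lambda>_def\<close>)
      moreover have "real (length (enc (all_letters key ?ts))) \<le> real ((a + 1) * card (all_letters key ?ts))"
        using enc(2)[OF sub\<Gamma>[OF G]] by (simp only: of_nat_le_iff)
      ultimately show "real (length (enc (all_letters key ?ts)))
          \<le> X ^ (102 * k) * (71 * (1 + log 2 (real n))) * (real b + w * real (card E))" by linarith
    qed
    show "1 - \<delta> \<le> measure (estimate_distribution A \<kappa> n \<B> \<sigma>) {c. \<bar>c - real (num_components n E)\<bar> \<le> \<epsilon> * real n} \<and>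
      (\<forall>t\<in>?box. space_at_most A (?xs t)
         (real x ^ (102 * k) * (71 * (1 + log 2 (real n))) * (real b + w * real (card E))))"
      using 1 2 unfolding X_def by blast
  qed
qed

section \<open>Choice of the constants and combination of the two algorithms\<close>

lemma space_at_most_mono: "space_at_most A xs S \<Longrightarrow> S \<le> S' \<Longrightarrow> space_at_most A xs S'"
  unfolding space_at_most_def by (meson order_trans)

text \<open>Here and in \<open>base\<close>, capping \<epsilon> and \<delta> at 1/2 ensures the
  lower bounds 8 on \<open>k\<close> and 4 on \<open>X\<close> that \<open>parameters\<close>
  demands.\<close>

definition tree_size :: "real \<Rightarrow> nat" where
  "tree_size \<epsilon> = nat \<lceil>4 / min \<epsilon> (1 / 2)\<rceil>"

definition base :: "real \<Rightarrow> real \<Rightarrow> nat" where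
  "base \<epsilon> \<delta> = nat \<lceil>1 / (min \<epsilon> (1 / 2) * min \<delta> (1 / 2))\<rceil>"

lemma parameter_choice:
  assumes "0 < \<epsilon>" "0 < \<delta>"
  defines "k \<equiv> tree_size \<epsilon>" and "x \<equiv> base \<epsilon> \<delta>"
  shows "4 \<le> x" "8 \<le> k" "k \<le> 2 * x" "4 \<le> \<epsilon> * real k" "2 \<le> 3 * \<epsilon> * \<delta> * real x"
    "real k \<le> 4 / min \<epsilon> (1 / 2) + 1" "real x \<le> 1 / (min \<epsilon> (1 / 2) * min \<delta> (1 / 2)) + 1"
proof -
  define e d where "e = min \<epsilon> (1 / 2)" and "d = min \<delta> (1 / 2)"
  have e: "0 < e" "e \<le> 1 / 2" "e \<le> \<epsilon>" and d: "0 < d" "d \<le> 1 / 2" "d \<le> \<delta>"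
    using assms(1,2) by (auto simp: e_def d_def)
  have k: "4 / e \<le> real k" "real k \<le> 4 / e + 1"
  proof -
    have "0 \<le> 4 / e" using e by simp
    then show "4 / e \<le> real k" "real k \<le> 4 / e + 1" unfolding k_def tree_size_def e_def[symmetric] by linarith+
  qed
  have ed: "0 < e * d" using e d by simp
  have x: "1 / (e * d) \<le> real x" "real x \<le> 1 / (e * d) + 1"
  proof -
    have "0 \<le> 1 / (e * d)" using ed by simp
    then show "1 / (e * d) \<le> real x" "real x \<le> 1 / (e * d) + 1"
      unfolding x_def base_def e_def[symmetric] d_def[symmetric] by linarith+
  qed
  show "real k \<le> 4 / min \<epsilon> (1 / 2) + 1" using k unfolding e_def by blast
  show "real x \<le> 1 / (min \<epsilon> (1 / 2) * min \<delta> (1 / 2)) + 1" using x unfolding e_def d_def by blast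
  have "8 \<le> 4 / e" using e by (simp add: pos_le_divide_eq)
  then have "8 \<le> real k" using k by linarith
  then show "8 \<le> k" by simp
  have "e * d \<le> 1 / 2 * (1 / 2)" using e d by (intro mult_mono) auto
  then have "4 \<le> 1 / (e * d)" using ed by (simp add: pos_le_divide_eq)
  then have "4 \<le> real x" using x by linarith
  then show "4 \<le> x" by simp
  have "4 / e \<le> 2 * (1 / (e * d))"
  proof -
    have "2 \<le> 1 / d" using d by (simp add: pos_le_divide_eq)
    then have "2 / e * 2 \<le> 2 / e * (1 / d)" using e by (intro mult_left_mono) auto
    then show ?thesis by simp
  qed
  then have "4 / e \<le> of_int (int (2 * x))" using x by simp
  then have "\<lceil>4 / e\<rceil> \<le> int (2 * x)" by (rule ceiling_le)
  then show "k \<le> 2 * x" unfolding k_def tree_size_def e_def[symmetric] by linarith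
  have "4 \<le> e * real k" using k(1) e by (simp add: pos_divide_le_eq mult.commute)
  also have "\<dots> \<le> \<epsilon> * real k" using e by (intro mult_right_mono) auto
  finally show "4 \<le> \<epsilon> * real k" .
  have "1 \<le> (e * d) * real x" using x(1) ed by (simp add: pos_divide_le_eq mult.commute)
  also have "\<dots> \<le> (\<epsilon> * \<delta>) * real x" using e d by (intro mult_right_mono mult_mono) auto
  finally show "2 \<le> 3 * \<epsilon> * \<delta> * real x" by (simp add: mult.assoc)
qed

text \<open>If \<epsilon> \<le> 1/2, then y = 1/(\<epsilon>\<delta>) is at least 2 and powers of y
  absorb constants: X \<le> y^3 and k \<le> 5/\<epsilon> give the exponent 102 * 3 * 5 = 1530. If
  \<epsilon> > 1/2, y may be close to 1, but then the exponent is the fixed number 102 * 8 = 816 and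
  X \<le> 8 y costs only a constant factor.\<close>

lemma space_factor:
  assumes \<epsilon>: "0 < \<epsilon>" "\<epsilon> < 1" and \<delta>: "0 < \<delta>" "\<delta> < 1"
  shows "real (base \<epsilon> \<delta>) ^ (102 * tree_size \<epsilon>) \<le> 8 ^ 816 * (1 / (\<epsilon> * \<delta>)) powr (1530 / \<epsilon>)"
proof -
  define c :: real where "c = 8 ^ 816"
  define y where "y = 1 / (\<epsilon> * \<delta>)"
  define X where "X = real (base \<epsilon> \<delta>)"
  note pc = parameter_choice[OF \<epsilon>(1) \<delta>(1)]
  have c1: "1 \<le> c" unfolding c_def by (rule one_le_power) simp
  have ed: "0 < \<epsilon> * \<delta>" using \<epsilon> \<delta> by simp
  have "\<epsilon> * \<delta> \<le> 1 * 1" using \<epsilon> \<delta> by (intro mult_mono) auto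
  then have y1: "1 \<le> y" unfolding y_def using ed by (simp add: pos_le_divide_eq)
  have d2: "\<delta> / 2 \<le> min \<delta> (1 / 2)" using \<delta> by auto
  have X0: "0 \<le> X" by (simp add: X_def)
  have "X ^ (102 * tree_size \<epsilon>) \<le> c * y powr (1530 / \<epsilon>)"
  proof (cases "\<epsilon> \<le> 1 / 2")
    case True
    then have me: "min \<epsilon> (1 / 2) = \<epsilon>" by simp
    have "\<epsilon> * \<delta> \<le> 1 / 2 * 1" using True \<epsilon> \<delta> by (intro mult_mono) auto
    then have y2: "2 \<le> y" unfolding y_def using ed by (simp add: pos_le_divide_eq)
    have "1 / (\<epsilon> * min \<delta> (1 / 2)) \<le> 1 / (\<epsilon> * (\<delta> / 2))"
      using d2 \<epsilon> \<delta> by (intro divide_left_mono mult_left_mono mult_pos_pos) auto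
    also have "\<dots> = 2 * y" unfolding y_def by simp
    finally have "X \<le> 2 * y + 1" using pc(7) unfolding X_def me by linarith
    then have "X \<le> 4 * y" using y1 by linarith
    also have "\<dots> \<le> y ^ 2 * y"
    proof (rule mult_right_mono)
      have "2 ^ 2 \<le> y ^ 2" using y2 by (intro power_mono) auto
      then show "4 \<le> y ^ 2" by simp
    qed (use y1 in simp)
    also have "\<dots> = y ^ 3" by (simp add: power3_eq_cube power2_eq_square)
    finally have Xy: "X \<le> y ^ 3" .
    have "X ^ (102 * tree_size \<epsilon>) \<le> (y ^ 3) ^ (102 * tree_size \<epsilon>)" by (rule power_mono[OF Xy X0])
    also have "\<dots> = y ^ (306 * tree_size \<epsilon>)" by (simp add: power_mult[symmetric])
    also have "\<dots> = y powr real (306 * tree_size \<epsilon>)"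
      by (rule powr_realpow[symmetric]) (use y1 in simp)
    also have "\<dots> \<le> y powr (1530 / \<epsilon>)"
    proof (rule powr_mono[OF _ y1])
      have "1 \<le> 1 / \<epsilon>" using \<epsilon> by simp
      then have "real (tree_size \<epsilon>) \<le> 5 * (1 / \<epsilon>)" using pc(6) unfolding me by simp
      then show "real (306 * tree_size \<epsilon>) \<le> 1530 / \<epsilon>" by simp
    qed
    also have "\<dots> \<le> c * y powr (1530 / \<epsilon>)" using mult_right_mono[OF c1, of "y powr (1530 / \<epsilon>)"] by simp
    finally show ?thesis .
  next
    case False
    then have me: "min \<epsilon> (1 / 2) = 1 / 2" by simp
    have k: "tree_size \<epsilon> = 8" unfolding tree_size_def me by simp
    have "1 / (1 / 2 * min \<delta> (1 / 2)) \<le> 1 / (1 / 2 * (\<delta> / 2))"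
      using d2 \<delta> by (intro divide_left_mono mult_left_mono mult_pos_pos) auto
    also have "\<dots> = 4 * (1 / \<delta>)" by simp
    also have "1 / \<delta> \<le> y" unfolding y_def
      using \<epsilon> \<delta> ed by (intro divide_left_mono) (auto simp: mult_le_cancel_right1)
    finally have "X \<le> 4 * y + 1" using pc(7) unfolding X_def me by simp
    then have Xy: "X \<le> 8 * y" using y1 by linarith
    have "X ^ (102 * tree_size \<epsilon>) \<le> (8 * y) ^ (102 * tree_size \<epsilon>)" by (rule power_mono[OF Xy X0])
    also have "\<dots> = c * y ^ 816" unfolding k c_def by (simp only: power_mult_distrib) simp
    also have "\<dots> = c * y powr real (816 :: nat)" using y1 powr_realpow[of y 816] by simp
    also have "\<dots> \<le> c * y powr (1530 / \<epsilon>)"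
    proof (intro mult_left_mono powr_mono y1)
      have "1 \<le> 1 / \<epsilon>" using \<epsilon> by simp
      then show "real (816 :: nat) \<le> 1530 / \<epsilon>" by simp
    qed (use c1 in simp)
    finally show ?thesis .
  qed
  then show ?thesis unfolding c_def y_def X_def .
qed

lemma ex_algorithm:
  fixes n b \<kappa> :: nat and w \<epsilon> \<delta> :: real
  assumes \<epsilon>: "0 < \<epsilon>" "\<epsilon> < 1" and \<delta>: "0 < \<delta>" "\<delta> < 1" and b: "1 \<le> b" and w: "0 \<le> w"
    and n: "1 \<le> n" and \<kappa>: "4 \<le> \<kappa>"
  defines "Y \<equiv> real (base \<epsilon> \<delta>) ^ (102 * tree_size \<epsilon>)"
  shows "\<exists>A. \<forall>E \<B> \<sigma>. simple_graph n E \<and> hidden_batch_adversary b w \<kappa> n E \<B> \<sigma> \<longrightarrow>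
    1 - \<delta> \<le> measure (estimate_distribution A \<kappa> n \<B> \<sigma>) {c. \<bar>c - real (num_components n E)\<bar> \<le> \<epsilon> * real n} \<and>
    (\<forall>t \<in> (\<Pi>\<^sub>E B\<in>\<B>. {0..1}). space_at_most A (presented \<kappa> n (\<sigma> t))
       (Y * (71 * (1 + log 2 (real n))) * (real b + w * real (card E))))"
proof -
  define x where "x = base \<epsilon> \<delta>"
  define k where "k = tree_size \<epsilon>"
  define X where "X = real x"
  \<comment> \<open>The first summand makes \<open>h\<close> at least X^(25 k) w, the second at
    least n^(-4), which limits the indices of retained cells. Rounding up costs at most another
    n^(\<kappa> - 4).\<close>
  define N where "N = nat \<lceil>X ^ (25 * k) * w * real n ^ \<kappa>\<rceil> + n ^ (\<kappa> - 4)"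
  define h where "h = real N / real n ^ \<kappa>"
  note pc = parameter_choice[OF \<epsilon>(1) \<delta>(1), folded x_def k_def]
  have X: "4 \<le> X" using pc(1) by (simp add: X_def)
  have Xp: "0 < X ^ e" "1 \<le> X ^ e" for e using X by auto
  have Xm: "X ^ e \<le> X ^ e'" if "e \<le> e'" for e e' using X that by (intro power_increasing) auto
  have np: "0 < real n ^ e" for e using n by simp
  have nn: "real n ^ (\<kappa> - 4) * real n ^ 4 = real n ^ \<kappa>" using \<kappa> by (simp add: power_add[symmetric])
  have "1 \<le> n ^ (\<kappa> - 4)" using n by simp
  then have "1 \<le> N" unfolding N_def by (rule trans_le_add2)
  moreover have "1 \<le> real n ^ (\<kappa> - 4)" using n by simp
  ultimately have N1: "1 \<le> N" "1 \<le> real n ^ (\<kappa> - 4)" by blast+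
  have v0: "0 \<le> X ^ (25 * k) * w * real n ^ \<kappa>" using X w by simp
  have Nl: "X ^ (25 * k) * w * real n ^ \<kappa> \<le> real N" "real n ^ (\<kappa> - 4) \<le> real N"
    "real N \<le> X ^ (25 * k) * w * real n ^ \<kappa> + 2 * real n ^ (\<kappa> - 4)"
  proof -
    have *: "real N = real (nat \<lceil>X ^ (25 * k) * w * real n ^ \<kappa>\<rceil>) + real n ^ (\<kappa> - 4)" unfolding N_def by simp
    have "X ^ (25 * k) * w * real n ^ \<kappa> \<le> real (nat \<lceil>X ^ (25 * k) * w * real n ^ \<kappa>\<rceil>)"
      "real (nat \<lceil>X ^ (25 * k) * w * real n ^ \<kappa>\<rceil>) \<le> X ^ (25 * k) * w * real n ^ \<kappa> + 1"
      using v0 by linarith+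
    then show "X ^ (25 * k) * w * real n ^ \<kappa> \<le> real N" "real n ^ (\<kappa> - 4) \<le> real N"
      "real N \<le> X ^ (25 * k) * w * real n ^ \<kappa> + 2 * real n ^ (\<kappa> - 4)"
      unfolding * using N1(2) by linarith+
  qed
  have hw: "X ^ (25 * k) * w \<le> h" unfolding h_def using Nl(1) pos_le_divide_eq[OF np] by blast
  have h4: "1 \<le> h * real n ^ 4"
  proof -
    have "real n ^ \<kappa> \<le> real N * real n ^ 4" using mult_right_mono[OF Nl(2), of "real n ^ 4"] nn by simp
    then show ?thesis unfolding h_def using np[of \<kappa>] by (simp add: pos_le_divide_eq)
  qed
  have hn: "h \<le> X ^ (25 * k) * w + 2 / real n ^ 4"
  proof -
    have "(X ^ (25 * k) * w + 2 / real n ^ 4) * real n ^ \<kappa> = X ^ (25 * k) * w * real n ^ \<kappa> + 2 * real n ^ (\<kappa> - 4)"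
      unfolding nn[symmetric] using n by (simp add: algebra_simps)
    then show ?thesis unfolding h_def using Nl(3) pos_divide_le_eq[OF np] by metis
  qed
  have lg: "0 \<le> log 2 (real n)" using n by simp
  have Y: "Y = X ^ (102 * k)" unfolding Y_def X_def x_def k_def ..
  show ?thesis
  proof (cases "h \<le> 1 / X ^ (33 * k) \<and> real b * X ^ (30 * k) \<le> real n")
    case True
    show ?thesis
      unfolding Y X_def
      by (rule tracker_algorithm[OF n b w pc(1,2,3) \<epsilon>(1) pc(4,5) h_def N1(1)])
         (use hw h4 hn True in \<open>simp_all add: X_def\<close>)
  next
    case False
    obtain A where A: "\<And>E \<B> \<sigma> b w \<kappa> \<epsilon>. simple_graph n E \<Longrightarrow> hidden_batch_adversary b w \<kappa> n E \<B> \<sigma> \<Longrightarrow> 0 \<le> \<epsilon> \<Longrightarrow>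
      measure (estimate_distribution A \<kappa> n \<B> \<sigma>) {c. \<bar>c - real (num_components n E)\<bar> \<le> \<epsilon> * real n} = 1 \<and>
      (\<forall>t \<in> (\<Pi>\<^sub>E B\<in>\<B>. {0..1}). space_at_most A (presented \<kappa> n (\<sigma> t))
         (3 * (1 + log 2 (real n)) * min (real n) (2 * real (card E))))"
      using forest_algorithm[OF n] by meson
    have le: "min (real n) (2 * real m) \<le> X ^ (102 * k) * (real b + w * real m)" for m
    proof -
      have wm: "0 \<le> w * real m" using w by simp
      have bY: "X ^ e \<le> X ^ (102 * k) * (real b + w * real m)" if "e \<le> 102 * k" for e
      proof -
        have "X ^ e * 1 \<le> X ^ (102 * k) * (real b + w * real m)"
          using Xm[OF that] b wm X by (intro mult_mono) auto
        then show ?thesis by simp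
      qed
      \<comment> \<open>If \<open>h\<close> exceeds X^(-33 k), one of the two summands in its upper
        bound is at least half of that: either \<open>w\<close> is large or \<open>n\<close> is
        small.\<close>
      consider "real n < real b * X ^ (30 * k)" | "1 / (2 * X ^ (33 * k)) \<le> X ^ (25 * k) * w"
        | "1 / (2 * X ^ (33 * k)) \<le> 2 / real n ^ 4"
      proof -
        have "2 * (1 / (2 * X ^ (33 * k))) = 1 / X ^ (33 * k)" by simp
        then show ?thesis using False hn that by linarith
      qed
      then show ?thesis
      proof cases
        case 1
        have "real b * X ^ (30 * k) \<le> (real b + w * real m) * X ^ (102 * k)"
          by (rule mult_mono) (use Xm[of "30 * k" "102 * k"] wm X in auto)
        then show ?thesis using 1 by (simp add: mult.commute min_le_iff_disj)
      next
        case 2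
        have "1 \<le> X ^ (25 * k) * w * (2 * X ^ (33 * k))"
          using 2 pos_divide_le_eq[of "2 * X ^ (33 * k)" 1 "X ^ (25 * k) * w"] Xp(1)[of "33 * k"] by simp
        also have "\<dots> = 2 * w * X ^ (58 * k)"
        proof -
          have "X ^ (25 * k) * X ^ (33 * k) = X ^ (58 * k)" by (simp only: power_add[symmetric]) simp
          then show ?thesis by (simp add: mult_ac)
        qed
        finally have "2 * real m * 1 \<le> 2 * real m * (2 * w * X ^ (58 * k))" by (intro mult_left_mono) auto
        also have "\<dots> = (4 * X ^ (58 * k)) * (w * real m)" by (simp add: mult_ac)
        also have "\<dots> \<le> X ^ (102 * k) * (w * real m)"
        proof (rule mult_right_mono[OF _ wm])
          have "4 * X ^ (58 * k) \<le> X * X ^ (58 * k)" using X by (intro mult_right_mono) auto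
          also have "\<dots> = X ^ Suc (58 * k)" by simp
          also have "\<dots> \<le> X ^ (102 * k)" by (rule Xm) (use pc(2) in simp)
          finally show "4 * X ^ (58 * k) \<le> X ^ (102 * k)" .
        qed
        also have "\<dots> \<le> X ^ (102 * k) * (real b + w * real m)" using X by (intro mult_left_mono) auto
        finally show ?thesis by simp
      next
        case 3
        have "real n ^ 4 \<le> 4 * X ^ (33 * k)"
          using 3 np[of 4] Xp(1)[of "33 * k"] by (simp add: field_simps)
        also have "\<dots> \<le> X * X ^ (33 * k)" using X by (intro mult_right_mono) auto
        also have "\<dots> = X ^ Suc (33 * k)" by simp
        also have "\<dots> \<le> X ^ (102 * k) * (real b + w * real m)" by (rule bY) (use pc(2) in simp)
        finally have "real n ^ 4 \<le> X ^ (102 * k) * (real b + w * real m)" .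
        moreover have "real n \<le> real n ^ 4" using power_increasing[of 1 4 "real n"] n by simp
        ultimately have "real n \<le> X ^ (102 * k) * (real b + w * real m)" by (rule order_trans[rotated])
        then show ?thesis by (rule min.coboundedI1)
      qed
    qed
    show ?thesis
    proof (intro exI[of _ A] allI impI conjI ballI, elim conjE)
      fix E \<B> \<sigma> assume g: "simple_graph n E" and adv: "hidden_batch_adversary b w \<kappa> n E \<B> \<sigma>"
      show "1 - \<delta> \<le> measure (estimate_distribution A \<kappa> n \<B> \<sigma>) {c. \<bar>c - real (num_components n E)\<bar> \<le> \<epsilon> * real n}"
        using A[OF g adv, of \<epsilon>] \<epsilon> \<delta> by simp
    next
      fix E \<B> \<sigma> and t :: "nat set set \<Rightarrow> real"
      assume ga: "simple_graph n E \<and> hidden_batch_adversary b w \<kappa> n E \<B> \<sigma>" and t: "t \<in> (\<Pi>\<^sub>E B\<in>\<B>. {0..1})"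
      have "space_at_most A (presented \<kappa> n (\<sigma> t)) (3 * (1 + log 2 (real n)) * min (real n) (2 * real (card E)))"
        using A[OF conjunct1[OF ga] conjunct2[OF ga], of \<epsilon>] \<epsilon> t by simp
      moreover have "3 * (1 + log 2 (real n)) * min (real n) (2 * real (card E))
          \<le> 71 * (1 + log 2 (real n)) * (X ^ (102 * k) * (real b + w * real (card E)))"
        using le[of "card E"] lg by (intro mult_mono) auto
      ultimately show "space_at_most A (presented \<kappa> n (\<sigma> t)) (Y * (71 * (1 + log 2 (real n))) * (real b + w * real (card E)))"
        unfolding Y by (elim space_at_most_mono) (simp add: mult_ac)
    qed
  qed
qed

theorem mainTheorem4:
  "\<exists>(\<kappa>\<^sub>0 :: nat) (K :: real) (q :: real poly).
     \<forall>\<kappa> \<ge> \<kappa>\<^sub>0. \<forall>(\<epsilon> :: real) (\<delta> :: real) (b :: nat) (w :: real).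
       0 < \<epsilon> \<and> \<epsilon> < 1 \<and> 0 < \<delta> \<and> \<delta> < 1 \<and> 1 \<le> b \<and> 0 \<le> w \<longrightarrow>
       (\<exists>A :: nat \<Rightarrow> streaming_algorithm.
          \<forall>n \<ge> 1. \<forall>E \<B> \<sigma>.
            simple_graph n E \<and> hidden_batch_adversary b w \<kappa> n E \<B> \<sigma> \<longrightarrow>
            measure (estimate_distribution (A n) \<kappa> n \<B> \<sigma>)
              {c. \<bar>c - real (num_components n E)\<bar> \<le> \<epsilon> * real n} \<ge> 1 - \<delta> \<and>
            (\<forall>t \<in> (\<Pi>\<^sub>E B\<in>\<B>. {0..1}).
               space_at_most (A n) (presented \<kappa> n (\<sigma> t))
                 ((1 / (\<epsilon> * \<delta>)) powr (K / \<epsilon>) * (real b + w * real (card E))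
                    * poly q (log 2 (real n)))))"
proof -
  define c :: real where "c = 8 ^ 816"
  \<comment> \<open>The constant from \<open>space_factor\<close> goes into the polynomial, because
    1/(\<epsilon>\<delta>) may be close to 1 and its powers cannot absorb it.\<close>
  define q where "q = [:71 * c, 71 * c:]"
  have main: "\<exists>A :: nat \<Rightarrow> streaming_algorithm.
          \<forall>n \<ge> 1. \<forall>E \<B> \<sigma>.
            simple_graph n E \<and> hidden_batch_adversary b w \<kappa> n E \<B> \<sigma> \<longrightarrow>
            measure (estimate_distribution (A n) \<kappa> n \<B> \<sigma>)
              {c. \<bar>c - real (num_components n E)\<bar> \<le> \<epsilon> * real n} \<ge> 1 - \<delta> \<and>
            (\<forall>t \<in> (\<Pi>\<^sub>E B\<in>\<B>. {0..1}).
               space_at_most (A n) (presented \<kappa> n (\<sigma> t))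
                 ((1 / (\<epsilon> * \<delta>)) powr (1530 / \<epsilon>) * (real b + w * real (card E))
                    * poly q (log 2 (real n))))"
    if \<kappa>: "4 \<le> \<kappa>" and \<epsilon>: "0 < \<epsilon>" "\<epsilon> < 1" and \<delta>: "0 < \<delta>" "\<delta> < 1" and b: "1 \<le> b" and w: "0 \<le> w"
    for \<kappa> b :: nat and \<epsilon> \<delta> w :: real
  proof -
    let ?Y = "real (base \<epsilon> \<delta>) ^ (102 * tree_size \<epsilon>)"
    let ?Q = "\<lambda>n A. \<forall>E \<B> \<sigma>. simple_graph n E \<and> hidden_batch_adversary b w \<kappa> n E \<B> \<sigma> \<longrightarrow>
      1 - \<delta> \<le> measure (estimate_distribution A \<kappa> n \<B> \<sigma>) {c. \<bar>c - real (num_components n E)\<bar> \<le> \<epsilon> * real n} \<and>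
      (\<forall>t \<in> (\<Pi>\<^sub>E B\<in>\<B>. {0..1}). space_at_most A (presented \<kappa> n (\<sigma> t))
         (?Y * (71 * (1 + log 2 (real n))) * (real b + w * real (card E))))"
    have "\<forall>n. \<exists>A. 1 \<le> n \<longrightarrow> ?Q n A" using ex_algorithm[OF \<epsilon> \<delta> b w _ \<kappa>] by blast
    then obtain A where A: "\<And>n. 1 \<le> n \<Longrightarrow> ?Q n (A n)" by metis
    have space: "?Y * (71 * (1 + log 2 (real n))) * (real b + w * real m)
        \<le> (1 / (\<epsilon> * \<delta>)) powr (1530 / \<epsilon>) * (real b + w * real m) * poly q (log 2 (real n))" if "1 \<le> n" for n m :: nat
    proof -
      let ?D = "(71 * (1 + log 2 (real n))) * (real b + w * real m)"
      have "0 \<le> log 2 (real n)" using that by simp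
      then have D: "0 \<le> ?D" using w by simp
      have "?Y * ?D \<le> (c * (1 / (\<epsilon> * \<delta>)) powr (1530 / \<epsilon>)) * ?D"
        unfolding c_def by (rule mult_right_mono[OF space_factor[OF \<epsilon> \<delta>] D])
      moreover have "poly q (log 2 (real n)) = c * (71 * (1 + log 2 (real n)))"
        unfolding q_def by (simp add: algebra_simps)
      ultimately show ?thesis by (simp only: mult_ac)
    qed
    show ?thesis
    proof (intro exI[of _ A] allI impI conjI ballI)
      fix n E \<B> \<sigma> assume n: "1 \<le> n" and ga: "simple_graph n E \<and> hidden_batch_adversary b w \<kappa> n E \<B> \<sigma>"
      note Q = A[OF n, rule_format, OF ga]
      show "1 - \<delta> \<le> measure (estimate_distribution (A n) \<kappa> n \<B> \<sigma>) {c. \<bar>c - real (num_components n E)\<bar> \<le> \<epsilon> * real n}"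
        by (rule conjunct1[OF Q])
      fix t :: "nat set set \<Rightarrow> real" assume "t \<in> (\<Pi>\<^sub>E B\<in>\<B>. {0..1})"
      from space_at_most_mono[OF bspec[OF conjunct2[OF Q] this] space[OF n]]
      show "space_at_most (A n) (presented \<kappa> n (\<sigma> t)) ((1 / (\<epsilon> * \<delta>)) powr (1530 / \<epsilon>) *
          (real b + w * real (card E)) * poly q (log 2 (real n)))" .
    qed
  qed
  show ?thesis
    by (intro exI[of _ 4] exI[of _ 1530] exI[of _ q] allI impI, elim conjE, rule main) assumption+
qed

end
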